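(* Let $(X,\mathcal F)$ be a minimal compact Polish foliated space, let $X_0\subset X$ be the union of the leaves without holonomy, and let $X_{0,\mathrm d}\subset X_0$ be the union of the leaves that are dense and without holonomy. Suppose that all leaves in $X_{0,\mathrm d}$ are equi-coarsely quasi-isometric to each other. Then all leaves in $X_0$ have zero, one, two or a Cantor space of ends, simultaneously (that is, exactly one of the following holds: every leaf in $X_0$ has zero ends; every leaf in $X_0$ has one end; every leaf in $X_0$ has two ends; the end space of every leaf in $X_0$ is a Cantor space).
   Context: Foliated spaces. A (topological) foliated structure $\mathcal F$ of dimension $n$ on a space $X$ is given by an atlas $\{(U_i,\phi_i)\}$, where $\{U_i\}$ is an open cover of $X$ and $\phi_i:U_i\to B_i\times Z_i$ are homeomorphisms, with $B_i\subset\mathbb R^n$ an open ball and $Z_i$ a locally compact Polish space, whose changes of coordinates are locally of the form $\phi_j\phi_i^{-1}(x,z)=(x_{ij}(x,z),h_{ij}(z))$. The sets $\phi_i^{-1}(B_i\times\{z\})$ are the plaques; the leaves are the connected components of $X$ with the (leaf) topology whose basic open sets are the plaques of all foliated charts; each leaf is a connected manifold with the leaf topology. $(X,\mathcal F)$ is a compact Polish foliated space if $X$ is compact, Hausdorff and second countable. It is minimal if every leaf is dense in $X$. Regular atlas and holonomy. A foliated atlas $\mathcal U=\{(U_i,\phi_i)\}$ is regular if: each $(U_i,\phi_i)$ is the restriction of a foliated chart $(\widetilde U_i,\tilde\phi_i)$ with $\overline{U_i}\subset\widetilde U_i$; $\{U_i\}$ is locally finite; and the closure of every plaque of $(U_i,\phi_i)$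 meets at most the closure of one plaque of $(U_j,\phi_j)$, for all $i,j$. Let $p_i:U_i\to Z_i$ be $\phi_i$ followed by the second projection; there are homeomorphisms $h_{ij}:p_i(U_i\cap U_j)\to p_j(U_i\cap U_j)$ with $p_j=h_{ij}p_i$ on $U_i\cap U_j$, generating the holonomy pseudogroup $\mathcal H$ on $\bigsqcup_iZ_i$. The holonomy group of the leaf through $x\in U_i$ is the group of germs at $p_i(x)$ of maps in $\mathcal H$ fixing $p_i(x)$; a leaf is without holonomy if this group is trivial. Leaf metrics. Fix a regular foliated atlas $\mathcal U$. For $x,y$ in the same leaf, $d^*_{\mathcal U}(x,y)=0$ if $x=y$, and otherwise it is the minimum number of $\mathcal U$-plaques whose union is connected and contains $x$ and $y$. In speaking of coarse quasi-isometries, leaves are considered as metric spaces with $d^*_{\mathcal U}$; the notions used do not depend on the choice of $\mathcal U$. Coarse quasi-isometries. For $K\ge0$, $A\subset M$ is a $K$-net in a metric space $M$ if every point of $M$ is at distance $\le K$ from some point of $A$. For $C\ge1$, a $(K,C)$-coarse quasi-isometry of $M$ to $M'$ is a bijection $f:A\to A'$ between $K$-nets $A\subset M$ and $A'\subset M'$ with $\frac1C d(x,y)\le d'(f(x),f(y))\le C\,d(x,y)$ for all $x,y\in A$. The metric spaces in a family are equi-coarsely quasi-isometric to each other if there is a single $(K,C)$ such that any two of them admit a $(K,C)$-coarse quasi-isometry. Ends. The end space of a leaf $L$ (with the leaf topology) is the inverse limit, over compact subsets $K\subset L$, of the discrete spaces of connected components of $L\setminus K$ with non-compact closure. A Cantor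 space is a space homeomorphic to the Cantor set. *)

theory Defs
  imports "HOL-Analysis.Analysis"
begin

section \<open>Foliated spaces\<close>

text \<open>
  A chart is a homeomorphism \<open>chart_map\<close> from \<open>chart_dom\<close> onto the product of an open
  ball \<open>chart_ball\<close> of R^n and a locally compact Polish space \<open>chart_trans\<close>; the values
  of \<open>chart_map\<close> outside \<open>chart_dom\<close> are irrelevant. The transversals of different charts
  are unrelated topologies on subsets of one type. R^n is the library's \<^const>\<open>Euclidean_space\<close>
  (sequences vanishing from index n on), so that n is an ordinary natural number, possibly 0.
\<close>

record ('a, 'z) fol_chart =
  chart_dom :: "'a set"
  chart_map :: "'a \<Rightarrow> (nat \<Rightarrow> real) \<times> 'z"
  chart_ball :: "(nat \<Rightarrow> real) set"
  chart_trans :: "'z topology"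

definition polish_topology :: "'a topology \<Rightarrow> bool" where
  "polish_topology Z \<longleftrightarrow> completely_metrizable_space Z \<and> separable_space Z"

definition open_ball_in_Rn :: "nat \<Rightarrow> (nat \<Rightarrow> real) set \<Rightarrow> bool" where
  "open_ball_in_Rn n B \<longleftrightarrow>
     (\<exists>c \<in> topspace (Euclidean_space n). \<exists>r>0.
        B = {x \<in> topspace (Euclidean_space n). L2_set (\<lambda>i. x i - c i) {..<n} < r})"

definition product_chart :: "'a topology \<Rightarrow> nat \<Rightarrow> ('a, 'z) fol_chart \<Rightarrow> bool" where
  "product_chart X n c \<longleftrightarrow>
     openin X (chart_dom c) \<and>
     open_ball_in_Rn n (chart_ball c) \<and>
     locally_compact_space (chart_trans c) \<and> polish_topology (chart_trans c) \<and>
     homeomorphic_map (subtopology X (chart_dom c))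
       (prod_topology (subtopology (Euclidean_space n) (chart_ball c)) (chart_trans c))
       (chart_map c)"

text \<open>
  Near each point of the overlap, the change of coordinates from c to d has the form
  (x, z) to (g (x, z), h z). Continuity of g and h is then automatic.
\<close>

definition foliated_change :: "'a topology \<Rightarrow> ('a, 'z) fol_chart \<Rightarrow> ('a, 'z) fol_chart \<Rightarrow> bool" where
  "foliated_change X c d \<longleftrightarrow>
     (\<forall>p \<in> chart_dom c \<inter> chart_dom d.
        \<exists>V g h. openin X V \<and> p \<in> V \<and> V \<subseteq> chart_dom c \<inter> chart_dom d \<and>
          (\<forall>q\<in>V. \<forall>x z. chart_map c q = (x, z) \<longrightarrow> chart_map d q = (g (x, z), h z)))"

definition foliated_atlas :: "'a topology \<Rightarrow> nat \<Rightarrow> ('a, 'z) fol_chart set \<Rightarrow> bool" where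
  "foliated_atlas X n \<A> \<longleftrightarrow>
     (\<forall>c\<in>\<A>. product_chart X n c) \<and>
     (\<Union>c\<in>\<A>. chart_dom c) = topspace X \<and>
     (\<forall>c\<in>\<A>. \<forall>d\<in>\<A>. foliated_change X c d)"

text \<open>
  The foliated structure given by an atlas \<open>\<A>\<close> is represented by \<open>\<A>\<close> itself; its
  foliated charts are all charts compatible with \<open>\<A>\<close>.
\<close>

definition foliated_chart ::
  "'a topology \<Rightarrow> nat \<Rightarrow> ('a, 'z) fol_chart set \<Rightarrow> ('a, 'z) fol_chart \<Rightarrow> bool" where
  "foliated_chart X n \<A> c \<longleftrightarrow>
     product_chart X n c \<and> (\<forall>d\<in>\<A>. foliated_change X c d \<and> foliated_change X d c)"

definition transverse_proj :: "('a, 'z) fol_chart \<Rightarrow> 'a \<Rightarrow> 'z" where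
  "transverse_proj c x = snd (chart_map c x)"

definition plaques :: "('a, 'z) fol_chart \<Rightarrow> 'a set set" where
  "plaques c =
     {{x \<in> chart_dom c. chart_map c x \<in> chart_ball c \<times> {z}} | z. z \<in> topspace (chart_trans c)}"

definition leaf_topology :: "'a topology \<Rightarrow> nat \<Rightarrow> ('a, 'z) fol_chart set \<Rightarrow> 'a topology" where
  "leaf_topology X n \<A> = topology_generated_by (\<Union>c \<in> {c. foliated_chart X n \<A> c}. plaques c)"

definition leaves :: "'a topology \<Rightarrow> nat \<Rightarrow> ('a, 'z) fol_chart set \<Rightarrow> 'a set set" where
  "leaves X n \<A> = connected_components_of (leaf_topology X n \<A>)"

definition compact_polish_foliated_space ::
  "'a topology \<Rightarrow> nat \<Rightarrow> ('a, 'z) fol_chart set \<Rightarrow> bool" where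
  "compact_polish_foliated_space X n \<A> \<longleftrightarrow>
     compact_space X \<and> Hausdorff_space X \<and> second_countable X \<and> foliated_atlas X n \<A>"

definition dense_leaf :: "'a topology \<Rightarrow> 'a set \<Rightarrow> bool" where
  "dense_leaf X L \<longleftrightarrow> X closure_of L = topspace X"

definition minimal_foliation :: "'a topology \<Rightarrow> nat \<Rightarrow> ('a, 'z) fol_chart set \<Rightarrow> bool" where
  "minimal_foliation X n \<A> \<longleftrightarrow> (\<forall>L \<in> leaves X n \<A>. dense_leaf X L)"


section \<open>Regular atlases and holonomy\<close>

definition regular_atlas ::
  "'a topology \<Rightarrow> nat \<Rightarrow> ('a, 'z) fol_chart set \<Rightarrow> ('a, 'z) fol_chart set \<Rightarrow> bool" where
  "regular_atlas X n \<A> \<U> \<longleftrightarrow>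
     (\<forall>c\<in>\<U>. foliated_chart X n \<A> c) \<and>
     (\<Union>c\<in>\<U>. chart_dom c) = topspace X \<and>
     (\<forall>c\<in>\<U>. \<exists>c'. foliated_chart X n \<A> c' \<and> X closure_of (chart_dom c) \<subseteq> chart_dom c' \<and>
        (\<forall>x \<in> chart_dom c. chart_map c x = chart_map c' x)) \<and>
     (\<forall>x \<in> topspace X. \<exists>V. openin X V \<and> x \<in> V \<and> finite {c\<in>\<U>. V \<inter> chart_dom c \<noteq> {}}) \<and>
     (\<forall>c\<in>\<U>. \<forall>d\<in>\<U>. \<forall>P \<in> plaques c. \<forall>Q \<in> plaques d. \<forall>Q' \<in> plaques d.
        X closure_of P \<inter> X closure_of Q \<noteq> {} \<and> X closure_of P \<inter> X closure_of Q' \<noteq> {} \<longrightarrow> Q = Q')"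

text \<open>
  Homeomorphisms between open subsets of a space T are represented by their graphs. Thus
  \<open>f O g\<close> is "f, then g", \<open>f\<inverse>\<close> is the inverse map, and \<open>Id_on V O f\<close> is the restriction
  of f to V.
\<close>

definition local_homeo_graph :: "'p topology \<Rightarrow> 'p rel \<Rightarrow> bool" where
  "local_homeo_graph T f \<longleftrightarrow>
     openin T (Domain f) \<and> openin T (Range f) \<and>
     (\<exists>g. f = {(u, g u) | u. u \<in> Domain f} \<and>
          homeomorphic_map (subtopology T (Domain f)) (subtopology T (Range f)) g)"

inductive_set generated_pseudogroup :: "'p topology \<Rightarrow> 'p rel set \<Rightarrow> 'p rel set"
  for T :: "'p topology" and S :: "'p rel set" where
  gen: "f \<in> S \<Longrightarrow> f \<in> generated_pseudogroup T S"
| ident: "openin T V \<Longrightarrow> Id_on V \<in> generated_pseudogroup T S"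
| comp: "f \<in> generated_pseudogroup T S \<Longrightarrow> g \<in> generated_pseudogroup T S
    \<Longrightarrow> f O g \<in> generated_pseudogroup T S"
| inv: "f \<in> generated_pseudogroup T S \<Longrightarrow> f\<inverse> \<in> generated_pseudogroup T S"
| glue: "local_homeo_graph T f
    \<Longrightarrow> (\<And>u. u \<in> Domain f
          \<Longrightarrow> \<exists>V. openin T V \<and> u \<in> V \<and> Id_on V O f \<in> generated_pseudogroup T S)
    \<Longrightarrow> f \<in> generated_pseudogroup T S"

text \<open>Points of the disjoint union of the transversals are pairs (c, z) with z in the
  transversal of c.\<close>

definition transversal :: "('a, 'z) fol_chart set \<Rightarrow> (('a, 'z) fol_chart \<times> 'z) topology" where
  "transversal \<U> = sum_topology chart_trans \<U>"

text \<open>The graph of the elementary holonomy map \<open>h\<^sub>c\<^sub>d\<close>, determined by \<open>p\<^sub>d = h\<^sub>c\<^sub>d p\<^sub>c\<close>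
  on the overlap of c and d.\<close>

definition elementary_holonomy ::
  "('a, 'z) fol_chart \<Rightarrow> ('a, 'z) fol_chart \<Rightarrow> (('a, 'z) fol_chart \<times> 'z) rel" where
  "elementary_holonomy c d =
     {((c, transverse_proj c x), (d, transverse_proj d x)) | x. x \<in> chart_dom c \<inter> chart_dom d}"

definition holonomy_pseudogroup ::
  "('a, 'z) fol_chart set \<Rightarrow> (('a, 'z) fol_chart \<times> 'z) rel set" where
  "holonomy_pseudogroup \<U> =
     generated_pseudogroup (transversal \<U>) {elementary_holonomy c d | c d. c \<in> \<U> \<and> d \<in> \<U>}"

definition holonomy_stabilizer ::
  "('a, 'z) fol_chart set \<Rightarrow> ('a, 'z) fol_chart \<times> 'z \<Rightarrow> (('a, 'z) fol_chart \<times> 'z) rel set" where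
  "holonomy_stabilizer \<U> u = {f \<in> holonomy_pseudogroup \<U>. (u, u) \<in> f}"

definition same_germ ::
  "('a, 'z) fol_chart set \<Rightarrow> ('a, 'z) fol_chart \<times> 'z \<Rightarrow> (('a, 'z) fol_chart \<times> 'z) rel rel" where
  "same_germ \<U> u =
     {(f, g). f \<in> holonomy_stabilizer \<U> u \<and> g \<in> holonomy_stabilizer \<U> u \<and>
        (\<exists>V. openin (transversal \<U>) V \<and> u \<in> V \<and> Id_on V O f = Id_on V O g)}"

text \<open>The set of elements of the holonomy group at u: germs at u, as equivalence classes.
  The group operation is not needed to say that the group is trivial.\<close>

definition holonomy_germs ::
  "('a, 'z) fol_chart set \<Rightarrow> ('a, 'z) fol_chart \<times> 'z \<Rightarrow> (('a, 'z) fol_chart \<times> 'z) rel set set" where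
  "holonomy_germs \<U> u = holonomy_stabilizer \<U> u // same_germ \<U> u"

definition without_holonomy :: "('a, 'z) fol_chart set \<Rightarrow> 'a set \<Rightarrow> bool" where
  "without_holonomy \<U> L \<longleftrightarrow>
     (\<forall>c\<in>\<U>. \<forall>x \<in> L \<inter> chart_dom c.
        holonomy_germs \<U> (c, transverse_proj c x)
          = {same_germ \<U> (c, transverse_proj c x) `` {Id_on (topspace (transversal \<U>))}})"

definition union_without_holonomy ::
  "'a topology \<Rightarrow> nat \<Rightarrow> ('a, 'z) fol_chart set \<Rightarrow> ('a, 'z) fol_chart set \<Rightarrow> 'a set" where
  "union_without_holonomy X n \<A> \<U> = \<Union> {L \<in> leaves X n \<A>. without_holonomy \<U> L}"

definition union_dense_without_holonomy ::
  "'a topology \<Rightarrow> nat \<Rightarrow> ('a, 'z) fol_chart set \<Rightarrow> ('a, 'z) fol_chart set \<Rightarrow> 'a set" where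
  "union_dense_without_holonomy X n \<A> \<U> =
     \<Union> {L \<in> leaves X n \<A>. dense_leaf X L \<and> without_holonomy \<U> L}"


section \<open>Coarse geometry of the leaves\<close>

text \<open>Meaningful for x and y in the same leaf only. Connectedness is in the leaf topology.\<close>

definition leaf_dist ::
  "'a topology \<Rightarrow> nat \<Rightarrow> ('a, 'z) fol_chart set \<Rightarrow> ('a, 'z) fol_chart set \<Rightarrow> 'a \<Rightarrow> 'a \<Rightarrow> real" where
  "leaf_dist X n \<A> \<U> x y =
     (if x = y then 0
      else real (LEAST k. \<exists>\<P>. \<P> \<subseteq> (\<Union>c\<in>\<U>. plaques c) \<and> finite \<P> \<and> card \<P> = k \<and>
             connectedin (leaf_topology X n \<A>) (\<Union>\<P>) \<and> x \<in> \<Union>\<P> \<and> y \<in> \<Union>\<P>))"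

text \<open>Metric spaces are given by a carrier and a distance function on it, as in
  \<^locale>\<open>Metric_space\<close>.\<close>

definition net :: "real \<Rightarrow> 'm set \<Rightarrow> ('m \<Rightarrow> 'm \<Rightarrow> real) \<Rightarrow> 'm set \<Rightarrow> bool" where
  "net K M d A \<longleftrightarrow> A \<subseteq> M \<and> (\<forall>x\<in>M. \<exists>a\<in>A. d x a \<le> K)"

definition coarse_quasi_isometry ::
  "real \<Rightarrow> real \<Rightarrow> 'm set \<Rightarrow> ('m \<Rightarrow> 'm \<Rightarrow> real) \<Rightarrow> 'k set \<Rightarrow> ('k \<Rightarrow> 'k \<Rightarrow> real)
    \<Rightarrow> 'm set \<Rightarrow> 'k set \<Rightarrow> ('m \<Rightarrow> 'k) \<Rightarrow> bool" where
  "coarse_quasi_isometry K C M d M' d' A A' f \<longleftrightarrow>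
     net K M d A \<and> net K M' d' A' \<and> bij_betw f A A' \<and>
     (\<forall>x\<in>A. \<forall>y\<in>A. 1 / C * d x y \<le> d' (f x) (f y) \<and> d' (f x) (f y) \<le> C * d x y)"

definition equi_coarsely_quasi_isometric ::
  "('m set \<times> ('m \<Rightarrow> 'm \<Rightarrow> real)) set \<Rightarrow> bool" where
  "equi_coarsely_quasi_isometric \<M> \<longleftrightarrow>
     (\<exists>K\<ge>0. \<exists>C\<ge>1. \<forall>(M, d) \<in> \<M>. \<forall>(M', d') \<in> \<M>.
        \<exists>A A' f. coarse_quasi_isometry K C M d M' d' A A' f)"


section \<open>Ends\<close>

definition unbounded_components :: "'a topology \<Rightarrow> 'a set \<Rightarrow> 'a set set" where
  "unbounded_components T K =
     {C \<in> connected_components_of (subtopology T (topspace T - K)). \<not> compactin T (T closure_of C)}"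

text \<open>The inverse limit over the compact sets K, as a subspace of the product of discrete
  spaces; for \<open>K \<subseteq> K'\<close> the bonding map sends a component outside K' to the component
  outside K containing it.\<close>

definition end_space :: "'a topology \<Rightarrow> ('a set \<Rightarrow> 'a set) topology" where
  "end_space T =
     subtopology
       (product_topology (\<lambda>K. discrete_topology (unbounded_components T K)) {K. compactin T K})
       {e. \<forall>K K'. compactin T K \<and> compactin T K' \<and> K \<subseteq> K' \<longrightarrow> e K' \<subseteq> e K}"

definition leaf_end_space ::
  "'a topology \<Rightarrow> nat \<Rightarrow> ('a, 'z) fol_chart set \<Rightarrow> 'a set \<Rightarrow> ('a set \<Rightarrow> 'a set) topology" where
  "leaf_end_space X n \<A> L = end_space (subtopology (leaf_topology X n \<A>) L)"

text \<open>The middle-thirds Cantor set.\<close>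

primrec cantor_stage :: "nat \<Rightarrow> real set" where
  "cantor_stage 0 = {0..1}"
| "cantor_stage (Suc k) = (\<lambda>x. x / 3) ` cantor_stage k \<union> (\<lambda>x. (2 + x) / 3) ` cantor_stage k"

definition cantor_set :: "real set" where
  "cantor_set = (\<Inter>k. cantor_stage k)"

definition cantor_space :: "'b topology \<Rightarrow> bool" where
  "cantor_space E \<longleftrightarrow> E homeomorphic_space subtopology euclideanreal cantor_set"

datatype end_type = Zero_Ends | One_End | Two_Ends | Cantor_Ends

primrec has_end_type :: "'b topology \<Rightarrow> end_type \<Rightarrow> bool" where
  "has_end_type E Zero_Ends \<longleftrightarrow> topspace E = {}"
| "has_end_type E One_End \<longleftrightarrow> card (topspace E) = 1"
| "has_end_type E Two_Ends \<longleftrightarrow> card (topspace E) = 2"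
| "has_end_type E Cantor_Ends \<longleftrightarrow> cantor_space E"

end

theory Submission
  imports Defs
begin

text \<open>
  The vertices of the plaque graph are the points of the transversals, two of them being joined
  when their plaques meet; the components of this graph are the leaves. Infinite components of the
  complements of finite sets of plaques correspond to unbounded components of the complements of
  compact sets, and having at least k of the former for some finite set is invariant under coarse
  quasi-isometries. By minimality all leaves without holonomy are dense, so the number of their
  ends, cut off at three, does not depend on the leaf.

  It remains to see that three ends force a Cantor space. For generic points of a transversal the
  plaque graph is locally constant, so the set of those x for which the disc of radius R about x has
  at least three infinite complementary components is relatively closed. By Baire's theorem it
  contains, for some R, all generic points of an open set. By minimality and compactness this open
  set is met at bounded distance from every point of every leaf, so a generic leaf branches
  everywhere at a uniform scale. This passes to the other leaves without holonomy by
  quasi-isometry, and it makes the end space perfect.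
\<close>

section \<open>A characterization of the Cantor set\<close>

text \<open>Discs about nearby points are compared with those at the limit in one direction only.
  That two plaques lie in the same piece of a complement, or that a piece is finite, is visible
  inside some disc of finite radius; that pieces are distinct or infinite never is. Distinct
  infinite pieces at nearby points therefore persist at the limit, but not conversely. This is the
  reason for the relative closedness, and for taking closures in the Baire argument. Trivial
  holonomy alone does not make the plaque graph locally constant, since plaques that do not meet may
  be limits of plaques that do. Hence a stronger generic condition is imposed on one leaf, and the
  remaining leaves without holonomy are reached only through the quasi-isometries. Three is the
  least number that works: one of the pieces around a deep disc may contain everything cut off
  before, and two must remain to split an end. The leaf metric counts plaques with connected union
  rather than steps of a walk. Each of the two distances is bounded by a function of the other,
  which is enough because all radii enter only qualitatively.\<close>

definition ternary_value :: "(nat \<Rightarrow> bool) \<Rightarrow> real" where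
  "ternary_value b = (\<Sum>n. (if b n then 2 else 0) / 3 ^ Suc n)"

lemma summable_ternary: "summable (\<lambda>n. (if b n then 2 else 0) / 3 ^ Suc n :: real)"
proof (rule summable_comparison_test')
  show "summable (\<lambda>n. 2 * (1/3) ^ Suc n :: real)"
    by (intro summable_mult) (simp add: summable_Suc_iff summable_geometric)
  show "norm ((if b n then 2 else 0) / 3 ^ Suc n :: real) \<le> 2 * (1/3) ^ Suc n" for n
    by (simp add: power_divide)
qed

text \<open>The shift on sequences inverts the two contractions that build
  \<open>cantor_stage\<close>; the lemmas on stages, injectivity and closeness are inductions along
  this self-similarity.\<close>

lemma ternary_value_rec:
  "ternary_value b = ((if b 0 then 2 else 0) + ternary_value (\<lambda>n. b (Suc n))) / 3"
proof -
  have "ternary_value b = (if b 0 then 2 else 0) / 3 + (\<Sum>n. (if b (Suc n) then 2 else 0) / 3 ^ Suc (Suc n))"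
    unfolding ternary_value_def using suminf_split_head[OF summable_ternary[of b]] by simp
  also have "(\<Sum>n. (if b (Suc n) then 2 else 0) / 3 ^ Suc (Suc n) :: real) =
      (\<Sum>n. (if b (Suc n) then 2 else 0) / 3 ^ Suc n / 3)"
    by (intro suminf_cong) simp
  also have "\<dots> = ternary_value (\<lambda>n. b (Suc n)) / 3"
    unfolding ternary_value_def by (rule suminf_divide[OF summable_ternary])
  finally show ?thesis by (simp add: add_divide_distrib)
qed

lemma ternary_value_bounds: "0 \<le> ternary_value b" "ternary_value b \<le> 1"
proof -
  show "0 \<le> ternary_value b"
    unfolding ternary_value_def by (intro suminf_nonneg summable_ternary) auto
  have "(\<lambda>n. 2 / 3 * (1/3) ^ n :: real) sums (2 / 3 * (1 / (1 - 1/3)))"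
    by (intro sums_mult geometric_sums) simp
  then have s: "(\<lambda>n. 2 / 3 ^ Suc n :: real) sums 1" by (simp add: power_divide)
  have "ternary_value b \<le> (\<Sum>n. 2 / 3 ^ Suc n)"
    unfolding ternary_value_def
    by (intro suminf_le summable_ternary sums_summable[OF s]) auto
  then show "ternary_value b \<le> 1" using sums_unique[OF s] by simp
qed

lemma ternary_value_in_stage: "ternary_value b \<in> cantor_stage k"
proof (induction k arbitrary: b)
  case 0
  then show ?case using ternary_value_bounds by simp
next
  case (Suc k)
  then show ?case using Suc[of "\<lambda>n. b (Suc n)"] ternary_value_rec[of b] by (auto simp: image_iff)
qed

lemma cantor_stage_bounds: "cantor_stage k \<subseteq> {0..1}"
  by (induction k) auto

text \<open>The point 1/2 lies in the removed middle third, so comparison with it decides which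
  contraction produced y; undoing that contraction stays in the set.\<close>

lemma cantor_set_digit:
  assumes "y \<in> cantor_set"
  shows "\<exists>d. 3 * y - (if d then 2 else 0) \<in> cantor_set"
proof -
  have st: "y \<in> cantor_stage (Suc k)" for k using assms unfolding cantor_set_def by blast
  show ?thesis
  proof (cases "y \<le> 1/2")
    case True
    have "3 * y \<in> cantor_stage k" for k
      using st[of k] True cantor_stage_bounds[of k] by auto
    then have "3 * y - (if False then 2 else 0) \<in> cantor_set" unfolding cantor_set_def by simp
    then show ?thesis ..
  next
    case False
    have "3 * y - 2 \<in> cantor_stage k" for k
    proof -
      consider x where "x \<in> cantor_stage k" "y = x / 3" | x where "x \<in> cantor_stage k" "y = (2 + x) / 3"
        using st[of k] by auto
      then show ?thesis
      proof cases
        case 1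
        then show ?thesis using False cantor_stage_bounds[of k] by auto
      next
        case 2
        have "3 * y - 2 = x" unfolding 2(2) by (simp add: field_simps)
        then show ?thesis using 2(1) by metis
      qed
    qed
    then have "3 * y - (if True then 2 else 0) \<in> cantor_set" unfolding cantor_set_def by simp
    then show ?thesis ..
  qed
qed

lemma range_ternary_value: "range ternary_value = cantor_set"
proof
  show "range ternary_value \<subseteq> cantor_set"
    unfolding cantor_set_def using ternary_value_in_stage by blast
  show "cantor_set \<subseteq> range ternary_value"
  proof
    fix y assume y: "y \<in> cantor_set"
    obtain d where d: "\<And>y. y \<in> cantor_set \<Longrightarrow> 3 * y - (if d y then 2 else 0) \<in> cantor_set"
      using cantor_set_digit by metis
    define t where "t = rec_nat y (\<lambda>_ x. 3 * x - (if d x then 2 else 0))"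
    have t: "t 0 = y" "\<And>n. t (Suc n) = 3 * t n - (if d (t n) then 2 else 0)"
      unfolding t_def by simp_all
    have tc: "t n \<in> cantor_set" for n by (induction n) (use t y d in auto)
    have tb: "0 \<le> t n" "t n \<le> 1" for n
    proof -
      have "t n \<in> cantor_stage 0" using tc[of n] unfolding cantor_set_def by blast
      then show "0 \<le> t n" "t n \<le> 1" by simp_all
    qed
    let ?a = "\<lambda>n. (if d (t n) then 2 else 0) / 3 ^ Suc n :: real"
    \<comment> \<open>Invariant of the digit expansion: the remainder \<open>t n\<close>, scaled
      down by the n-th power of 3, is what the first n digits miss.\<close>
    have part: "(\<Sum>i<n. ?a i) = y - t n / 3 ^ n" for n
      by (induction n) (auto simp: t field_simps)
    have "(\<lambda>n. t n / 3 ^ n) \<longlonglongrightarrow> 0"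
    proof (rule Lim_null_comparison)
      show "\<forall>\<^sub>F n in sequentially. norm (t n / 3 ^ n) \<le> (1/3) ^ n"
        using tb by (intro always_eventually) (auto simp: power_divide divide_right_mono)
    qed (rule LIMSEQ_power_zero, simp)
    then have "(\<lambda>n. y - t n / 3 ^ n) \<longlonglongrightarrow> y - 0" by (intro tendsto_diff tendsto_const)
    then have "?a sums y" unfolding sums_def part by simp
    then have "ternary_value (\<lambda>n. d (t n)) = y" unfolding ternary_value_def by (simp add: sums_iff)
    then show "y \<in> range ternary_value" by blast
  qed
qed

text \<open>By the bounds, the two choices of first digit give values in the disjoint intervals
  [0, 1/3] and [2/3, 1].\<close>

lemma ternary_value_inject: assumes "ternary_value b = ternary_value c" shows "b = c"
proof
  have hd: "b 0 = c 0 \<and> ternary_value (\<lambda>n. b (Suc n)) = ternary_value (\<lambda>n. c (Suc n))"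
    if "ternary_value b = ternary_value c" for b c
    using that ternary_value_rec[of b] ternary_value_rec[of c]
      ternary_value_bounds[of "\<lambda>n. b (Suc n)"] ternary_value_bounds[of "\<lambda>n. c (Suc n)"]
    by (auto split: if_splits)
  show "b n = c n" for n using assms
  proof (induction n arbitrary: b c)
    case (Suc n)
    then show ?case using hd[of b c] Suc.IH[of "\<lambda>n. b (Suc n)" "\<lambda>n. c (Suc n)"] by blast
  qed (use hd in blast)
qed

lemma ternary_value_close:
  assumes "\<And>i. i < n \<Longrightarrow> b i = c i" shows "\<bar>ternary_value b - ternary_value c\<bar> \<le> (1/3) ^ n"
  using assms
proof (induction n arbitrary: b c)
  case 0
  then show ?case using ternary_value_bounds[of b] ternary_value_bounds[of c] by simp
next
  case (Suc n)
  have "\<bar>ternary_value (\<lambda>n. b (Suc n)) - ternary_value (\<lambda>n. c (Suc n))\<bar> \<le> (1/3) ^ n"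
    using Suc by simp
  moreover have "ternary_value b - ternary_value c
      = (ternary_value (\<lambda>n. b (Suc n)) - ternary_value (\<lambda>n. c (Suc n))) / 3"
    using ternary_value_rec[of b] ternary_value_rec[of c] Suc.prems[of 0] by (simp add: field_simps)
  then have "\<bar>ternary_value b - ternary_value c\<bar>
      = \<bar>ternary_value (\<lambda>n. b (Suc n)) - ternary_value (\<lambda>n. c (Suc n))\<bar> / 3"
    by (simp only: abs_divide)
  ultimately show ?case by simp
qed

text \<open>Brouwer's characterization of the Cantor set: zero-dimensionality enters as a countable
  separating family of clopen sets, perfectness as the absence of open singletons.\<close>

locale clopen_coding =
  fixes E :: "'b topology" and A :: "nat \<Rightarrow> 'b set"
  assumes compact: "compact_space E" and nonempty: "topspace E \<noteq> {}"
    and clopen: "\<And>n. openin E (A n)" "\<And>n. closedin E (A n)"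
    and separating: "\<And>x y. x \<in> topspace E \<Longrightarrow> y \<in> topspace E \<Longrightarrow> x \<noteq> y \<Longrightarrow> \<exists>n. (x \<in> A n) \<noteq> (y \<in> A n)"
    and perfect: "\<And>S. openin E S \<Longrightarrow> S \<noteq> {} \<Longrightarrow> \<exists>x\<in>S. \<exists>y\<in>S. x \<noteq> y"
begin

text \<open>The n-th cut is \<open>A n\<close> whenever this set cuts S at all; this makes the codes injective.
  Otherwise some other cut is made, which makes every binary sequence a code.\<close>

definition cut :: "nat \<Rightarrow> 'b set \<Rightarrow> 'b set" where
  "cut n S = (if S \<inter> A n \<noteq> {} \<and> S - A n \<noteq> {} then A n
     else A (SOME k. S \<inter> A k \<noteq> {} \<and> S - A k \<noteq> {}))"

primrec cell :: "(nat \<Rightarrow> bool) \<Rightarrow> nat \<Rightarrow> 'b set" where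
  "cell b 0 = topspace E"
| "cell b (Suc n) = (if b n then cell b n \<inter> cut n (cell b n) else cell b n - cut n (cell b n))"

text \<open>A code determines its cells and is itself read off from them. Following the cells along
  a point breaks this circle; \<open>cell_code\<close> identifies the two afterwards.\<close>

primrec point_cell :: "'b \<Rightarrow> nat \<Rightarrow> 'b set" where
  "point_cell x 0 = topspace E"
| "point_cell x (Suc n) = (if x \<in> cut n (point_cell x n)
     then point_cell x n \<inter> cut n (point_cell x n) else point_cell x n - cut n (point_cell x n))"

definition code :: "'b \<Rightarrow> nat \<Rightarrow> bool" where
  "code x n \<longleftrightarrow> x \<in> cut n (point_cell x n)"

lemma cell_code: "cell (code x) n = point_cell x n"
  by (induction n) (auto simp: code_def)

lemma point_in_cell: "x \<in> topspace E \<Longrightarrow> x \<in> point_cell x n"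
  by (induction n) auto

lemma clopen_cut: "openin E (cut n S)" "closedin E (cut n S)"
  unfolding cut_def using clopen by auto

lemma clopen_cell: "openin E (cell b n)" "closedin E (cell b n)"
  by (induction n) (auto intro: openin_diff closedin_diff clopen_cut)

text \<open>Perfectness puts two points into a cell and separation gives an \<open>A k\<close> that
  divides it, so \<open>SOME\<close> has a witness and both halves survive.\<close>

lemma cell_nonempty: "cell b n \<noteq> {}"
proof (induction n)
  case 0 then show ?case using nonempty by simp
next
  case (Suc n)
  let ?S = "cell b n"
  obtain x y where xy: "x \<in> ?S" "y \<in> ?S" "x \<noteq> y" using perfect[OF clopen_cell(1) Suc] by blast
  have "?S \<subseteq> topspace E" using clopen_cell(1) openin_subset by blast
  then obtain k where "(x \<in> A k) \<noteq> (y \<in> A k)" using separating[of x y] xy by blast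
  then have "\<exists>k. ?S \<inter> A k \<noteq> {} \<and> ?S - A k \<noteq> {}" using xy by blast
  then have "?S \<inter> cut n ?S \<noteq> {} \<and> ?S - cut n ?S \<noteq> {}"
    unfolding cut_def using someI_ex[of "\<lambda>k. ?S \<inter> A k \<noteq> {} \<and> ?S - A k \<noteq> {}"] by presburger
  then show ?case by simp
qed

lemma cell_of_point:
  assumes "\<And>n. x \<in> cell b n" shows "code x = b"
proof
  have eq: "point_cell x n = cell b n \<and> (\<forall>k<n. code x k = b k)" for n
  proof (induction n)
    case (Suc n)
    then have "code x n = b n" using assms[of "Suc n"] unfolding code_def by (auto split: if_splits)
    then show ?case using Suc by (auto simp: less_Suc_eq code_def)
  qed simp
  show "code x n = b n" for n using eq[of "Suc n"] by simp
qed

text \<open>The cells of a given sequence are nested, nonempty and closed, so compactness supplies a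
  common point.\<close>

lemma surj_code: obtains x where "x \<in> topspace E" "code x = b"
proof -
  have "(\<Inter>n. cell b n) \<noteq> {}"
  proof (rule compact_space_imp_nest[OF compact])
    show "decseq (cell b)" by (rule decseq_SucI) auto
  qed (use clopen_cell cell_nonempty in auto)
  then obtain x where x: "\<And>n. x \<in> cell b n" by blast
  then show ?thesis using that[of x] cell_of_point[of x b] x[of 0] by simp
qed

text \<open>If the codes agree, both points lie in one cell of level n, where \<open>A n\<close>
  separates them. Then \<open>A n\<close> divides this cell, hence is the cut made there, and the
  n-th digits differ.\<close>

lemma inj_code: "inj_on code (topspace E)"
proof (rule inj_onI, rule ccontr)
  fix x y assume xy: "x \<in> topspace E" "y \<in> topspace E" "code x = code y" "x \<noteq> y"
  then obtain n where n: "(x \<in> A n) \<noteq> (y \<in> A n)" using separating by blast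
  have eq: "point_cell x n = point_cell y n" using xy(3) cell_code by metis
  then have "x \<in> point_cell x n" "y \<in> point_cell x n" using xy point_in_cell by auto
  then have "cut n (point_cell x n) = A n" using n unfolding cut_def by auto
  then show False using n eq fun_cong[OF xy(3), of n] unfolding code_def by simp
qed

lemma code_locally_constant:
  assumes "y \<in> point_cell x n" shows "point_cell y n = point_cell x n \<and> (\<forall>k<n. code y k = code x k)"
  using assms
proof (induction n)
  case (Suc n)
  then have "y \<in> point_cell x n" by (auto split: if_splits)
  with Suc show ?case by (auto simp: less_Suc_eq code_def split: if_splits)
qed simp

lemma homeomorphic_cantor_set: "cantor_space E"
proof -
  let ?h = "\<lambda>x. ternary_value (code x)"
  have img: "?h ` topspace E = cantor_set"
  proof -
    have "b \<in> code ` topspace E" for b by (rule surj_code[of b]) auto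
    then have "code ` topspace E = UNIV" by auto
    then have "ternary_value ` (code ` topspace E) = cantor_set" using range_ternary_value by simp
    then show ?thesis by (simp add: image_image)
  qed
  have "continuous_map E euclideanreal ?h"
    unfolding continuous_map_def
  proof (intro conjI allI impI)
    fix U :: "real set" assume "openin euclideanreal U"
    then have U: "open U" by simp
    show "openin E {x \<in> topspace E. ?h x \<in> U}"
    proof (subst openin_subopen, intro ballI)
      fix x assume x: "x \<in> {x \<in> topspace E. ?h x \<in> U}"
      obtain e where e: "e > 0" "\<And>y. dist y (?h x) < e \<Longrightarrow> y \<in> U"
        using U x unfolding open_dist by blast
      obtain n where n: "(1/3 :: real) ^ n < e" using real_arch_pow_inv[OF e(1), of "1/3"] by auto
      have op: "openin E (point_cell x n)" using clopen_cell(1)[of "code x" n] by (simp add: cell_code)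
      have "?h y \<in> U" if "y \<in> point_cell x n" for y
      proof (rule e(2))
        show "dist (?h y) (?h x) < e"
          using ternary_value_close[of n "code y" "code x"] code_locally_constant[OF that] n
          by (auto simp: dist_real_def)
      qed
      then have "point_cell x n \<subseteq> {x \<in> topspace E. ?h x \<in> U}"
        using openin_subset[OF op] by blast
      then show "\<exists>T. openin E T \<and> x \<in> T \<and> T \<subseteq> {x \<in> topspace E. ?h x \<in> U}"
        using op x point_in_cell by blast
    qed
  qed simp
  then have "continuous_map E (subtopology euclideanreal cantor_set) ?h"
    using img by (auto simp: continuous_map_in_subtopology)
  moreover have "inj_on ?h (topspace E)"
    using inj_code ternary_value_inject unfolding inj_on_def by blast
  \<comment> \<open>A continuous bijection from a compact space onto a Hausdorff space is a
    homeomorphism.\<close>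
  ultimately have "homeomorphic_map E (subtopology euclideanreal cantor_set) ?h"
    using img compact by (intro continuous_imp_homeomorphic_map) (auto simp: Hausdorff_space_subtopology)
  then show ?thesis unfolding cantor_space_def by (rule homeomorphic_map_imp_homeomorphic_space)
qed

end

section \<open>End spaces\<close>

lemma unbounded_component_nonempty: "C \<in> unbounded_components T K \<Longrightarrow> C \<noteq> {}"
  unfolding unbounded_components_def using nonempty_connected_components_of by blast

lemma unbounded_component_eq:
  assumes "C \<in> unbounded_components T K" "D \<in> unbounded_components T K" "C \<inter> D \<noteq> {}"
  shows "C = D"
  using assms connected_components_of_disjoint[of C "subtopology T (topspace T - K)" D]
  unfolding unbounded_components_def disjnt_def by auto

lemma unbounded_component_extend:
  assumes "connectedin T D" "D \<noteq> {}" "D \<inter> K = {}" "\<not> compactin T (T closure_of D)"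
  obtains C where "C \<in> unbounded_components T K" "D \<subseteq> C"
proof -
  let ?T = "subtopology T (topspace T - K)"
  have "D \<subseteq> topspace T" using assms(1) by (rule connectedin_subset_topspace)
  then have "connectedin ?T D" using assms by (auto simp: connectedin_subtopology)
  moreover have "?T \<noteq> trivial_topology"
    using connectedin_subset_topspace[OF calculation] assms(2) by (metis subset_empty topspace_discrete_topology)
  ultimately obtain C where C: "C \<in> connected_components_of ?T" "D \<subseteq> C"
    using exists_connected_component_of_superset by blast
  have "\<not> compactin T (T closure_of C)"
    using assms(4) closed_compactin[OF _ closure_of_mono[OF C(2)] closedin_closure_of] by blast
  then show ?thesis using that C unfolding unbounded_components_def by blast
qed

lemma unbounded_component_coarsen:
  assumes "C' \<in> unbounded_components T K'" "K \<subseteq> K'"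
  obtains C where "C \<in> unbounded_components T K" "C' \<subseteq> C"
proof -
  have C': "C' \<in> connected_components_of (subtopology T (topspace T - K'))"
    "\<not> compactin T (T closure_of C')" using assms(1) unfolding unbounded_components_def by auto
  then have c: "connectedin (subtopology T (topspace T - K')) C'" by (simp add: connectedin_connected_components_of)
  then have "connectedin T C'" "C' \<inter> K = {}" using assms(2) by (auto simp: connectedin_subtopology)
  then show ?thesis
    using unbounded_component_extend[of T C' K] that C' unbounded_component_nonempty[OF assms(1)] by blast
qed

text \<open>These conditions make the inverse limit manageable: finite terms give compactness,
  \<open>refine\<close> says that the bonding maps are onto, and the cofinal sequence replaces all
  compact sets by countably many.\<close>

locale exhausted_ends =
  fixes T :: "'b topology" and ex :: "nat \<Rightarrow> 'b set"
  assumes compact_ex: "\<And>i. compactin T (ex i)"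
    and mono_ex: "\<And>i j. i \<le> j \<Longrightarrow> ex i \<subseteq> ex j"
    and cofinal: "\<And>K. compactin T K \<Longrightarrow> \<exists>i. K \<subseteq> ex i"
    and finite_unbounded: "\<And>K. compactin T K \<Longrightarrow> finite (unbounded_components T K)"
    and refine: "\<And>K K' C. compactin T K \<Longrightarrow> compactin T K' \<Longrightarrow> K \<subseteq> K' \<Longrightarrow>
      C \<in> unbounded_components T K \<Longrightarrow> \<exists>C'\<in>unbounded_components T K'. C' \<subseteq> C"
begin

section \<open>Ends as compatible families of components\<close>

lemma topspace_end_space:
  "topspace (end_space T) = {e \<in> Pi\<^sub>E {K. compactin T K} (unbounded_components T).
     \<forall>K K'. compactin T K \<and> compactin T K' \<and> K \<subseteq> K' \<longrightarrow> e K' \<subseteq> e K}"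
  unfolding end_space_def by auto

lemma end_component: "e \<in> topspace (end_space T) \<Longrightarrow> compactin T K \<Longrightarrow> e K \<in> unbounded_components T K"
  unfolding topspace_end_space by auto

lemma end_antimono:
  "e \<in> topspace (end_space T) \<Longrightarrow> compactin T K \<Longrightarrow> compactin T K' \<Longrightarrow> K \<subseteq> K' \<Longrightarrow> e K' \<subseteq> e K"
  unfolding topspace_end_space by auto

lemma end_determined:
  assumes "e \<in> topspace (end_space T)" "compactin T K" "compactin T K'" "K \<subseteq> K'"
    "C \<in> unbounded_components T K" "e K' \<inter> C \<noteq> {}"
  shows "e K = C"
  using end_antimono[OF assms(1-4)] end_component[OF assms(1,2)] assms(5,6)
  by (intro unbounded_component_eq[of _ T K]) auto

lemma ends_agree:
  assumes "e \<in> topspace (end_space T)" "e' \<in> topspace (end_space T)"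
    "compactin T K" "compactin T K'" "K \<subseteq> K'" "e K' = e' K'"
  shows "e K = e' K"
proof (rule end_determined[OF assms(1) assms(3-5)])
  show "e' K \<in> unbounded_components T K" using end_component assms by blast
  show "e K' \<inter> e' K \<noteq> {}"
    using end_antimono[OF assms(2-5)] assms(6) unbounded_component_nonempty[OF end_component[OF assms(2,4)]]
    by auto
qed

lemma end_eqI:
  assumes "e \<in> topspace (end_space T)" "e' \<in> topspace (end_space T)" "\<And>i. e (ex i) = e' (ex i)"
  shows "e = e'"
proof (rule PiE_ext)
  show "e \<in> Pi\<^sub>E {K. compactin T K} (unbounded_components T)"
    "e' \<in> Pi\<^sub>E {K. compactin T K} (unbounded_components T)"
    using assms unfolding topspace_end_space by auto
  fix K assume "K \<in> {K. compactin T K}"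
  then show "e K = e' K" using cofinal[of K] ends_agree[OF assms(1,2) _ compact_ex] assms(3) by auto
qed

text \<open>Since bonding maps are onto, components can be chosen along the exhaustion; joining K to
  every stage keeps the sequence inside C from the start. For any other compact set, take the
  component that contains a tail of the sequence.\<close>

lemma end_through:
  assumes K: "compactin T K" and C: "C \<in> unbounded_components T K"
  obtains e where "e \<in> topspace (end_space T)" "e K = C"
proof -
  let ?K = "\<lambda>i. ex i \<union> K"
  have cK: "compactin T (?K i)" for i using compact_ex K by (rule compactin_Un)
  have Kmono: "?K i \<subseteq> ?K j" if "i \<le> j" for i j using mono_ex[OF that] by auto
  have "\<exists>c. \<forall>n. (c n \<in> unbounded_components T (?K n) \<and> c n \<subseteq> C) \<and> c (Suc n) \<subseteq> c n"
  proof (rule dependent_nat_choice)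
    show "\<exists>x. x \<in> unbounded_components T (?K 0) \<and> x \<subseteq> C"
      using refine[OF K cK[of 0] _ C] by auto
    fix x n assume "x \<in> unbounded_components T (?K n) \<and> x \<subseteq> C"
    then show "\<exists>y. (y \<in> unbounded_components T (?K (Suc n)) \<and> y \<subseteq> C) \<and> y \<subseteq> x"
      using refine[OF cK[of n] cK[of "Suc n"] Kmono[of n "Suc n"], of x] by fastforce
  qed
  then obtain c where c: "\<And>n. c n \<in> unbounded_components T (?K n)" "\<And>n. c n \<subseteq> C"
    "\<And>n. c (Suc n) \<subseteq> c n" by blast
  have dec: "c j \<subseteq> c i" if "i \<le> j" for i j using c(3) that by (rule lift_Suc_antimono_le)
  have "\<exists>D. D \<in> unbounded_components T K' \<and> (\<exists>i. c i \<subseteq> D)" if K': "compactin T K'" for K'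
  proof -
    obtain i where "K' \<subseteq> ex i" using cofinal[OF K'] by blast
    then have "K' \<subseteq> ?K i" by blast
    then obtain D where "D \<in> unbounded_components T K'" "c i \<subseteq> D"
      by (rule unbounded_component_coarsen[OF c(1)[of i]])
    then show ?thesis by blast
  qed
  then obtain e0 where e0: "\<And>K'. compactin T K' \<Longrightarrow> e0 K' \<in> unbounded_components T K'"
    "\<And>K'. compactin T K' \<Longrightarrow> \<exists>i. c i \<subseteq> e0 K'" by metis
  \<comment> \<open>The \<open>c i\<close> are nonempty and decreasing, so only one component can
    contain some of them.\<close>
  have meet: "D = D'" if "D \<in> unbounded_components T K'" "D' \<in> unbounded_components T K'"
    "c i \<subseteq> D" "c j \<subseteq> D'" for D D' K' i j
  proof -
    have "c (max i j) \<subseteq> D \<inter> D'" using that dec[of i "max i j"] dec[of j "max i j"] by auto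
    then have "D \<inter> D' \<noteq> {}" using unbounded_component_nonempty[OF c(1)[of "max i j"]] by blast
    then show ?thesis using that(1,2) unbounded_component_eq by meson
  qed
  define e where "e = restrict e0 {K. compactin T K}"
  have "e K'' \<subseteq> e K'" if K: "compactin T K'" "compactin T K''" "K' \<subseteq> K''" for K' K''
  proof -
    obtain D where D: "D \<in> unbounded_components T K'" "e0 K'' \<subseteq> D"
      using unbounded_component_coarsen[OF e0(1)[OF K(2)] K(3)] by metis
    obtain i j where "c i \<subseteq> e0 K''" "c j \<subseteq> e0 K'" using e0(2)[OF K(1)] e0(2)[OF K(2)] by blast
    then have "D = e0 K'" using meet[OF D(1) e0(1)[OF K(1)]] D(2) by blast
    then show ?thesis using D(2) K unfolding e_def by simp
  qed
  then have "e \<in> topspace (end_space T)" unfolding topspace_end_space using e0(1) by (auto simp: e_def)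
  moreover have "e K = C"
    using meet[OF C e0(1)[OF K] c(2)[of 0]] e0(2)[OF K] K unfolding e_def by auto
  ultimately show ?thesis using that by blast
qed

text \<open>Where the number of unbounded components is maximal, enlarging the compact set cannot
  split any of them: the bonding map goes from at most k elements onto k, hence is injective. So an
  end is determined by its component outside K.\<close>

lemma card_end_space:
  assumes K: "compactin T K" and k: "card (unbounded_components T K) = k"
    and le: "\<And>K'. compactin T K' \<Longrightarrow> card (unbounded_components T K') \<le> k"
  shows "card (topspace (end_space T)) = k" "finite (topspace (end_space T))"
proof -
  let ?X = "topspace (end_space T)"
  have "inj_on (\<lambda>e. e K) ?X"
  proof (rule inj_onI, rule end_eqI)
    fix e e' i assume e: "e \<in> ?X" "e' \<in> ?X" and eq: "e K = e' K"
    let ?K = "K \<union> ex i"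
    have cK: "compactin T ?K" using K compact_ex by (rule compactin_Un)
    define up where "up C = (SOME D. D \<in> unbounded_components T K \<and> C \<subseteq> D)" for C
    have up: "up C \<in> unbounded_components T K \<and> C \<subseteq> up C" if C: "C \<in> unbounded_components T ?K" for C
    proof -
      obtain D where "D \<in> unbounded_components T K" "C \<subseteq> D"
        by (rule unbounded_component_coarsen[OF C Un_upper1])
      then have "\<exists>D. D \<in> unbounded_components T K \<and> C \<subseteq> D" by blast
      from someI_ex[OF this] show ?thesis unfolding up_def .
    qed
    have "up ` unbounded_components T ?K = unbounded_components T K"
    proof
      show "up ` unbounded_components T ?K \<subseteq> unbounded_components T K" using up by blast
      show "unbounded_components T K \<subseteq> up ` unbounded_components T ?K"
      proof
        fix D assume D: "D \<in> unbounded_components T K"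
        then obtain C where C: "C \<in> unbounded_components T ?K" "C \<subseteq> D"
          using refine[OF K cK, of D] by auto
        then have "up C \<inter> D \<noteq> {}" using up[of C] unbounded_component_nonempty[of C T ?K] by blast
        then have "up C = D" using unbounded_component_eq D up C(1) by blast
        then show "D \<in> up ` unbounded_components T ?K" using C(1) by blast
      qed
    qed
    then have "card (up ` unbounded_components T ?K) = card (unbounded_components T ?K)"
      using le[OF cK] k card_image_le[OF finite_unbounded[OF cK], of up] by simp
    then have inj: "inj_on up (unbounded_components T ?K)"
      by (rule eq_card_imp_inj_on[OF finite_unbounded[OF cK]])
    have upe: "up (e ?K) = e K" if "e \<in> ?X" for e
    proof -
      have u: "e ?K \<in> unbounded_components T ?K" using end_component[OF that cK] .
      have "e K = up (e ?K)"
        by (rule end_determined[OF that K cK]) (use up[OF u] unbounded_component_nonempty[OF u] in auto)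
      then show ?thesis by simp
    qed
    then have "e ?K = e' ?K" using inj_onD[OF inj, of "e ?K" "e' ?K"] e eq end_component[OF _ cK] by simp
    then show "e (ex i) = e' (ex i)" using ends_agree[OF e compact_ex cK] by auto
  qed
  moreover have "(\<lambda>e. e K) ` ?X = unbounded_components T K"
    using end_component[OF _ K] end_through[OF K] by (auto simp: image_iff) metis
  ultimately have "bij_betw (\<lambda>e. e K) ?X (unbounded_components T K)" unfolding bij_betw_def by blast
  then show "card ?X = k" "finite ?X"
    using k finite_unbounded[OF K] bij_betw_same_card bij_betw_finite by blast+
qed

lemma continuous_map_end:
  assumes "compactin T K"
  shows "continuous_map (end_space T) (discrete_topology (unbounded_components T K)) (\<lambda>e. e K)"
  unfolding end_space_def using assms
  by (intro continuous_map_from_subtopology continuous_map_product_projection) simp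

text \<open>Each compatibility condition involves two coordinates with finitely many values, so it
  is closed in the compact product of finite discrete spaces.\<close>

lemma compact_end_space: "compact_space (end_space T)"
proof -
  let ?P = "product_topology (\<lambda>K. discrete_topology (unbounded_components T K)) {K. compactin T K}"
  have cP: "compact_space ?P"
    by (simp add: compact_space_product_topology compact_space_discrete_topology finite_unbounded)
  have proj: "closedin ?P {e \<in> topspace ?P. e K = C}" if "compactin T K" for K C
  proof -
    have "closedin ?P {e \<in> topspace ?P. e K \<in> {C} \<inter> unbounded_components T K}"
      by (rule closedin_continuous_map_preimage[OF continuous_map_product_projection]) (use that in auto)
    moreover have "{e \<in> topspace ?P. e K \<in> {C} \<inter> unbounded_components T K} = {e \<in> topspace ?P. e K = C}"
      using that by auto
    ultimately show ?thesis by simp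
  qed
  have two: "closedin ?P {e \<in> topspace ?P. e K' \<subseteq> e K}" if K: "compactin T K" "compactin T K'" for K K'
  proof -
    let ?I = "{(C, C') \<in> unbounded_components T K \<times> unbounded_components T K'. C' \<subseteq> C}"
    have "{e \<in> topspace ?P. e K' \<subseteq> e K} =
        (\<Union>(C, C')\<in>?I. {e \<in> topspace ?P. e K = C} \<inter> {e \<in> topspace ?P. e K' = C'})"
      using K by auto
    moreover have "closedin ?P \<dots>"
    proof (intro closedin_Union)
      show "finite ((\<lambda>(C, C'). {e \<in> topspace ?P. e K = C} \<inter> {e \<in> topspace ?P. e K' = C'}) ` ?I)"
        by (intro finite_imageI finite_subset[OF _ finite_cartesian_product[OF finite_unbounded[OF K(1)] finite_unbounded[OF K(2)]]]) auto
    qed (use proj[OF K(1)] proj[OF K(2)] in \<open>auto intro: closedin_Int\<close>)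
    ultimately show ?thesis by simp
  qed
  let ?J = "{(K, K'). compactin T K \<and> compactin T K' \<and> K \<subseteq> K'}"
  \<comment> \<open>The index set must be nonempty for the intersection to stay within
    \<open>topspace ?P\<close>.\<close>
  have "({}, {}) \<in> ?J" by simp
  then have "closedin ?P (\<Inter>(K, K')\<in>?J. {e \<in> topspace ?P. e K' \<subseteq> e K})"
    by (intro closedin_Inter) (use two in auto)
  moreover have "(\<Inter>(K, K')\<in>?J. {e \<in> topspace ?P. e K' \<subseteq> e K}) =
      topspace ?P \<inter> {e. \<forall>K K'. compactin T K \<and> compactin T K' \<and> K \<subseteq> K' \<longrightarrow> e K' \<subseteq> e K}"
    using \<open>({}, {}) \<in> ?J\<close> by auto
  ultimately have "compactin ?P (topspace ?P \<inter> {e. \<forall>K K'. compactin T K \<and> compactin T K' \<and> K \<subseteq> K' \<longrightarrow> e K' \<subseteq> e K})"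
    using closedin_compact_space[OF cP] by simp
  from compact_space_subtopology[OF this] show ?thesis
    unfolding end_space_def subtopology_restrict .
qed

text \<open>The components at the stages of the exhaustion give the countable clopen family, and
  \<open>split\<close> gives perfectness, because a basic neighbourhood constrains only finitely
  many coordinates.\<close>

lemma cantor_end_space:
  assumes split: "\<And>K C. compactin T K \<Longrightarrow> C \<in> unbounded_components T K \<Longrightarrow>
      \<exists>K' C1 C2. compactin T K' \<and> K \<subseteq> K' \<and> C1 \<in> unbounded_components T K' \<and>
        C2 \<in> unbounded_components T K' \<and> C1 \<noteq> C2 \<and> C1 \<subseteq> C \<and> C2 \<subseteq> C"
    and ne: "unbounded_components T {} \<noteq> {}"
  shows "cantor_space (end_space T)"
proof -
  let ?E = "end_space T" and ?X = "topspace (end_space T)"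
  define \<B> where "\<B> = {{e \<in> ?X. e (ex i) = C} | i C. C \<in> unbounded_components T (ex i)}"
  have "\<B> = (\<Union>i. (\<lambda>C. {e \<in> ?X. e (ex i) = C}) ` unbounded_components T (ex i))"
    unfolding \<B>_def by blast
  then have count: "countable \<B>"
    using finite_unbounded[OF compact_ex] by (simp add: countable_finite)
  obtain C0 where "C0 \<in> unbounded_components T (ex 0)"
    using ne refine[of "{}" "ex 0"] compact_ex[of 0] by (metis compactin_empty empty_subsetI ex_in_conv)
  then have "\<B> \<noteq> {}" unfolding \<B>_def by blast
  define A where "A = from_nat_into \<B>"
  have A: "range A = \<B>" unfolding A_def using range_from_nat_into[OF \<open>\<B> \<noteq> {}\<close> count] .
  interpret clopen_coding ?E A
  proof
    show "compact_space ?E" by (rule compact_end_space)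
    show "?X \<noteq> {}"
      using end_through[OF compact_ex \<open>C0 \<in> _\<close>] by blast
    fix n
    have "A n \<in> \<B>" using A by blast
    then obtain i C where iC: "A n = {e \<in> ?X. e (ex i) \<in> {C}}" "C \<in> unbounded_components T (ex i)"
      unfolding \<B>_def by auto
    show "openin ?E (A n)"
      unfolding iC(1) using iC(2)
      by (intro openin_continuous_map_preimage[OF continuous_map_end[OF compact_ex]]) simp
    show "closedin ?E (A n)"
      unfolding iC(1) using iC(2)
      by (intro closedin_continuous_map_preimage[OF continuous_map_end[OF compact_ex]]) simp
  next
    fix x y assume xy: "x \<in> ?X" "y \<in> ?X" "x \<noteq> y"
    then obtain i where i: "x (ex i) \<noteq> y (ex i)" using end_eqI by blast
    have "{e \<in> ?X. e (ex i) = x (ex i)} \<in> \<B>"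
      unfolding \<B>_def using end_component[OF xy(1) compact_ex] by blast
    then have "{e \<in> ?X. e (ex i) = x (ex i)} \<in> range A" unfolding A .
    then obtain n where "{e \<in> ?X. e (ex i) = x (ex i)} = A n" by (rule rangeE)
    then have "x \<in> A n" "y \<notin> A n" using xy i by auto
    then show "\<exists>n. (x \<in> A n) \<noteq> (y \<in> A n)" by blast
  next
    fix S assume S: "openin ?E S" "S \<noteq> {}"
    then obtain e where e: "e \<in> S" by blast
    then have eX: "e \<in> ?X" using openin_subset[OF S(1)] by blast
    obtain W where W: "openin (product_topology (\<lambda>K. discrete_topology (unbounded_components T K)) {K. compactin T K}) W"
      "S = W \<inter> {e. \<forall>K K'. compactin T K \<and> compactin T K' \<and> K \<subseteq> K' \<longrightarrow> e K' \<subseteq> e K}"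
      using S(1) unfolding end_space_def openin_subtopology by blast
    then obtain U where U: "finite {K \<in> {K. compactin T K}. U K \<noteq> unbounded_components T K}"
      "e \<in> Pi\<^sub>E {K. compactin T K} U" "Pi\<^sub>E {K. compactin T K} U \<subseteq> W"
      using e unfolding openin_product_topology_alt by fastforce
    \<comment> \<open>Ends that agree on the union of the constrained compact sets agree on each of
      them, so fixing the component outside this K keeps an end inside S.\<close>
    define K where "K = \<Union>{K \<in> {K. compactin T K}. U K \<noteq> unbounded_components T K}"
    have cK: "compactin T K" unfolding K_def using U(1) by (intro compactin_Union) auto
    have inS: "e' \<in> S" if e': "e' \<in> ?X" "e' K = e K" for e'
    proof -
      have "e' K' \<in> U K'" if K': "compactin T K'" for K'
      proof (cases "U K' = unbounded_components T K'")
        case True then show ?thesis using end_component[OF e'(1) K'] by simp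
      next
        case False
        then have "K' \<subseteq> K" unfolding K_def using K' by auto
        then have "e' K' = e K'" using ends_agree[OF e'(1) eX K' cK] e'(2) by simp
        then show ?thesis using U(2) K' by auto
      qed
      moreover have "e' \<in> extensional {K. compactin T K}"
        using e'(1) unfolding topspace_end_space by (simp add: PiE_def)
      ultimately have "e' \<in> W" using U(3) by (auto simp: PiE_def)
      then show ?thesis using W(2) e'(1) unfolding topspace_end_space by auto
    qed
    obtain K' C1 C2 where K': "compactin T K'" "K \<subseteq> K'" and C: "C1 \<in> unbounded_components T K'"
      "C2 \<in> unbounded_components T K'" "C1 \<noteq> C2" "C1 \<subseteq> e K" "C2 \<subseteq> e K"
      using split[OF cK end_component[OF eX cK]] by blast
    obtain e1 e2 where e12: "e1 \<in> ?X" "e1 K' = C1" "e2 \<in> ?X" "e2 K' = C2"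
      using end_through[OF K'(1) C(1)] end_through[OF K'(1) C(2)] by metis
    have "e1 K = e K"
      by (rule end_determined[OF e12(1) cK K' end_component[OF eX cK]])
        (use e12 C(4) unbounded_component_nonempty[OF C(1)] in auto)
    moreover have "e2 K = e K"
      by (rule end_determined[OF e12(3) cK K' end_component[OF eX cK]])
        (use e12 C(5) unbounded_component_nonempty[OF C(2)] in auto)
    ultimately have "e1 \<in> S" "e2 \<in> S" using inS e12 by auto
    moreover have "e1 \<noteq> e2" using e12 C(3) by auto
    ultimately show "\<exists>x\<in>S. \<exists>y\<in>S. x \<noteq> y" by blast
  qed
  show ?thesis by (rule homeomorphic_cantor_set)
qed

end

section \<open>Locally finite graphs\<close>

locale locally_finite_graph =
  fixes V :: "'v set" and E :: "'v rel"
  assumes edges: "E \<subseteq> V \<times> V"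
    and edge_refl: "\<And>u. u \<in> V \<Longrightarrow> (u, u) \<in> E"
    and edge_sym: "\<And>u v. (u, v) \<in> E \<Longrightarrow> (v, u) \<in> E"
    and finite_neighbours: "\<And>u. finite (E `` {u})"
begin

definition avoid :: "'v set \<Rightarrow> 'v rel" where
  "avoid F = {(a, b) \<in> E. a \<notin> F \<and> b \<notin> F}"

text \<open>For a in F no edge of \<open>avoid F\<close> leaves a, and the piece degenerates to {a};
  hence the side conditions \<open>a \<notin> F\<close> below.\<close>

definition piece :: "'v set \<Rightarrow> 'v \<Rightarrow> 'v set" where
  "piece F a = (avoid F)\<^sup>* `` {a}"

definition leaf :: "'v \<Rightarrow> 'v set" where
  "leaf u = E\<^sup>* `` {u}"

text \<open>An exact number of steps still yields the ball of radius m because every vertex carries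
  a loop. Outside V there are no loops, hence \<open>u \<in> V\<close> in
  \<open>disc_mono\<close>.\<close>

definition disc :: "'v \<Rightarrow> nat \<Rightarrow> 'v set" where
  "disc u m = (E ^^ m) `` {u}"

text \<open>Counting through representatives expresses a lower bound instead of an exact number, and
  this bound survives enlarging F to a finite set.\<close>

definition branch :: "nat \<Rightarrow> 'v set \<Rightarrow> 'v \<Rightarrow> bool" where
  "branch k F u \<longleftrightarrow> (\<exists>S. finite S \<and> card S = k \<and> S \<subseteq> leaf u - F \<and>
     (\<forall>a\<in>S. infinite (piece F a)) \<and> (\<forall>a\<in>S. \<forall>b\<in>S. b \<in> piece F a \<longrightarrow> a = b))"

section \<open>Pieces, leaves and discs\<close>

lemma branchE:
  assumes "branch k F u"
  obtains S where "finite S" "card S = k" "S \<subseteq> leaf u - F"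
    "\<forall>a\<in>S. infinite (piece F a)" "\<forall>a\<in>S. \<forall>b\<in>S. b \<in> piece F a \<longrightarrow> a = b"
  using assms unfolding branch_def by (elim exE conjE) rule

lemma sym_avoid: "sym (avoid F)"
  unfolding avoid_def sym_def using edge_sym by blast

lemma piece_self [simp]: "a \<in> piece F a"
  unfolding piece_def by blast

lemma piece_sym: "b \<in> piece F a \<Longrightarrow> a \<in> piece F b"
  unfolding piece_def using sym_rtrancl[OF sym_avoid, of F] by (auto simp: sym_def)

lemma piece_trans: "b \<in> piece F a \<Longrightarrow> c \<in> piece F b \<Longrightarrow> c \<in> piece F a"
  unfolding piece_def by auto

lemma piece_eq: "b \<in> piece F a \<Longrightarrow> piece F b = piece F a"
  using piece_sym piece_trans by blast

lemma piece_step: "b \<in> piece F a \<Longrightarrow> (b, c) \<in> E \<Longrightarrow> b \<notin> F \<Longrightarrow> c \<notin> F \<Longrightarrow> c \<in> piece F a"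
  unfolding piece_def avoid_def by (auto intro: rtrancl_into_rtrancl)

lemma piece_antimono: "F \<subseteq> F' \<Longrightarrow> piece F' a \<subseteq> piece F a"
  unfolding piece_def
  by (intro Image_mono rtrancl_mono) (auto simp: avoid_def)

lemma piece_disjoint: assumes "a \<notin> F" shows "piece F a \<inter> F = {}"
proof -
  have "b \<notin> F" if "(a, b) \<in> (avoid F)\<^sup>*" for b
    using that assms by (induction rule: rtrancl_induct) (auto simp: avoid_def)
  then show ?thesis unfolding piece_def by blast
qed

lemma piece_subset_closed:
  assumes "a \<in> Y" "\<And>b c. b \<in> Y \<Longrightarrow> (b, c) \<in> E \<Longrightarrow> c \<notin> F \<Longrightarrow> c \<in> Y"
  shows "piece F a \<subseteq> Y"
proof -
  have "b \<in> Y" if "(a, b) \<in> (avoid F)\<^sup>*" for b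
    using that assms by (induction rule: rtrancl_induct) (auto simp: avoid_def)
  then show ?thesis unfolding piece_def by blast
qed

lemma leaf_self [simp]: "u \<in> leaf u"
  unfolding leaf_def by blast

lemma leaf_trans: "v \<in> leaf u \<Longrightarrow> w \<in> leaf v \<Longrightarrow> w \<in> leaf u"
  unfolding leaf_def by auto

lemma leaf_sym: "v \<in> leaf u \<Longrightarrow> u \<in> leaf v"
proof -
  have "sym (E\<^sup>*)" by (intro sym_rtrancl) (auto simp: sym_def edge_sym)
  then show "v \<in> leaf u \<Longrightarrow> u \<in> leaf v" unfolding leaf_def by (auto simp: sym_def)
qed

lemma leaf_eq: "v \<in> leaf u \<Longrightarrow> leaf v = leaf u"
  using leaf_sym leaf_trans by blast

lemma leaf_step: "v \<in> leaf u \<Longrightarrow> (v, w) \<in> E \<Longrightarrow> w \<in> leaf u"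
  unfolding leaf_def by (auto intro: rtrancl_into_rtrancl)

lemma leaf_subset_vertices: "u \<in> V \<Longrightarrow> leaf u \<subseteq> V"
proof -
  have "v \<in> V" if "(u, v) \<in> E\<^sup>*" "u \<in> V" for v
    using that edges by (induction rule: rtrancl_induct) auto
  then show "u \<in> V \<Longrightarrow> leaf u \<subseteq> V" unfolding leaf_def by blast
qed

lemma piece_subset_leaf: "piece F a \<subseteq> leaf a"
  unfolding piece_def leaf_def by (intro Image_mono rtrancl_mono) (auto simp: avoid_def)

lemma piece_in_leaf: "a \<in> leaf u \<Longrightarrow> piece F a \<subseteq> leaf u"
  using piece_subset_leaf leaf_trans by blast

lemma piece_empty: "piece {} a = leaf a"
  unfolding piece_def leaf_def avoid_def by auto

lemma disc_0 [simp]: "disc u 0 = {u}"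
  unfolding disc_def by auto

lemma disc_Suc: "disc u (Suc m) = E `` disc u m"
  unfolding disc_def by auto

lemma disc_SucI: "v \<in> disc u m \<Longrightarrow> (v, w) \<in> E \<Longrightarrow> w \<in> disc u (Suc m)"
  unfolding disc_Suc by auto

lemma finite_disc [simp]: "finite (disc u m)"
proof (induction m)
  case (Suc m)
  have "disc u (Suc m) = (\<Union>v\<in>disc u m. E `` {v})" unfolding disc_Suc by auto
  then show ?case using Suc finite_neighbours by simp
qed simp

lemma disc_subset_leaf: "disc u m \<subseteq> leaf u"
  by (induction m) (auto simp: disc_Suc intro: leaf_step)

lemma disc_trans: "v \<in> disc u m \<Longrightarrow> w \<in> disc v k \<Longrightarrow> w \<in> disc u (m + k)"
  unfolding disc_def by (auto simp: relpow_add)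

lemma disc_sym: "v \<in> disc u m \<Longrightarrow> u \<in> disc v m"
proof (induction m arbitrary: v)
  case (Suc m)
  then obtain w where w: "w \<in> disc u m" "(w, v) \<in> E" unfolding disc_Suc by auto
  then have "w \<in> disc v 1" using edge_sym by (auto simp: disc_def)
  with Suc.IH[OF w(1)] show ?case using disc_trans[of w v 1 u m] by auto
qed simp

lemma disc_in_vertices: "u \<in> V \<Longrightarrow> disc u m \<subseteq> V"
  using disc_subset_leaf leaf_subset_vertices by blast

lemma disc_mono: assumes "u \<in> V" "m \<le> k" shows "disc u m \<subseteq> disc u k"
  using assms(2)
proof (induction k rule: dec_induct)
  case (step k)
  have "disc u k \<subseteq> disc u (Suc k)"
    using disc_in_vertices[OF assms(1), of k] edge_refl by (auto intro: disc_SucI)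
  then show ?case using step by blast
qed simp

lemma disc_shift: assumes "v \<in> disc u m" shows "disc v k \<subseteq> disc u (m + k)"
  using assms disc_trans by blast

lemma leaf_disc: assumes "v \<in> leaf u" obtains m where "v \<in> disc u m"
  using assms unfolding leaf_def disc_def by (auto dest: rtrancl_imp_relpow)

lemma finite_subset_disc:
  assumes "u \<in> V" "finite F" "F \<subseteq> leaf u" obtains m where "F \<subseteq> disc u m"
proof -
  have "\<exists>m. F \<subseteq> disc u m" using assms(2,3)
  proof (induction F)
    case (insert a F)
    then obtain m where "F \<subseteq> disc u m" by blast
    moreover obtain j where "a \<in> disc u j" using insert leaf_disc by auto
    ultimately have "insert a F \<subseteq> disc u (max m j)"
      using disc_mono[OF assms(1), of m "max m j"] disc_mono[OF assms(1), of j "max m j"] by auto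
    then show ?case by blast
  qed simp
  then show ?thesis using that by blast
qed

section \<open>Infinite pieces outside finite sets\<close>

lemma piece_of_far_disc:
  assumes "u \<in> V" "a \<notin> disc u (R + s)" "b \<in> disc a s"
  shows "b \<in> piece (disc u R) a \<and> b \<notin> disc u R"
  using assms(2,3)
proof (induction s arbitrary: b)
  case 0 then show ?case by simp
next
  case (Suc s)
  then obtain c where c: "c \<in> disc a s" "(c, b) \<in> E" unfolding disc_Suc by auto
  have "a \<notin> disc u (R + s)" using Suc.prems(1) disc_mono[OF assms(1), of "R+s" "R + Suc s"] by auto
  from Suc.IH[OF this c(1)] have 1: "c \<in> piece (disc u R) a" "c \<notin> disc u R" by auto
  have "b \<notin> disc u R"
    using Suc.prems disc_trans[of b u R a "Suc s"] disc_sym[of b a "Suc s"] by auto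
  then show ?case using 1 c piece_step by blast
qed

text \<open>A finite piece in Y must touch F, for otherwise it would be the whole leaf and contain
  Y. So it contains one of the finitely many neighbours of F, and if all pieces were finite then so
  would be Y.\<close>

lemma infinite_piece_in_closed:
  assumes "finite F" "infinite Y" "Y \<subseteq> leaf u" "Y \<inter> F = {}"
    and closed: "\<And>b c. b \<in> Y \<Longrightarrow> (b, c) \<in> E \<Longrightarrow> c \<notin> F \<Longrightarrow> c \<in> Y"
  shows "\<exists>b\<in>Y. infinite (piece F b)"
proof (rule ccontr)
  assume "\<not> ?thesis"
  then have fin: "\<And>b. b \<in> Y \<Longrightarrow> finite (piece F b)" by blast
  define N where "N = (\<Union>f\<in>F. E `` {f}) \<inter> Y"
  have "finite N" unfolding N_def using assms(1) finite_neighbours by auto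
  have "Y \<subseteq> (\<Union>w\<in>N. piece F w)"
  proof
    fix v assume v: "v \<in> Y"
    have sub: "piece F v \<subseteq> Y" using v closed by (rule piece_subset_closed)
    show "v \<in> (\<Union>w\<in>N. piece F w)"
    proof (rule ccontr)
      assume contra: "v \<notin> (\<Union>w\<in>N. piece F w)"
      have "piece {} v \<subseteq> piece F v"
      proof (rule piece_subset_closed)
        fix b c assume b: "b \<in> piece F v" and bc: "(b, c) \<in> E"
        have "c \<notin> F"
        proof
          assume "c \<in> F"
          then have "b \<in> N" unfolding N_def using b bc sub edge_sym by auto
          then show False using contra piece_sym[OF b] by blast
        qed
        moreover have "b \<notin> F" using b sub assms(4) by blast
        ultimately show "c \<in> piece F v" using b bc piece_step by blast
      qed simp
      then have "leaf v \<subseteq> piece F v" by (simp add: piece_empty)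
      moreover have "leaf v = leaf u" using v assms(3) leaf_eq by blast
      ultimately have "Y \<subseteq> piece F v" using assms(3) by simp
      then show False using assms(2) fin[OF v] by (meson finite_subset)
    qed
  qed
  moreover have "finite (\<Union>w\<in>N. piece F w)"
    using \<open>finite N\<close> fin unfolding N_def by auto
  ultimately show False using assms(2) by (meson finite_subset)
qed

lemma infinite_piece_refine:
  assumes "finite F'" "a \<notin> F" "infinite (piece F a)" "F \<subseteq> F'"
  shows "\<exists>b\<in>piece F a - F'. infinite (piece F' b)"
proof (rule infinite_piece_in_closed)
  show "finite F'" "infinite (piece F a - F')" using assms by auto
  show "piece F a - F' \<subseteq> leaf a" using piece_subset_leaf by blast
  fix b c assume "b \<in> piece F a - F'" "(b, c) \<in> E" "c \<notin> F'"
  then show "c \<in> piece F a - F'" using piece_step[of b F a c] assms(4) by blast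
qed auto

text \<open>The disjoint sets \<open>Y a\<close> serve as labels: pieces found inside different ones
  are certainly distinct.\<close>

lemma branch_from_family:
  assumes "finite S" "\<And>a. a \<in> S \<Longrightarrow> \<exists>b \<in> Y a. b \<in> leaf u - F \<and> infinite (piece F b) \<and> piece F b \<subseteq> Y a"
    and "\<And>a a'. a \<in> S \<Longrightarrow> a' \<in> S \<Longrightarrow> a \<noteq> a' \<Longrightarrow> Y a \<inter> Y a' = {}"
  shows "branch (card S) F u"
proof -
  obtain f where f: "\<And>a. a \<in> S \<Longrightarrow> f a \<in> Y a \<and> f a \<in> leaf u - F \<and> infinite (piece F (f a)) \<and> piece F (f a) \<subseteq> Y a"
    using assms(2) by metis
  have "inj_on f S"
  proof (rule inj_onI, rule ccontr)
    fix a a' assume "a \<in> S" "a' \<in> S" "f a = f a'" "a \<noteq> a'"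
    then show False using assms(3)[of a a'] f[of a] f[of a'] by auto
  qed
  then have "card (f ` S) = card S" by (rule card_image)
  moreover have "\<forall>a\<in>f ` S. \<forall>b\<in>f ` S. b \<in> piece F a \<longrightarrow> a = b"
  proof (intro ballI impI, rule ccontr)
    fix a b assume "a \<in> f ` S" "b \<in> f ` S" "b \<in> piece F a" "a \<noteq> b"
    then obtain x y where "x \<in> S" "y \<in> S" "a = f x" "b = f y" "x \<noteq> y" by auto
    then show False using assms(3)[of x y] f[of x] f[of y] \<open>b \<in> piece F a\<close> by auto
  qed
  ultimately show ?thesis unfolding branch_def using assms(1) f
    by (intro exI[of _ "f ` S"]) auto
qed

text \<open>A larger finite set may break an infinite piece apart, but always leaves an infinite
  fragment of it.\<close>

lemma branch_mono_set:
  assumes "branch k F u" "F \<subseteq> F'" "finite F'" shows "branch k F' u"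
proof -
  obtain S where S: "finite S" "card S = k" "S \<subseteq> leaf u - F"
     "\<forall>a\<in>S. infinite (piece F a)" "\<forall>a\<in>S. \<forall>b\<in>S. b \<in> piece F a \<longrightarrow> a = b"
    using assms(1) by (rule branchE)
  have "branch (card S) F' u"
  proof (rule branch_from_family[where Y = "piece F"])
    fix a assume a: "a \<in> S"
    then obtain b where b: "b \<in> piece F a - F'" "infinite (piece F' b)"
      using infinite_piece_refine[OF assms(3), of a F] assms(2) S by auto
    have "b \<in> leaf u" using a b S piece_in_leaf[of a u F] by auto
    moreover have "piece F' b \<subseteq> piece F a"
      using piece_antimono[OF assms(2), of b] piece_eq[of b F a] b by auto
    ultimately show "\<exists>b \<in> piece F a. b \<in> leaf u - F' \<and> infinite (piece F' b) \<and> piece F' b \<subseteq> piece F a"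
      using b by blast
  next
    fix a a' assume "a \<in> S" "a' \<in> S" "a \<noteq> a'"
    then show "piece F a \<inter> piece F a' = {}" using S(5) piece_sym piece_trans by blast
  qed (use S in auto)
  then show ?thesis using S by simp
qed

lemma branch_le: assumes "branch k F u" "j \<le> k" shows "branch j F u"
proof -
  obtain S where S: "finite S" "card S = k" "S \<subseteq> leaf u - F"
     "\<forall>a\<in>S. infinite (piece F a)" "\<forall>a\<in>S. \<forall>b\<in>S. b \<in> piece F a \<longrightarrow> a = b"
    using assms(1) by (rule branchE)
  obtain S' where "S' \<subseteq> S" "card S' = j"
    using obtain_subset_with_card_n[of j S] S assms(2) by auto
  then show ?thesis unfolding branch_def using S finite_subset[of S' S]
    by (intro exI[of _ S']) (simp, meson subsetD subset_trans)
qed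

lemma branch_0: "branch 0 F u"
  unfolding branch_def by (intro exI[of _ "{}"]) auto

lemma branch_leaf: "v \<in> leaf u \<Longrightarrow> branch k F v = branch k F u"
  using leaf_eq[of v u] unfolding branch_def by simp

lemma branch_restrict: assumes "branch k F u" shows "branch k (F \<inter> leaf u) u"
proof -
  have *: "piece (F \<inter> leaf u) a = piece F a" if "a \<in> leaf u - F" for a
  proof
    show "piece F a \<subseteq> piece (F \<inter> leaf u) a" by (rule piece_antimono) simp
    show "piece (F \<inter> leaf u) a \<subseteq> piece F a"
    proof (rule piece_subset_closed)
      fix b c assume b: "b \<in> piece F a" and "(b, c) \<in> E" "c \<notin> F \<inter> leaf u"
      moreover have "b \<in> leaf u" "b \<notin> F"
        using b piece_in_leaf[of a u F] piece_disjoint[of a F] that by auto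
      ultimately show "c \<in> piece F a" using leaf_step piece_step by blast
    qed simp
  qed
  obtain S where "finite S" "card S = k" "S \<subseteq> leaf u - F"
     "\<forall>a\<in>S. infinite (piece F a)" "\<forall>a\<in>S. \<forall>b\<in>S. b \<in> piece F a \<longrightarrow> a = b"
    using assms by (rule branchE)
  then show ?thesis unfolding branch_def using *
    by (intro exI[of _ S]) (auto simp: subset_iff)
qed

lemma branch_imp_disc:
  assumes "branch k F u" "finite F" "u \<in> V" shows "\<exists>R. branch k (disc u R) u"
proof -
  obtain m where "F \<inter> leaf u \<subseteq> disc u m"
    using finite_subset_disc[OF assms(3), of "F \<inter> leaf u"] assms(2) by auto
  then have "branch k (disc u m) u" using branch_mono_set[OF branch_restrict[OF assms(1)]] by simp
  then show ?thesis ..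
qed

text \<open>Pieces are pulled back along g: \<open>Y a\<close> collects the vertices far from v that
  g sends into the piece of a. An edge moves the image by at most s, too little to enter the disc
  about \<open>g v\<close>, because \<open>proper\<close> keeps the image farther than R + s
  away.\<close>

lemma branch_coarse_transfer:
  assumes u: "u \<in> V" and v: "v \<in> V"
    and g: "g ` leaf v \<subseteq> leaf u"
    and lip: "\<And>y y'. y \<in> leaf v \<Longrightarrow> (y, y') \<in> E \<Longrightarrow> g y' \<in> disc (g y) s"
    and onto: "\<And>x. x \<in> leaf u \<Longrightarrow> \<exists>y\<in>leaf v. x \<in> disc (g y) s"
    and proper: "\<And>y. y \<in> leaf v \<Longrightarrow> g y \<in> disc (g v) (R + s) \<Longrightarrow> y \<in> disc v R'"
    and br: "branch k (disc (g v) R) u"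
  shows "branch k (disc v R') v"
proof -
  let ?B = "disc (g v) R" and ?B' = "disc v R'"
  have gV: "\<And>y. y \<in> leaf v \<Longrightarrow> g y \<in> V" using g leaf_subset_vertices[OF u] by blast
  then have gv: "g v \<in> V" by simp
  obtain S where S: "finite S" "card S = k" "S \<subseteq> leaf u - ?B"
     "\<forall>a\<in>S. infinite (piece ?B a)" "\<forall>a\<in>S. \<forall>b\<in>S. b \<in> piece ?B a \<longrightarrow> a = b"
    using br by (rule branchE)
  define Y where "Y a = {y \<in> leaf v - ?B'. g y \<in> piece ?B a}" for a
  have "branch (card S) ?B' v"
  proof (rule branch_from_family[where Y = Y])
    fix a assume a: "a \<in> S"
    have closed: "c \<in> Y a" if "b \<in> Y a" "(b, c) \<in> E" "c \<notin> ?B'" for b c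
    proof -
      have "g b \<notin> disc (g v) (R + s)" using that proper unfolding Y_def by blast
      then have "g c \<in> piece ?B (g b)"
        using piece_of_far_disc[OF gv] lip[of b c] that unfolding Y_def by blast
      then show ?thesis using that leaf_step piece_trans unfolding Y_def by blast
    qed
    \<comment> \<open>Every x of the piece is within s of some \<open>g y\<close>, and unless x is
      close to \<open>g v\<close> this \<open>g y\<close> lies in the same piece; so a finite
      \<open>Y a\<close> would make the piece finite.\<close>
    have "infinite (Y a)"
    proof
      assume fin: "finite (Y a)"
      have "piece ?B a \<subseteq> disc (g v) (R + s) \<union> (\<Union>y\<in>Y a \<union> ?B'. disc (g y) s)"
      proof
        fix x assume x: "x \<in> piece ?B a"
        then have "x \<in> leaf u" using a S(3) piece_in_leaf[of a u ?B] by blast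
        then obtain y where y: "y \<in> leaf v" "x \<in> disc (g y) s" using onto by blast
        show "x \<in> disc (g v) (R + s) \<union> (\<Union>y\<in>Y a \<union> ?B'. disc (g y) s)"
        proof (cases "x \<in> disc (g v) (R + s)")
          case False
          then have "g y \<in> piece ?B x" using piece_of_far_disc[OF gv False] disc_sym[OF y(2)] by blast
          then have "g y \<in> piece ?B a" using x piece_trans by blast
          then have "y \<in> Y a \<union> ?B'" using y unfolding Y_def by blast
          then show ?thesis using y by blast
        qed simp
      qed
      moreover have "finite (disc (g v) (R + s) \<union> (\<Union>y\<in>Y a \<union> ?B'. disc (g y) s))"
        using fin by auto
      ultimately show False using S(4) a by (meson finite_subset)
    qed
    have "\<exists>b\<in>Y a. infinite (piece ?B' b)"
    proof (rule infinite_piece_in_closed[where u = v])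
      show "Y a \<subseteq> leaf v" "Y a \<inter> ?B' = {}" unfolding Y_def by auto
    qed (use closed \<open>infinite (Y a)\<close> in simp_all)
    then obtain b where b: "b \<in> Y a" "infinite (piece ?B' b)" by blast
    moreover have "piece ?B' b \<subseteq> Y a" using b(1) closed by (rule piece_subset_closed)
    ultimately show "\<exists>b \<in> Y a. b \<in> leaf v - ?B' \<and> infinite (piece ?B' b) \<and> piece ?B' b \<subseteq> Y a"
      unfolding Y_def by blast
  next
    fix a a' assume "a \<in> S" "a' \<in> S" "a \<noteq> a'"
    then show "Y a \<inter> Y a' = {}" unfolding Y_def using S(5) piece_sym piece_trans by blast
  qed (use S in auto)
  then show ?thesis using S by simp
qed

text \<open>Trace a walk from u to v backwards from v: the last vertex before it enters the disc
  lies on the sphere.\<close>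

lemma piece_meets_sphere:
  assumes "u \<in> V" "v \<in> leaf u - disc u R"
  obtains w where "w \<in> disc u (Suc R) - disc u R" "v \<in> piece (disc u R) w"
proof -
  have "\<exists>w\<in>disc u (Suc R) - disc u R. v \<in> piece (disc u R) w" if "v \<in> disc u j" "v \<notin> disc u R" for j
    using that
  proof (induction j arbitrary: v)
    case 0
    then show ?case using disc_mono[OF assms(1), of 0 R] by auto
  next
    case (Suc j)
    then obtain c where c: "c \<in> disc u j" "(c, v) \<in> E" unfolding disc_Suc by auto
    show ?case
    proof (cases "c \<in> disc u R")
      case True
      then show ?thesis using c Suc.prems disc_SucI[of c u R v] by (intro bexI[of _ v]) auto
    next
      case False
      then show ?thesis using Suc.IH[OF c(1) False] c(2) Suc.prems piece_step by blast
    qed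
  qed
  then show ?thesis using that assms(2) leaf_disc[of v u] by (metis DiffE)
qed

lemma finite_pieces:
  assumes "u \<in> V" shows "finite (piece (disc u R) ` (leaf u - disc u R))"
proof (rule finite_subset)
  show "piece (disc u R) ` (leaf u - disc u R) \<subseteq> piece (disc u R) ` disc u (Suc R)"
  proof clarify
    fix v assume "v \<in> leaf u" "v \<notin> disc u R"
    then obtain w where "w \<in> disc u (Suc R) - disc u R" "v \<in> piece (disc u R) w"
      using piece_meets_sphere[OF assms, of v R] by blast
    then show "piece (disc u R) v \<in> piece (disc u R) ` disc u (Suc R)" using piece_eq by blast
  qed
qed simp

text \<open>Otherwise the part of the piece inside \<open>disc u m\<close> would be closed under
  admissible edges, hence be the whole piece, which would then be finite.\<close>

lemma infinite_piece_meets_sphere: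
  assumes u: "u \<in> V" and a: "a \<in> leaf u - disc u R" and inf: "infinite (piece (disc u R) a)" and "R < m"
  obtains b where "b \<in> piece (disc u R) a" "b \<in> disc u (Suc m) - disc u m"
proof -
  obtain w where w: "w \<in> disc u (Suc R) - disc u R" "a \<in> piece (disc u R) w"
    using piece_meets_sphere[OF u a] by blast
  have eq: "piece (disc u R) w = piece (disc u R) a" using w(2) piece_eq by simp
  have wm: "w \<in> disc u m" using w(1) disc_mono[OF u, of "Suc R" m] \<open>R < m\<close> by auto
  show ?thesis
  proof (rule ccontr)
    assume no: "\<not> thesis"
    have "piece (disc u R) w \<subseteq> disc u m \<inter> piece (disc u R) w"
    proof (rule piece_subset_closed)
      fix b c assume b: "b \<in> disc u m \<inter> piece (disc u R) w" "(b, c) \<in> E" "c \<notin> disc u R"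
      have "b \<notin> disc u R" using b(1) piece_disjoint[of w "disc u R"] w(1) by auto
      then have "c \<in> piece (disc u R) w" using b piece_step by blast
      then show "c \<in> disc u m \<inter> piece (disc u R) w"
        using that[of c] no b disc_SucI[of b u m c] eq by auto
    qed (use wm in auto)
    then have "finite (piece (disc u R) w)" using finite_subset[OF _ finite_disc] by blast
    then show False using inf eq by simp
  qed
qed

text \<open>M is chosen large enough for two facts about u: beyond radius m all pieces are infinite,
  and two vertices of \<open>disc u (Suc m)\<close> in the same piece are joined inside
  \<open>disc u M\<close>. The first makes the pieces pulled back from u' infinite, the second keeps
  them distinct.\<close>

lemma branch_of_local_iso:
  assumes u: "u \<in> V"
  obtains M where "\<And>u' \<theta>. u' \<in> V \<Longrightarrow> inj_on \<theta> (disc u M) \<Longrightarrow> (\<And>r. r \<le> M \<Longrightarrow> \<theta> ` disc u r = disc u' r) \<Longrightarrow>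
    (\<And>a b. a \<in> disc u M \<Longrightarrow> b \<in> disc u M \<Longrightarrow> (a, b) \<in> E \<Longrightarrow> (\<theta> a, \<theta> b) \<in> E) \<Longrightarrow>
    branch k (disc u' R) u' \<Longrightarrow> branch k (disc u R) u"
proof -
  let ?F = "disc u R"
  \<comment> \<open>The finite pieces are finitely many, since each of them meets the sphere of
    radius \<open>Suc R\<close>; so all of them fit into one disc.\<close>
  define Q where "Q = (\<Union>w\<in>{w\<in>disc u (Suc R) - ?F. finite (piece ?F w)}. piece ?F w)"
  have "Q \<subseteq> leaf u" unfolding Q_def using piece_in_leaf disc_subset_leaf by blast
  moreover have "finite Q" unfolding Q_def by auto
  ultimately obtain m0 where m0: "Q \<subseteq> disc u m0" using finite_subset_disc[OF u] by metis
  define m where "m = max m0 (Suc R)"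
  have Rm: "R \<le> m" unfolding m_def by simp
  have Qm: "Q \<subseteq> disc u m" using m0 disc_mono[OF u, of m0 m] unfolding m_def by auto
  have inf: "infinite (piece ?F b)" if "b \<in> leaf u - disc u m" for b
  proof
    assume fin: "finite (piece ?F b)"
    have "b \<notin> ?F" using that disc_mono[OF u Rm] by auto
    then obtain w where w: "w \<in> disc u (Suc R) - ?F" "b \<in> piece ?F w"
      using piece_meets_sphere[OF u, of b R] \<open>b \<in> leaf u - disc u m\<close> by blast
    then have "finite (piece ?F w)" using fin piece_eq[OF w(2)] by simp
    then have "b \<in> Q" unfolding Q_def using w by blast
    then show False using that Qm by blast
  qed
  \<comment> \<open>Only walks that stay in \<open>disc u M\<close> are visible to a local
    isomorphism.\<close>
  define r where "r M = avoid ?F \<inter> disc u M \<times> disc u M" for M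
  have rmono: "(r i)\<^sup>* \<subseteq> (r j)\<^sup>*" if "i \<le> j" for i j
    unfolding r_def using disc_mono[OF u that] by (intro rtrancl_mono) auto
  have path: "\<exists>M. (a, b) \<in> (r M)\<^sup>*" if "(a, b) \<in> (avoid ?F)\<^sup>*" "a \<in> leaf u" for a b
    using that
  proof (induction rule: rtrancl_induct)
    case (step b c)
    then obtain M where M: "(a, b) \<in> (r M)\<^sup>*" by blast
    have "b \<in> leaf u" using step piece_in_leaf[of a u ?F] unfolding piece_def by blast
    moreover have "c \<in> leaf u" using \<open>b \<in> leaf u\<close> step(2) leaf_step unfolding avoid_def by blast
    ultimately obtain j where j: "{b, c} \<subseteq> disc u j"
      using finite_subset_disc[OF u, of "{b,c}"] by auto
    let ?N = "max M j"
    have "(a, b) \<in> (r ?N)\<^sup>*" using M rmono[of M ?N] by auto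
    moreover have "(b, c) \<in> r ?N" using j step(2) disc_mono[OF u, of j ?N] unfolding r_def by auto
    ultimately show ?case by (meson rtrancl_into_rtrancl)
  qed blast
  obtain g where g: "\<And>a b. (a, b) \<in> (avoid ?F)\<^sup>* \<Longrightarrow> a \<in> leaf u \<Longrightarrow> (a, b) \<in> (r (g a b))\<^sup>*"
    using path by metis
  \<comment> \<open>\<open>g a b\<close> is a radius that accommodates a connecting walk; for pairs
    in different pieces its value is arbitrary and does no harm in a maximum. The entry
    \<open>Suc m\<close> makes the sphere of that radius visible.\<close>
  define M where "M = Max (insert (Suc m) ((\<lambda>(a,b). g a b) ` (disc u (Suc m) \<times> disc u (Suc m))))"
  have Mm: "Suc m \<le> M" unfolding M_def by (intro Max_ge) auto
  have Mg: "g a b \<le> M" if "a \<in> disc u (Suc m)" "b \<in> disc u (Suc m)" for a b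
    unfolding M_def using that by (intro Max_ge) auto
  have RM: "R \<le> M" using Mm unfolding m_def by linarith
  show ?thesis
  proof (rule that)
    fix u' \<theta> assume u': "u' \<in> V" and inj: "inj_on \<theta> (disc u M)"
      and img: "\<And>r. r \<le> M \<Longrightarrow> \<theta> ` disc u r = disc u' r"
      and hom: "\<And>a b. a \<in> disc u M \<Longrightarrow> b \<in> disc u M \<Longrightarrow> (a, b) \<in> E \<Longrightarrow> (\<theta> a, \<theta> b) \<in> E"
      and br: "branch k (disc u' R) u'"
    let ?F' = "disc u' R"
    obtain S where S: "finite S" "card S = k" "S \<subseteq> leaf u' - ?F'"
      "\<forall>a\<in>S. infinite (piece ?F' a)" "\<forall>a\<in>S. \<forall>b\<in>S. b \<in> piece ?F' a \<longrightarrow> a = b"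
      using br by (rule branchE)
    have "\<exists>b. b \<in> disc u (Suc m) - disc u m \<and> \<theta> b \<in> piece ?F' a" if "a \<in> S" for a
    proof -
      have "a \<in> leaf u' - ?F'" "infinite (piece ?F' a)" "R < m"
        using S that unfolding m_def by auto
      then obtain b where b: "b \<in> piece ?F' a" "b \<in> disc u' (Suc m) - disc u' m"
        by (rule infinite_piece_meets_sphere[OF u'])
      then obtain c where "c \<in> disc u (Suc m)" "b = \<theta> c" using img[OF Mm] by blast
      moreover have "c \<notin> disc u m" using b img[of m] Mm \<open>b = \<theta> c\<close> by auto
      ultimately show ?thesis using b by blast
    qed
    then obtain h where h: "\<And>a. a \<in> S \<Longrightarrow> h a \<in> disc u (Suc m) - disc u m \<and> \<theta> (h a) \<in> piece ?F' a"
      by metis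
    \<comment> \<open>Injectivity prevents a vertex outside the inner disc from being mapped into
      the image of that disc.\<close>
    have nF: "\<theta> x \<notin> ?F'" if "x \<in> disc u M" "x \<notin> ?F" for x
    proof
      assume "\<theta> x \<in> ?F'"
      then obtain y where "y \<in> ?F" "\<theta> x = \<theta> y" using img[OF RM] by blast
      then show False using inj_onD[OF inj, of x y] that disc_mono[OF u RM] by auto
    qed
    have transport: "\<theta> y \<in> piece ?F' (\<theta> x)" if "(x, y) \<in> (r M)\<^sup>*" for x y
      using that
    proof (induction rule: rtrancl_induct)
      case (step y z)
      then show ?case
        using hom[of y z] nF[of y] nF[of z] piece_step[of "\<theta> y" ?F' "\<theta> x" "\<theta> z"]
        unfolding r_def avoid_def by auto
    qed simp
    have hl: "h a \<in> leaf u - disc u m" if "a \<in> S" for a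
      using h[OF that] disc_subset_leaf[of u "Suc m"] by blast
    have "branch (card S) ?F u"
    proof (rule branch_from_family[where Y = "\<lambda>a. piece ?F (h a)"])
      fix a assume a: "a \<in> S"
      show "\<exists>b\<in>piece ?F (h a). b \<in> leaf u - ?F \<and> infinite (piece ?F b) \<and> piece ?F b \<subseteq> piece ?F (h a)"
        using hl[OF a] inf[OF hl[OF a]] disc_mono[OF u Rm] by (intro bexI[of _ "h a"]) auto
    next
      fix a a' assume aa: "a \<in> S" "a' \<in> S" "a \<noteq> a'"
      show "piece ?F (h a) \<inter> piece ?F (h a') = {}"
      proof (rule ccontr)
        assume "\<not> ?thesis"
        then have "h a' \<in> piece ?F (h a)" using piece_sym piece_trans by blast
        then have "(h a, h a') \<in> (r (g (h a) (h a')))\<^sup>*"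
          using g[of "h a" "h a'"] hl[OF aa(1)] unfolding piece_def by blast
        then have "(h a, h a') \<in> (r M)\<^sup>*"
          using Mg[of "h a" "h a'"] h[OF aa(1)] h[OF aa(2)] rmono[of "g (h a) (h a')" M] by auto
        then have "\<theta> (h a') \<in> piece ?F' (\<theta> (h a))" by (rule transport)
        then have "a' \<in> piece ?F' a"
          using h[OF aa(1)] h[OF aa(2)] piece_sym piece_trans by meson
        then show False using S(5) aa by blast
      qed
    qed (use S in auto)
    then show "branch k ?F u" using S by simp
  qed
qed

section \<open>Splitting an infinite piece\<close>

lemma disc_subset_piece:
  assumes "u \<in> V" "disc u r \<inter> Q = {}" shows "disc u r \<subseteq> piece Q u"
  using assms(2)
proof (induction r)
  case (Suc r)
  then have sub: "disc u r \<subseteq> piece Q u" using disc_mono[OF assms(1), of r "Suc r"] by auto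
  show ?case
  proof
    fix v assume v: "v \<in> disc u (Suc r)"
    then obtain c where c: "c \<in> disc u r" "(c, v) \<in> E" unfolding disc_Suc by auto
    then have "c \<notin> Q" "v \<notin> Q" using Suc.prems v disc_mono[OF assms(1), of r "Suc r"] by auto
    then show "v \<in> piece Q u" using c sub piece_step by blast
  qed
qed simp

text \<open>Deep inside an infinite piece there is a disc with three infinite pieces around it, and
  the connected set outside the piece can meet only one of these.\<close>

lemma uniform_branch_splits:
  assumes u: "u \<in> V" and unif: "\<And>v. v \<in> leaf u \<Longrightarrow> branch 3 (disc v R) v"
    and F: "finite F" "F \<subseteq> leaf u" and a: "a \<in> leaf u - F" "infinite (piece F a)"
  obtains F' b c where "finite F'" "F \<subseteq> F'" "F' \<subseteq> leaf u" "b \<in> piece F a - F'" "c \<in> piece F a - F'"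
    "infinite (piece F' b)" "infinite (piece F' c)" "c \<notin> piece F' b"
proof -
  obtain r where r: "F \<subseteq> disc u r" using finite_subset_disc[OF u F] by blast
  let ?B = "disc u r"
  obtain b0 where b0: "b0 \<in> piece F a - ?B" "infinite (piece ?B b0)"
    using infinite_piece_refine[of ?B a F] r a by auto
  \<comment> \<open>Distance more than r + R from u puts the disc of radius R about y outside
    \<open>?B\<close> and inside the piece of y.\<close>
  have "infinite (piece ?B b0 - disc u (r + R))" using b0(2) by simp
  then obtain y where y: "y \<in> piece ?B b0" "y \<notin> disc u (r + R)"
    using infinite_imp_nonempty by blast
  have b0l: "b0 \<in> leaf u" using b0 a piece_in_leaf[of a u F] by auto
  then have yl: "y \<in> leaf u" using y piece_in_leaf[of b0 u ?B] by auto
  then have yV: "y \<in> V" using leaf_subset_vertices[OF u] by auto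
  let ?Q = "disc y R"
  have Q: "?Q \<subseteq> piece ?B y" "?Q \<inter> ?B = {}" using piece_of_far_disc[OF u y(2)] by auto
  have yF: "piece ?B y \<subseteq> piece F a"
  proof -
    have "piece ?B y = piece ?B b0" using y(1) piece_eq by simp
    moreover have "piece ?B b0 \<subseteq> piece F b0" using piece_antimono r by simp
    moreover have "piece F b0 = piece F a" using b0(1) piece_eq by simp
    ultimately show ?thesis by simp
  qed
  obtain S where S: "finite S" "card S = 3" "S \<subseteq> leaf y - ?Q"
    "\<forall>a\<in>S. infinite (piece ?Q a)" "\<forall>a\<in>S. \<forall>b\<in>S. b \<in> piece ?Q a \<longrightarrow> a = b"
    using unif[OF yl] by (rule branchE)
  define S0 where "S0 = {x \<in> S. piece ?Q x \<inter> ?B \<noteq> {}}"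
  have B: "?B \<subseteq> piece ?Q u" using disc_subset_piece[OF u, of r ?Q] Q(2) by auto
  \<comment> \<open>\<open>?B\<close> is connected outside \<open>?Q\<close>, so it lies in a single
    piece and at most one of the three representatives can reach it.\<close>
  have "x = x'" if "x \<in> S0" "x' \<in> S0" for x x'
  proof -
    have "u \<in> piece ?Q x" "u \<in> piece ?Q x'"
      using that B piece_sym piece_trans unfolding S0_def by blast+
    then have "x' \<in> piece ?Q x" using piece_sym piece_trans by blast
    then show ?thesis using S(5) that unfolding S0_def by blast
  qed
  then have "card S0 \<le> 1" using S(1) unfolding S0_def by (subst card_le_Suc0_iff_eq[unfolded One_nat_def[symmetric]]) auto
  then have "card (S - S0) \<ge> 2" using S diff_card_le_card_Diff[of S0 S] finite_subset[of S0 S]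
    unfolding S0_def by auto
  then obtain x1 x2 where x: "x1 \<in> S - S0" "x2 \<in> S - S0" "x1 \<noteq> x2"
    by (metis card_le_Suc0_iff_eq finite_Diff S(1) Suc_1 not_less_eq_eq numeral_2_eq_2)
  let ?F' = "?B \<union> ?Q"
  \<comment> \<open>A piece that misses \<open>?B\<close> stays intact when \<open>?B\<close> is
    removed as well.\<close>
  have eq: "piece ?Q x \<subseteq> piece ?F' x" if "x \<in> S - S0" for x
  proof (rule piece_subset_closed)
    fix b c assume b: "b \<in> piece ?F' x" "(b, c) \<in> E" "c \<notin> ?Q"
    have "b \<in> piece ?Q x" using b(1) piece_antimono[of ?Q ?F' x] by auto
    moreover have "b \<notin> ?Q" using calculation piece_disjoint[of x ?Q] that S(3) by auto
    ultimately have "c \<in> piece ?Q x" using b piece_step by blast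
    then have "c \<notin> ?F'" using that b(3) unfolding S0_def by blast
    moreover have "b \<notin> ?F'" using \<open>b \<in> piece ?Q x\<close> \<open>b \<notin> ?Q\<close> that unfolding S0_def by blast
    ultimately show "c \<in> piece ?F' x" using b piece_step by blast
  qed simp
  \<comment> \<open>The piece of x touches the sphere about y, and \<open>?Q\<close> lies in the
    piece of y outside \<open>?B\<close>; so x belongs to that piece too.\<close>
  have inB: "x \<in> piece ?B y - ?F'" if xS: "x \<in> S - S0" for x
  proof -
    obtain w where w: "w \<in> disc y (Suc R) - ?Q" "x \<in> piece ?Q w"
      using piece_meets_sphere[OF yV, of x R] xS S(3) by blast
    have wx: "w \<in> piece ?Q x" using w(2) piece_sym by blast
    then have wB: "w \<notin> ?B" using xS unfolding S0_def by blast
    obtain q where q: "q \<in> ?Q" "(q, w) \<in> E" using w(1) unfolding disc_Suc by auto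
    have "w \<in> piece ?B y" using q Q wB piece_step by blast
    moreover have "w \<in> piece ?B x" using eq[OF xS] wx piece_antimono[of ?B ?F' x] by auto
    moreover have "x \<notin> ?B" using xS piece_self[of x ?Q] unfolding S0_def by blast
    ultimately show ?thesis using piece_sym piece_trans xS S(3) by blast
  qed
  show ?thesis
  proof (rule that)
    show "finite ?F'" "F \<subseteq> ?F'" using r by auto
    show "?F' \<subseteq> leaf u" using disc_subset_leaf leaf_eq[OF yl] by blast
    show "x1 \<in> piece F a - ?F'" "x2 \<in> piece F a - ?F'" using inB x yF by auto
    show "infinite (piece ?F' x1)" "infinite (piece ?F' x2)"
      using S(4) x eq finite_subset by blast+
    show "x2 \<notin> piece ?F' x1" using S(5) x piece_antimono[of ?Q ?F' x1] by blast
  qed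
qed

end

section \<open>Ends of spaces covered by plaques\<close>

text \<open>Plaques are indexed by V instead of being collected as sets, because the same subset may
  be a plaque of several charts and the index will record which.\<close>

locale plaque_cover =
  fixes S :: "'b topology" and V :: "'v set" and P :: "'v \<Rightarrow> 'b set"
  assumes open_plaque: "\<And>u. u \<in> V \<Longrightarrow> openin S (P u)"
    and connected_plaque: "\<And>u. u \<in> V \<Longrightarrow> connectedin S (P u)"
    and plaque_nonempty: "\<And>u. u \<in> V \<Longrightarrow> P u \<noteq> {}"
    and compact_closure_plaque: "\<And>u. u \<in> V \<Longrightarrow> compactin S (S closure_of P u)"
    and plaques_cover: "(\<Union>u\<in>V. P u) = topspace S"
    and finite_meeting: "\<And>u. u \<in> V \<Longrightarrow> finite {v \<in> V. P u \<inter> P v \<noteq> {}}"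
begin

definition meets :: "'v rel" where
  "meets = {(u, v) \<in> V \<times> V. P u \<inter> P v \<noteq> {}}"

sublocale locally_finite_graph V meets
proof
  show "finite (meets `` {u})" for u
  proof (cases "u \<in> V")
    case True
    have "meets `` {u} \<subseteq> {v \<in> V. P u \<inter> P v \<noteq> {}}" unfolding meets_def by auto
    then show ?thesis using finite_meeting[OF True] finite_subset by blast
  next
    case False
    then have "meets `` {u} = {}" unfolding meets_def by auto
    then show ?thesis by simp
  qed
qed (use plaque_nonempty in \<open>auto simp: meets_def\<close>)

definition cluster :: "'v set \<Rightarrow> 'v \<Rightarrow> 'b set" where
  "cluster F a = (\<Union>v\<in>piece F a. P v)"

definition region :: "'v \<Rightarrow> 'b set" where
  "region u = (\<Union>v\<in>leaf u. P v)"

lemma meetsI: "u \<in> V \<Longrightarrow> v \<in> V \<Longrightarrow> x \<in> P u \<Longrightarrow> x \<in> P v \<Longrightarrow> (u, v) \<in> meets"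
  unfolding meets_def by auto

lemma piece_in_vertices: "a \<in> V \<Longrightarrow> piece F a \<subseteq> V"
  using piece_subset_leaf leaf_subset_vertices by blast

lemma connectedin_cluster:
  assumes "a \<in> V" shows "connectedin S (cluster F a)"
proof -
  have ex: "\<exists>C. connectedin S C \<and> P a \<subseteq> C \<and> P v \<subseteq> C \<and> C \<subseteq> cluster F a" if "(a, v) \<in> (avoid F)\<^sup>*" for v
    using that
  proof (induction rule: rtrancl_induct)
    case base
    have "P a \<subseteq> cluster F a" unfolding cluster_def using piece_self[of a F] by blast
    then show ?case using connected_plaque[OF assms] by blast
  next
    case (step v w)
    then obtain C where C: "connectedin S C" "P a \<subseteq> C" "P v \<subseteq> C" "C \<subseteq> cluster F a" by blast
    have vw: "v \<in> V" "w \<in> V" "P v \<inter> P w \<noteq> {}"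
      using step(2) unfolding avoid_def unfolding meets_def by auto
    have "w \<in> piece F a" using step(1,2) unfolding piece_def by auto
    then have "P w \<subseteq> cluster F a" unfolding cluster_def by blast
    moreover have "connectedin S (C \<union> P w)"
      by (intro connectedin_Un C connected_plaque vw) (use C vw in blast)
    ultimately show ?case using C by (intro exI[of _ "C \<union> P w"]) auto
  qed
  let ?\<C> = "{C. connectedin S C \<and> P a \<subseteq> C \<and> C \<subseteq> cluster F a}"
  have "cluster F a = \<Union>?\<C>"
  proof
    show "cluster F a \<subseteq> \<Union>?\<C>"
    proof
      fix x assume "x \<in> cluster F a"
      then obtain v where "(a, v) \<in> (avoid F)\<^sup>*" "x \<in> P v" unfolding cluster_def piece_def by auto
      then show "x \<in> \<Union>?\<C>" using ex[of v] by blast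
    qed
  qed blast
  moreover have "connectedin S (\<Union>?\<C>)"
    by (rule connectedin_Union) (use plaque_nonempty[OF assms] in auto)
  ultimately show ?thesis by simp
qed

lemma region_eq_cluster: "region u = cluster {} u"
  unfolding region_def cluster_def piece_empty ..

lemma plaque_subset_region: "v \<in> leaf u \<Longrightarrow> P v \<subseteq> region u"
  unfolding region_def by blast

lemma leafI: "u \<in> V \<Longrightarrow> v \<in> V \<Longrightarrow> x \<in> P v \<Longrightarrow> x \<in> region u \<Longrightarrow> v \<in> leaf u"
  unfolding region_def using leaf_subset_vertices meetsI leaf_step by blast

lemma region_subset: "u \<in> V \<Longrightarrow> region u \<subseteq> topspace S"
  unfolding region_def using leaf_subset_vertices plaques_cover by blast

lemma openin_region: "u \<in> V \<Longrightarrow> openin S (region u)"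
  unfolding region_def using leaf_subset_vertices open_plaque by blast

lemma connectedin_region: "u \<in> V \<Longrightarrow> connectedin S (region u)"
  unfolding region_eq_cluster by (rule connectedin_cluster)

lemma closedin_region: assumes "u \<in> V" shows "closedin S (region u)"
proof -
  have "topspace S - region u = (\<Union>v\<in>V - leaf u. P v)"
  proof
    show "topspace S - region u \<subseteq> (\<Union>v\<in>V - leaf u. P v)"
      using plaques_cover plaque_subset_region by blast
    show "(\<Union>v\<in>V - leaf u. P v) \<subseteq> topspace S - region u"
      using plaques_cover leafI[OF assms] by blast
  qed
  then show ?thesis unfolding closedin_def using region_subset[OF assms] open_plaque by auto
qed

text \<open>Regions are connected and open, and also closed because the complement of one is a union
  of plaques; nonempty sets of this kind are components.\<close>

lemma connected_components_regions: "connected_components_of S = region ` V"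
proof -
  have comp: "region u \<in> connected_components_of S" if u: "u \<in> V" for u
  proof -
    obtain x where x: "x \<in> P u" using plaque_nonempty[OF u] by blast
    then have xr: "x \<in> region u" using plaque_subset_region[of u u] by auto
    have "connected_component_of_set S x = region u"
    proof
      show "region u \<subseteq> connected_component_of_set S x"
        by (rule connected_component_of_maximal[OF connectedin_region[OF u] xr])
      show "connected_component_of_set S x \<subseteq> region u"
      proof (rule ccontr)
        let ?C = "connected_component_of_set S x"
        assume "\<not> ?C \<subseteq> region u"
        moreover have "?C \<subseteq> topspace S" by (rule connected_component_of_subset_topspace)
        ultimately have "(topspace S - region u) \<inter> ?C \<noteq> {}" by blast
        moreover have "region u \<inter> ?C \<noteq> {}"
          using xr region_subset[OF u] connected_component_of_refl by fastforce
        ultimately show False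
          using connectedinD[OF connectedin_connected_component_of openin_region[OF u]
              openin_diff[OF openin_topspace closedin_region[OF u]], of x] \<open>?C \<subseteq> topspace S\<close> by blast
      qed
    qed
    moreover have "x \<in> topspace S" using xr region_subset[OF u] by blast
    ultimately show ?thesis unfolding connected_components_of_def by blast
  qed
  have "C \<in> region ` V" if C: "C \<in> connected_components_of S" for C
  proof -
    obtain x where x: "x \<in> C" using nonempty_connected_components_of[OF C] by blast
    then have "x \<in> topspace S" using connected_components_of_subset[OF C] by blast
    then obtain u where u: "u \<in> V" "x \<in> P u" using plaques_cover by blast
    then have "x \<in> region u" using plaque_subset_region[of u u] by auto
    then have "C = region u"
      using connected_components_of_disjoint[OF C comp[OF u(1)]] x unfolding disjnt_def by blast
    then show ?thesis using u by blast
  qed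
  then show ?thesis using comp by blast
qed

section \<open>Compact sets and finite sets of plaques\<close>

abbreviation leaf_space :: "'v \<Rightarrow> 'b topology" where
  "leaf_space u \<equiv> subtopology S (region u)"

definition hits :: "'v \<Rightarrow> 'b set \<Rightarrow> 'v set" where
  "hits u K = {v \<in> leaf u. P v \<inter> K \<noteq> {}}"

text \<open>Together with \<open>hits\<close> this passes between finite sets of plaques and compact
  sets. Closures are taken to obtain compactness; the price is that a shell may meet plaques outside
  F.\<close>

definition shell :: "'v \<Rightarrow> 'v set \<Rightarrow> 'b set" where
  "shell u F = (\<Union>v\<in>F. leaf_space u closure_of P v)"

lemma topspace_leaf_space: "u \<in> V \<Longrightarrow> topspace (leaf_space u) = region u"
  using region_subset[of u] by (simp add: Int_absorb1)

lemma subset_hits: "K \<subseteq> region u \<Longrightarrow> K \<subseteq> (\<Union>v\<in>hits u K. P v)"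
  unfolding region_def hits_def by blast

text \<open>Finitely many plaques cover K, a plaque meeting K meets one of these, and each has only
  finitely many neighbours.\<close>

lemma finite_hits:
  assumes u: "u \<in> V" and "compactin (leaf_space u) K" shows "finite (hits u K)"
proof -
  have K: "compactin S K" "K \<subseteq> region u" using assms(2) by (auto simp: compactin_subtopology)
  have "\<exists>\<F>. finite \<F> \<and> \<F> \<subseteq> P ` leaf u \<and> K \<subseteq> \<Union>\<F>"
    by (rule compactinD[OF K(1)]) (use K(2) open_plaque leaf_subset_vertices[OF u] in \<open>auto simp: region_def\<close>)
  then obtain \<F> where \<F>: "finite \<F>" "\<F> \<subseteq> P ` leaf u" "K \<subseteq> \<Union>\<F>" by (elim exE conjE)
  obtain G where G: "finite G" "G \<subseteq> leaf u" "K \<subseteq> (\<Union>v\<in>G. P v)"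
    using finite_subset_image[OF \<F>(1,2)] \<F>(3) by auto
  have "hits u K \<subseteq> (\<Union>v\<in>G. meets `` {v})"
  proof
    fix v assume "v \<in> hits u K"
    then obtain x w where "v \<in> leaf u" "x \<in> P v" "w \<in> G" "x \<in> P w" using G(3) unfolding hits_def by blast
    then have "(w, v) \<in> meets" using meetsI G(2) leaf_subset_vertices[OF u] by blast
    then show "v \<in> (\<Union>v\<in>G. meets `` {v})" using \<open>w \<in> G\<close> by blast
  qed
  then show ?thesis using G(1) finite_neighbours by (meson finite_UN_I finite_subset)
qed

lemma compact_shell:
  assumes u: "u \<in> V" and "finite F" "F \<subseteq> leaf u" shows "compactin (leaf_space u) (shell u F)"
  unfolding shell_def
proof (intro compactin_Union; clarify?)
  fix v assume "v \<in> F"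
  then have v: "v \<in> leaf u" "v \<in> V" using assms leaf_subset_vertices[OF u] by auto
  have "leaf_space u closure_of P v = region u \<inter> S closure_of P v"
    using plaque_subset_region[OF v(1)] by (simp add: closure_of_subtopology Int_absorb1)
  moreover have "compactin S (region u \<inter> S closure_of P v)"
    using closedin_region[OF u] compact_closure_plaque[OF v(2)] by (rule closed_Int_compactin)
  ultimately show "compactin (leaf_space u) (leaf_space u closure_of P v)"
    by (simp add: compactin_subtopology)
qed (use assms in auto)

lemma plaque_subset_shell: assumes "u \<in> V" "F \<subseteq> leaf u" "v \<in> F" shows "P v \<subseteq> shell u F"
proof -
  have "P v \<subseteq> topspace (leaf_space u)"
    using assms plaque_subset_region[of v u] topspace_leaf_space by auto
  then have "P v \<subseteq> leaf_space u closure_of P v" by (rule closure_of_subset)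
  then show ?thesis unfolding shell_def using assms(3) by blast
qed

lemma closedin_shell: "finite F \<Longrightarrow> closedin (leaf_space u) (shell u F)"
  unfolding shell_def by (intro closedin_Union) auto

text \<open>This replaces compactness of the closure, the size condition on components, by a count
  of plaques.\<close>

lemma compact_closure_iff:
  assumes u: "u \<in> V" and C: "C \<subseteq> region u"
  shows "compactin (leaf_space u) (leaf_space u closure_of C) \<longleftrightarrow> finite (hits u C)"
proof
  assume "compactin (leaf_space u) (leaf_space u closure_of C)"
  then have "finite (hits u (leaf_space u closure_of C))" by (rule finite_hits[OF u])
  moreover have "hits u C \<subseteq> hits u (leaf_space u closure_of C)"
    using closure_of_subset[of C "leaf_space u"] C topspace_leaf_space[OF u] unfolding hits_def by auto
  ultimately show "finite (hits u C)" using finite_subset by blast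
next
  assume fin: "finite (hits u C)"
  have sub: "hits u C \<subseteq> leaf u" unfolding hits_def by blast
  have "C \<subseteq> shell u (hits u C)" using subset_hits[OF C] plaque_subset_shell[OF u sub] by blast
  then have "leaf_space u closure_of C \<subseteq> shell u (hits u C)"
    by (rule closure_of_minimal) (rule closedin_shell[OF fin])
  then show "compactin (leaf_space u) (leaf_space u closure_of C)"
    using closed_compactin[OF compact_shell[OF u fin sub]] by simp
qed

lemma unbounded_component_of_piece:
  assumes u: "u \<in> V" and "hits u K \<subseteq> F" and a: "a \<in> leaf u - F" "infinite (piece F a)"
  obtains C where "C \<in> unbounded_components (leaf_space u) K" "cluster F a \<subseteq> C"
proof (rule unbounded_component_extend)
  have aV: "a \<in> V" using a(1) leaf_subset_vertices[OF u] by blast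
  have pl: "piece F a \<subseteq> leaf u" using a(1) piece_in_leaf[of a u] by blast
  then have sub: "cluster F a \<subseteq> region u" unfolding cluster_def region_def by blast
  show "connectedin (leaf_space u) (cluster F a)"
    using sub connectedin_cluster[OF aV] by (simp add: connectedin_subtopology)
  show "cluster F a \<noteq> {}" unfolding cluster_def using plaque_nonempty[OF aV] piece_self[of a F] by blast
  have "v \<notin> F" if "v \<in> piece F a" for v using that piece_disjoint[of a F] a(1) by blast
  then show "cluster F a \<inter> K = {}" unfolding cluster_def using assms(2) pl unfolding hits_def by blast
  have "piece F a \<subseteq> hits u (cluster F a)"
    unfolding hits_def cluster_def using plaque_nonempty pl leaf_subset_vertices[OF u] by blast
  then show "\<not> compactin (leaf_space u) (leaf_space u closure_of cluster F a)"
    using compact_closure_iff[OF u sub] a(2) finite_subset by blast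
qed (rule that)

text \<open>A plaque of the leaf outside F misses K, so it lies in C as soon as it meets C. Hence
  the plaques outside F that meet C are closed under admissible edges; they are infinitely many
  because C has non-compact closure.\<close>

lemma piece_in_unbounded_component:
  assumes u: "u \<in> V" and F: "finite F" "hits u K \<subseteq> F"
    and C: "C \<in> unbounded_components (leaf_space u) K"
  obtains a where "a \<in> leaf u - F" "infinite (piece F a)" "cluster F a \<subseteq> C"
proof -
  let ?T = "subtopology (leaf_space u) (topspace (leaf_space u) - K)"
  have Cc: "C \<in> connected_components_of ?T" and nc: "\<not> compactin (leaf_space u) (leaf_space u closure_of C)"
    using C unfolding unbounded_components_def by auto
  have CR: "C \<subseteq> region u" using connected_components_of_subset[OF Cc] region_subset[OF u] by auto
  define Y where "Y = hits u C - F"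
  have inf: "infinite Y" unfolding Y_def using compact_closure_iff[OF u CR] nc F(1) by simp
  have sub: "P v \<subseteq> C" if "v \<in> Y" for v
  proof (rule connected_components_of_maximal[OF Cc])
    have v: "v \<in> leaf u" "P v \<inter> C \<noteq> {}" "v \<notin> F" using that unfolding Y_def hits_def by auto
    then have vV: "v \<in> V" using leaf_subset_vertices[OF u] by blast
    have "P v \<inter> K = {}" using v F(2) unfolding hits_def by blast
    then show "connectedin ?T (P v)"
      using connected_plaque[OF vV] plaque_subset_region[OF v(1)] region_subset[OF u]
      by (auto simp: connectedin_subtopology)
    show "\<not> disjnt C (P v)" using v unfolding disjnt_def by blast
  qed
  have closed: "c \<in> Y" if "b \<in> Y" "(b, c) \<in> meets" "c \<notin> F" for b c
  proof -
    have "c \<in> leaf u" using that leaf_step unfolding Y_def hits_def by blast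
    moreover have "P c \<inter> C \<noteq> {}" using sub[OF that(1)] that(2) unfolding meets_def by blast
    ultimately show ?thesis using that(3) unfolding Y_def hits_def by blast
  qed
  have Y: "Y \<subseteq> leaf u" "Y \<inter> F = {}" unfolding Y_def hits_def by auto
  have "\<exists>b\<in>Y. infinite (piece F b)"
    by (rule infinite_piece_in_closed[OF F(1) inf Y]) (rule closed)
  then obtain b where b: "b \<in> Y" "infinite (piece F b)" by blast
  have "piece F b \<subseteq> Y" using b(1) closed by (rule piece_subset_closed)
  then have "cluster F b \<subseteq> C" unfolding cluster_def using sub by blast
  then show ?thesis using that[of b] b Y by blast
qed

lemma cluster_disjoint:
  assumes "a \<in> V - F" "b \<in> V - F" "b \<notin> piece F a" shows "cluster F a \<inter> cluster F b = {}"
proof (rule ccontr)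
  assume "\<not> ?thesis"
  then obtain x v w where vw: "v \<in> piece F a" "w \<in> piece F b" "x \<in> P v" "x \<in> P w"
    unfolding cluster_def by blast
  then have "v \<notin> F" "w \<notin> F" using piece_disjoint assms by blast+
  moreover have "(v, w) \<in> meets" using vw meetsI piece_in_vertices assms by blast
  ultimately have "w \<in> piece F a" using vw(1) piece_step by blast
  then show False using vw(2) assms(3) piece_sym piece_trans by blast
qed

text \<open>As the shell may meet plaques outside F, the infinite piece is first refined past all
  plaques that it meets. The component found there cannot leave the cluster, because the cluster and
  the remaining plaques outside F would split it into disjoint open sets.\<close>

lemma unbounded_component_in_cluster:
  assumes u: "u \<in> V" and F: "finite F" "F \<subseteq> leaf u" and a: "a \<in> leaf u - F" "infinite (piece F a)"
  obtains C where "C \<in> unbounded_components (leaf_space u) (shell u F)" "C \<subseteq> cluster F a"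
proof -
  let ?K = "shell u F"
  have lV: "leaf u \<subseteq> V" by (rule leaf_subset_vertices[OF u])
  have fin: "finite (hits u ?K)" by (rule finite_hits[OF u compact_shell[OF u F]])
  have "F \<subseteq> hits u ?K"
  proof
    fix v assume v: "v \<in> F"
    then show "v \<in> hits u ?K"
      using plaque_subset_shell[OF u F(2) v] plaque_nonempty[of v] F(2) lV unfolding hits_def by blast
  qed
  then obtain b where b: "b \<in> piece F a - hits u ?K" "infinite (piece (hits u ?K) b)"
    using infinite_piece_refine[OF fin _ a(2)] a(1) by blast
  have bl: "b \<in> leaf u" using b a piece_in_leaf[of a u F] by blast
  obtain C where C: "C \<in> unbounded_components (leaf_space u) ?K" "cluster (hits u ?K) b \<subseteq> C"
    using unbounded_component_of_piece[OF u order_refl, of b ?K] bl b by blast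
  have Pb: "P b \<subseteq> C" using C(2) piece_self[of b "hits u ?K"] unfolding cluster_def by blast
  have Cc: "C \<in> connected_components_of (subtopology (leaf_space u) (topspace (leaf_space u) - ?K))"
    using C(1) unfolding unbounded_components_def by blast
  have "connectedin (subtopology (leaf_space u) (topspace (leaf_space u) - ?K)) C"
    using Cc by (rule connectedin_connected_components_of)
  then have con: "connectedin (leaf_space u) C" and dis: "C \<inter> ?K = {}" by (auto simp: connectedin_subtopology)
  have CR: "C \<subseteq> region u" using connectedin_subset_topspace[OF con] by simp
  define O1 where "O1 = cluster F a - ?K"
  define O2 where "O2 = (\<Union>v\<in>leaf u - F - piece F a. P v) - ?K"
  have op: "openin (leaf_space u) (P v)" if "v \<in> leaf u" for v
    using that lV open_plaque plaque_subset_region[OF that] by (intro subset_openin_subtopology) auto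
  have pl: "piece F a \<subseteq> leaf u" using a(1) piece_in_leaf[of a u] by blast
  have "openin (leaf_space u) O1" "openin (leaf_space u) O2"
    unfolding O1_def O2_def cluster_def using op pl
    by (auto intro!: openin_diff closedin_shell[OF F(1)])
  moreover have "C \<subseteq> O1 \<union> O2"
  proof
    fix x assume x: "x \<in> C"
    then obtain v where v: "v \<in> leaf u" "x \<in> P v" using CR unfolding region_def by blast
    moreover have "v \<notin> F" using plaque_subset_shell[OF u F(2), of v] v x dis by blast
    ultimately show "x \<in> O1 \<union> O2" unfolding O1_def O2_def cluster_def using x dis by blast
  qed
  moreover have "O1 \<inter> O2 = {}"
  proof (rule ccontr)
    assume "O1 \<inter> O2 \<noteq> {}"
    then obtain x v w where "v \<in> piece F a" "x \<in> P v" "x \<in> P w" "w \<in> leaf u - F - piece F a"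
      unfolding O1_def O2_def cluster_def by blast
    moreover from this have "(v, w) \<in> meets" using meetsI pl lV by blast
    moreover have "v \<notin> F" using calculation(1) piece_disjoint[of a F] a(1) by blast
    ultimately show False using piece_step by blast
  qed
  moreover have "O1 \<inter> C \<noteq> {}"
    using Pb plaque_nonempty[of b] bl lV b(1) dis unfolding O1_def cluster_def by blast
  ultimately have "O2 \<inter> C = {}" using connectedinD[OF con, of O1 O2] by blast
  then have "C \<subseteq> cluster F a" using \<open>C \<subseteq> O1 \<union> O2\<close> unfolding O1_def by blast
  then show ?thesis using that C(1) by blast
qed

lemma exhausted_ends_leaf:
  assumes u: "u \<in> V" shows "exhausted_ends (leaf_space u) (\<lambda>n. shell u (disc u n))"
proof
  fix i j :: nat assume "i \<le> j"
  then show "shell u (disc u i) \<subseteq> shell u (disc u j)" unfolding shell_def using disc_mono[OF u] by blast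
next
  show "compactin (leaf_space u) (shell u (disc u i))" for i
    by (intro compact_shell u disc_subset_leaf) simp
next
  fix K assume K: "compactin (leaf_space u) K"
  have sub: "hits u K \<subseteq> leaf u" unfolding hits_def by blast
  obtain m where m: "hits u K \<subseteq> disc u m" using finite_subset_disc[OF u finite_hits[OF u K] sub] by blast
  have "K \<subseteq> region u" using K compactin_subset_topspace by force
  then have "K \<subseteq> (\<Union>v\<in>hits u K. P v)" by (rule subset_hits)
  also have "\<dots> \<subseteq> shell u (disc u m)"
    using m plaque_subset_shell[OF u disc_subset_leaf] by blast
  finally show "\<exists>i. K \<subseteq> shell u (disc u i)" by blast
  let ?F = "disc u m"
  have "\<exists>a. a \<in> leaf u - ?F \<and> infinite (piece ?F a) \<and> cluster ?F a \<subseteq> C"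
    if C: "C \<in> unbounded_components (leaf_space u) K" for C
    using piece_in_unbounded_component[OF u finite_disc m C] by metis
  then obtain f where f: "\<And>C. C \<in> unbounded_components (leaf_space u) K \<Longrightarrow>
      f C \<in> leaf u - ?F \<and> cluster ?F (f C) \<subseteq> C" by metis
  \<comment> \<open>Distinct components contain distinct pieces, and a disc has only finitely many
    pieces around it.\<close>
  have "inj_on (\<lambda>C. piece ?F (f C)) (unbounded_components (leaf_space u) K)"
  proof (rule inj_onI)
    fix C D assume CD: "C \<in> unbounded_components (leaf_space u) K" "D \<in> unbounded_components (leaf_space u) K"
      and eq: "piece ?F (f C) = piece ?F (f D)"
    have "cluster ?F (f C) \<subseteq> C \<inter> D" using f[OF CD(1)] f[OF CD(2)] eq unfolding cluster_def by auto
    moreover have "P (f C) \<subseteq> cluster ?F (f C)" unfolding cluster_def using piece_self by blast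
    moreover have "P (f C) \<noteq> {}"
      using plaque_nonempty f[OF CD(1)] leaf_subset_vertices[OF u] by blast
    ultimately show "C = D" using unbounded_component_eq[OF CD] by blast
  qed
  moreover have "(\<lambda>C. piece ?F (f C)) ` unbounded_components (leaf_space u) K \<subseteq> piece ?F ` (leaf u - ?F)"
    using f by blast
  ultimately show "finite (unbounded_components (leaf_space u) K)"
    using finite_pieces[OF u, of m] by (meson inj_on_finite)
next
  fix K K' C assume K: "compactin (leaf_space u) K" "compactin (leaf_space u) K'" "K \<subseteq> K'"
    and C: "C \<in> unbounded_components (leaf_space u) K"
  let ?F = "hits u K'"
  have "hits u K \<subseteq> ?F" using K(3) unfolding hits_def by blast
  then obtain a where a: "a \<in> leaf u - ?F" "infinite (piece ?F a)" "cluster ?F a \<subseteq> C"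
    using piece_in_unbounded_component[OF u finite_hits[OF u K(2)] _ C] by metis
  obtain C' where C': "C' \<in> unbounded_components (leaf_space u) K'" "cluster ?F a \<subseteq> C'"
    using unbounded_component_of_piece[OF u order_refl a(1,2)] by metis
  obtain D where D: "D \<in> unbounded_components (leaf_space u) K" "C' \<subseteq> D"
    using unbounded_component_coarsen[OF C'(1) K(3)] by metis
  have "P a \<subseteq> cluster ?F a" unfolding cluster_def using piece_self by blast
  moreover have "P a \<noteq> {}" using plaque_nonempty a(1) leaf_subset_vertices[OF u] by blast
  \<comment> \<open>Both D and C contain the nonempty plaque of a.\<close>
  ultimately have "D = C" using unbounded_component_eq[OF D(1) C] a(3) C'(2) D(2) by blast
  then show "\<exists>C'\<in>unbounded_components (leaf_space u) K'. C' \<subseteq> C" using C'(1) D(2) by blast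
qed

text \<open>The compact set is a shell, which may separate more than the plaques of F do; hence only
  an inequality.\<close>

lemma card_unbounded_of_branch:
  assumes u: "u \<in> V" and "branch k F u" "finite F"
  obtains K where "compactin (leaf_space u) K" "k \<le> card (unbounded_components (leaf_space u) K)"
proof -
  interpret exhausted_ends "leaf_space u" "\<lambda>n. shell u (disc u n)" by (rule exhausted_ends_leaf[OF u])
  let ?F = "F \<inter> leaf u"
  have F: "finite ?F" "?F \<subseteq> leaf u" using assms(3) by auto
  obtain S' where S': "finite S'" "card S' = k" "S' \<subseteq> leaf u - ?F"
    "\<forall>a\<in>S'. infinite (piece ?F a)" "\<forall>a\<in>S'. \<forall>b\<in>S'. b \<in> piece ?F a \<longrightarrow> a = b"
    using branch_restrict[OF assms(2)] by (rule branchE)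
  let ?U = "unbounded_components (leaf_space u) (shell u ?F)"
  have "\<exists>C. C \<in> ?U \<and> C \<subseteq> cluster ?F a" if a: "a \<in> S'" for a
  proof -
    have "a \<in> leaf u - ?F" "infinite (piece ?F a)" using S'(3,4) a by auto
    then obtain C where "C \<in> ?U" "C \<subseteq> cluster ?F a" by (rule unbounded_component_in_cluster[OF u F])
    then show ?thesis by blast
  qed
  then obtain f where f: "\<And>a. a \<in> S' \<Longrightarrow> f a \<in> ?U \<and> f a \<subseteq> cluster ?F a" by metis
  have "inj_on f S'"
  proof (rule inj_onI, rule ccontr)
    fix a b assume ab: "a \<in> S'" "b \<in> S'" "f a = f b" "a \<noteq> b"
    then have "b \<notin> piece ?F a" using S'(5) by blast
    moreover have "a \<in> V - ?F" "b \<in> V - ?F" using ab S'(3) leaf_subset_vertices[OF u] by auto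
    ultimately have "cluster ?F a \<inter> cluster ?F b = {}" by (intro cluster_disjoint)
    moreover have "f a \<noteq> {}" using f[OF ab(1)] unbounded_component_nonempty by blast
    ultimately show False using f[OF ab(1)] f[OF ab(2)] ab(3) by auto
  qed
  moreover have cK: "compactin (leaf_space u) (shell u ?F)" by (rule compact_shell[OF u F])
  ultimately have "k \<le> card ?U"
    using card_inj_on_le[of f S' ?U] f finite_unbounded[OF cK] S'(2) by blast
  then show ?thesis using that cK by blast
qed

lemma branch_of_card_unbounded:
  assumes u: "u \<in> V" and K: "compactin (leaf_space u) K"
  shows "branch (card (unbounded_components (leaf_space u) K)) (hits u K) u"
proof -
  interpret exhausted_ends "leaf_space u" "\<lambda>n. shell u (disc u n)" by (rule exhausted_ends_leaf[OF u])
  let ?F = "hits u K" and ?U = "unbounded_components (leaf_space u) K"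
  have "\<exists>a. a \<in> leaf u - ?F \<and> infinite (piece ?F a) \<and> cluster ?F a \<subseteq> C" if C: "C \<in> ?U" for C
    using piece_in_unbounded_component[OF u finite_hits[OF u K] order_refl C] by metis
  then obtain f where f: "\<And>C. C \<in> ?U \<Longrightarrow> f C \<in> leaf u - ?F \<and> infinite (piece ?F (f C)) \<and> cluster ?F (f C) \<subseteq> C"
    by metis
  show ?thesis
  proof (rule branch_from_family[where Y = "\<lambda>C. piece ?F (f C)"])
    show "finite ?U" by (rule finite_unbounded[OF K])
    fix C assume C: "C \<in> ?U"
    then show "\<exists>b\<in>piece ?F (f C). b \<in> leaf u - ?F \<and> infinite (piece ?F b) \<and> piece ?F b \<subseteq> piece ?F (f C)"
      using f[OF C] by (intro bexI[of _ "f C"]) auto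
  next
    fix C D assume CD: "C \<in> ?U" "D \<in> ?U" "C \<noteq> D"
    show "piece ?F (f C) \<inter> piece ?F (f D) = {}"
    proof (rule ccontr)
      assume "\<not> ?thesis"
      then obtain v where v: "v \<in> piece ?F (f C)" "v \<in> piece ?F (f D)" by blast
      have "P v \<subseteq> C \<inter> D" using v f[OF CD(1)] f[OF CD(2)] unfolding cluster_def by blast
      moreover have "v \<in> V" using v(1) f[OF CD(1)] piece_in_vertices leaf_subset_vertices[OF u] by blast
      ultimately show False using unbounded_component_eq[OF CD(1,2)] CD(3) plaque_nonempty by blast
    qed
  qed
qed

text \<open>Pieces give at least as many components for some compact set, and components at least as
  many pieces for some finite set; so both counts have the same maximum k.\<close>

lemma card_ends_of_branch:
  assumes u: "u \<in> V" and "branch k F u" "finite F"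
    and no: "\<And>F. finite F \<Longrightarrow> \<not> branch (Suc k) F u"
  shows "card (topspace (end_space (leaf_space u))) = k" "finite (topspace (end_space (leaf_space u)))"
proof -
  interpret exhausted_ends "leaf_space u" "\<lambda>n. shell u (disc u n)" by (rule exhausted_ends_leaf[OF u])
  have le: "card (unbounded_components (leaf_space u) K) \<le> k" if K: "compactin (leaf_space u) K" for K
    using branch_le[OF branch_of_card_unbounded[OF u K], of "Suc k"] no[OF finite_hits[OF u K]]
    by (meson not_less_eq_eq)
  obtain K where K: "compactin (leaf_space u) K" "k \<le> card (unbounded_components (leaf_space u) K)"
    using card_unbounded_of_branch[OF assms(1-3)] by metis
  then have "card (unbounded_components (leaf_space u) K) = k" using le[OF K(1)] by simp
  then show "card (topspace (end_space (leaf_space u))) = k" "finite (topspace (end_space (leaf_space u)))"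
    using card_end_space[OF K(1) _ le] by blast+
qed

lemma cantor_ends_of_uniform_branch:
  assumes u: "u \<in> V" and unif: "\<And>v. v \<in> leaf u \<Longrightarrow> branch 3 (disc v R) v"
  shows "cantor_space (end_space (leaf_space u))"
proof -
  interpret exhausted_ends "leaf_space u" "\<lambda>n. shell u (disc u n)" by (rule exhausted_ends_leaf[OF u])
  have lV: "leaf u \<subseteq> V" by (rule leaf_subset_vertices[OF u])
  show ?thesis
  proof (rule cantor_end_space)
    \<comment> \<open>The infinite pieces show that the leaf has infinitely many plaques, which
      yields an unbounded component for the empty compact set.\<close>
    obtain S' where "card S' = 3" "S' \<subseteq> leaf u - disc u R" "\<forall>a\<in>S'. infinite (piece (disc u R) a)"
      using unif[OF leaf_self] by (rule branchE)
    moreover from this have "S' \<noteq> {}" by auto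
    ultimately obtain a where "a \<in> leaf u" "infinite (piece (disc u R) a)" by blast
    then have "infinite (leaf u)" using piece_in_leaf[of a u "disc u R"] by (meson finite_subset)
    then have "infinite (piece {} u)" by (simp add: piece_empty)
    moreover have "hits u {} \<subseteq> {}" "u \<in> leaf u - {}" unfolding hits_def by auto
    ultimately obtain C where "C \<in> unbounded_components (leaf_space u) {}"
      using unbounded_component_of_piece[OF u] by metis
    then show "unbounded_components (leaf_space u) {} \<noteq> {}" by blast
  next
    fix K C assume K: "compactin (leaf_space u) K" and C: "C \<in> unbounded_components (leaf_space u) K"
    let ?F = "hits u K"
    have F: "finite ?F" "?F \<subseteq> leaf u" using finite_hits[OF u K] unfolding hits_def by auto
    obtain a where a: "a \<in> leaf u - ?F" "infinite (piece ?F a)" "cluster ?F a \<subseteq> C"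
      using piece_in_unbounded_component[OF u F(1) order_refl C] by metis
    obtain F' b c where F': "finite F'" "?F \<subseteq> F'" "F' \<subseteq> leaf u" "b \<in> piece ?F a - F'" "c \<in> piece ?F a - F'"
      "infinite (piece F' b)" "infinite (piece F' c)" "c \<notin> piece F' b"
      using uniform_branch_splits[OF u unif F a(1,2)] by metis
    have bc: "b \<in> leaf u - F'" "c \<in> leaf u - F'" using F'(4,5) piece_in_leaf[of a u ?F] a(1) by auto
    obtain C1 where C1: "C1 \<in> unbounded_components (leaf_space u) (shell u F')" "C1 \<subseteq> cluster F' b"
      using unbounded_component_in_cluster[OF u F'(1,3) bc(1) F'(6)] by metis
    obtain C2 where C2: "C2 \<in> unbounded_components (leaf_space u) (shell u F')" "C2 \<subseteq> cluster F' c"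
      using unbounded_component_in_cluster[OF u F'(1,3) bc(2) F'(7)] by metis
    have sub: "cluster F' d \<subseteq> C" if "d \<in> piece ?F a" for d
    proof -
      have "piece F' d \<subseteq> piece ?F a" using piece_antimono[OF F'(2), of d] piece_eq[OF that] by simp
      then show ?thesis using a(3) unfolding cluster_def by blast
    qed
    have "cluster F' b \<inter> cluster F' c = {}" by (rule cluster_disjoint) (use bc lV F'(8) in auto)
    then have "C1 \<noteq> C2" using C1 C2 unbounded_component_nonempty by blast
    moreover have "K \<subseteq> shell u F'"
    proof -
      have "K \<subseteq> region u" using compactin_subset_topspace[OF K] by simp
      then show ?thesis using subset_hits[of K u] plaque_subset_shell[OF u F'(3)] F'(2) by blast
    qed
    moreover have "compactin (leaf_space u) (shell u F')" by (rule compact_shell[OF u F'(1,3)])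
    ultimately show "\<exists>K' C1 C2. compactin (leaf_space u) K' \<and> K \<subseteq> K' \<and> C1 \<in> unbounded_components (leaf_space u) K' \<and>
        C2 \<in> unbounded_components (leaf_space u) K' \<and> C1 \<noteq> C2 \<and> C1 \<subseteq> C \<and> C2 \<subseteq> C"
      using C1 C2 sub F'(4,5) by blast
  qed
qed

end

section \<open>Leaves and plaques\<close>

text \<open>The ball is star-shaped about its centre. Segments are connected in the full power
  topology, of which \<open>Euclidean_space n\<close> is a subspace.\<close>

lemma connectedin_open_ball:
  assumes "open_ball_in_Rn n B" shows "connectedin (Euclidean_space n) B"
proof -
  obtain c r where c: "c \<in> topspace (Euclidean_space n)" and r: "r > 0"
    and B: "B = {x \<in> topspace (Euclidean_space n). L2_set (\<lambda>i. x i - c i) {..<n} < r}"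
    using assms unfolding open_ball_in_Rn_def by blast
  define seg where "seg x = (\<lambda>t i. c i + t * (x i - c i)) ` {0..1::real}" for x :: "nat \<Rightarrow> real"
  have con: "connectedin (powertop_real UNIV) (seg x)" for x
    unfolding seg_def
  proof (rule connectedin_continuous_map_image)
    show "continuous_map euclideanreal (powertop_real UNIV) (\<lambda>t i. c i + t * (x i - c i))"
      by (auto simp: continuous_map_componentwise_UNIV intro!: continuous_intros)
    show "connectedin euclideanreal {0..1}" by simp
  qed
  have sub: "seg x \<subseteq> B" if x: "x \<in> B" for x
  proof
    fix y assume "y \<in> seg x"
    then obtain t where t: "0 \<le> t" "t \<le> 1" "y = (\<lambda>i. c i + t * (x i - c i))" unfolding seg_def by auto
    have "L2_set (\<lambda>i. y i - c i) {..<n} = t * L2_set (\<lambda>i. x i - c i) {..<n}"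
      unfolding t(3) using t(1) by (simp add: L2_set_right_distrib)
    also have "\<dots> \<le> 1 * L2_set (\<lambda>i. x i - c i) {..<n}" using t by (intro mult_right_mono L2_set_nonneg)
    also have "\<dots> < r" using x unfolding B by simp
    finally show "y \<in> B" using x c unfolding B t(3) by (auto simp: topspace_Euclidean_space)
  qed
  have cx: "c \<in> seg x" "x \<in> seg x" for x
    unfolding seg_def by (rule image_eqI[of _ _ 0] image_eqI[of _ _ 1]; simp)+
  have "B = \<Union>(seg ` B)" using sub cx by blast
  moreover have "connectedin (powertop_real UNIV) (\<Union>(seg ` B))"
  proof (rule connectedin_Union)
    show "\<Inter>(seg ` B) \<noteq> {}" using cx(1) by blast
  qed (use con in auto)
  moreover have "B \<subseteq> {x. \<forall>i\<ge>n. x i = 0}" unfolding B by (auto simp: topspace_Euclidean_space)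
  ultimately show ?thesis unfolding Euclidean_space_def by (simp add: connectedin_subtopology)
qed

lemma closure_of_meets_open: "x \<in> T closure_of S \<Longrightarrow> openin T W \<Longrightarrow> x \<in> W \<Longrightarrow> S \<inter> W \<noteq> {}"
  unfolding in_closure_of by blast

section \<open>Plaques of a single chart\<close>

definition plaque :: "('a, 'z) fol_chart \<times> 'z \<Rightarrow> 'a set" where
  "plaque = (\<lambda>(c, z). {x \<in> chart_dom c. chart_map c x \<in> chart_ball c \<times> {z}})"

lemma plaques_eq: "plaques c = (\<lambda>z. plaque (c, z)) ` topspace (chart_trans c)"
  unfolding plaques_def plaque_def by auto

lemma product_chart_maps:
  assumes "product_chart X n c"
  shows "chart_dom c \<subseteq> topspace X" "chart_map c ` chart_dom c = chart_ball c \<times> topspace (chart_trans c)"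
    "chart_ball c \<noteq> {}" "connectedin (Euclidean_space n) (chart_ball c)"
proof -
  have d: "openin X (chart_dom c)" and b: "open_ball_in_Rn n (chart_ball c)"
    and h: "homeomorphic_map (subtopology X (chart_dom c))
       (prod_topology (subtopology (Euclidean_space n) (chart_ball c)) (chart_trans c)) (chart_map c)"
    using assms unfolding product_chart_def by auto
  show sub: "chart_dom c \<subseteq> topspace X" using d by (rule openin_subset)
  have "chart_ball c \<subseteq> topspace (Euclidean_space n)" using b unfolding open_ball_in_Rn_def by blast
  then show "chart_map c ` chart_dom c = chart_ball c \<times> topspace (chart_trans c)"
    using homeomorphic_imp_surjective_map[OF h] sub by (simp add: Int_absorb1)
  show "connectedin (Euclidean_space n) (chart_ball c)" by (rule connectedin_open_ball[OF b])
  obtain q r where q: "q \<in> topspace (Euclidean_space n)" "r > 0"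
    "chart_ball c = {x \<in> topspace (Euclidean_space n). L2_set (\<lambda>i. x i - q i) {..<n} < r}"
    using b unfolding open_ball_in_Rn_def by blast
  then have "q \<in> chart_ball c" by (simp add: L2_set_def)
  then show "chart_ball c \<noteq> {}" by blast
qed

lemma plaque_eq:
  assumes "product_chart X n c" shows "plaque (c, z) = {x \<in> chart_dom c. transverse_proj c x = z}"
proof -
  have "fst (chart_map c x) \<in> chart_ball c" if "x \<in> chart_dom c" for x
  proof -
    have "chart_map c x \<in> chart_ball c \<times> topspace (chart_trans c)"
      using product_chart_maps(2)[OF assms] that by blast
    then show ?thesis by (simp add: mem_Times_iff)
  qed
  then show ?thesis unfolding plaque_def transverse_proj_def by (auto simp: mem_Times_iff)
qed

lemma product_plaque_nonempty:
  assumes "product_chart X n c" "z \<in> topspace (chart_trans c)" shows "plaque (c, z) \<noteq> {}"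
proof -
  obtain b where "b \<in> chart_ball c" using product_chart_maps(3)[OF assms(1)] by blast
  then have "(b, z) \<in> chart_map c ` chart_dom c" using product_chart_maps(2)[OF assms(1)] assms(2) by simp
  then obtain x where "x \<in> chart_dom c" "chart_map c x = (b, z)" by (metis imageE)
  then have "x \<in> plaque (c, z)" using \<open>b \<in> chart_ball c\<close> unfolding plaque_def by simp
  then show ?thesis by blast
qed

lemma transverse_proj_in:
  assumes "product_chart X n c" "x \<in> chart_dom c" shows "transverse_proj c x \<in> topspace (chart_trans c)"
proof -
  have "chart_map c x \<in> chart_ball c \<times> topspace (chart_trans c)"
    using product_chart_maps(2)[OF assms(1)] assms(2) by blast
  then show ?thesis unfolding transverse_proj_def by auto
qed

lemma continuous_transverse_proj:
  assumes "product_chart X n c"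
  shows "continuous_map (subtopology X (chart_dom c)) (chart_trans c) (transverse_proj c)"
proof -
  have "continuous_map (subtopology X (chart_dom c))
       (prod_topology (subtopology (Euclidean_space n) (chart_ball c)) (chart_trans c)) (chart_map c)"
    using assms homeomorphic_imp_continuous_map unfolding product_chart_def by blast
  from continuous_map_compose[OF this continuous_map_snd] show ?thesis
    unfolding transverse_proj_def[abs_def] o_def .
qed

lemma open_transverse_preimage:
  assumes "product_chart X n c" "openin (chart_trans c) W"
  shows "openin X {x \<in> chart_dom c. transverse_proj c x \<in> W}"
proof -
  have d: "openin X (chart_dom c)" using assms(1) unfolding product_chart_def by blast
  have "openin (subtopology X (chart_dom c)) {x \<in> topspace (subtopology X (chart_dom c)). transverse_proj c x \<in> W}"
    by (rule openin_continuous_map_preimage[OF continuous_transverse_proj[OF assms(1)] assms(2)])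
  then show ?thesis
    using d product_chart_maps(1)[OF assms(1)] by (simp add: openin_open_subtopology Int_absorb1)
qed

lemma open_transverse_image:
  assumes "product_chart X n c" "openin X W" "W \<subseteq> chart_dom c"
  shows "openin (chart_trans c) (transverse_proj c ` W)"
proof -
  have h: "homeomorphic_map (subtopology X (chart_dom c))
       (prod_topology (subtopology (Euclidean_space n) (chart_ball c)) (chart_trans c)) (chart_map c)"
    using assms(1) unfolding product_chart_def by blast
  have "openin (subtopology X (chart_dom c)) W" using assms(2,3) by (rule subset_openin_subtopology)
  then have "openin (prod_topology (subtopology (Euclidean_space n) (chart_ball c)) (chart_trans c)) (chart_map c ` W)"
    using homeomorphic_imp_open_map[OF h] unfolding open_map_def by blast
  then have "openin (chart_trans c) (snd ` chart_map c ` W)"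
    using open_map_snd unfolding open_map_def by blast
  then show ?thesis unfolding transverse_proj_def by (simp add: image_image)
qed

lemma connectedin_plaque_ambient:
  assumes "product_chart X n c" "z \<in> topspace (chart_trans c)" shows "connectedin X (plaque (c, z))"
proof -
  let ?Q = "prod_topology (subtopology (Euclidean_space n) (chart_ball c)) (chart_trans c)"
  obtain g where g: "homeomorphic_maps (subtopology X (chart_dom c)) ?Q (chart_map c) g"
    using assms(1) unfolding product_chart_def homeomorphic_map_maps by blast
  have tops: "topspace (subtopology X (chart_dom c)) = chart_dom c"
    using product_chart_maps(1)[OF assms(1)] by (simp add: Int_absorb1)
  have "connectedin (subtopology (Euclidean_space n) (chart_ball c)) (chart_ball c)"
    using product_chart_maps(4)[OF assms(1)] by (simp add: connectedin_subtopology)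
  then have "connectedin ?Q (chart_ball c \<times> {z})"
    using assms(2) by (simp add: connectedin_Times)
  then have "connectedin (subtopology X (chart_dom c)) (g ` (chart_ball c \<times> {z}))"
    using g connectedin_continuous_map_image unfolding homeomorphic_maps_def by blast
  moreover have "g ` (chart_ball c \<times> {z}) = plaque (c, z)"
  proof
    have gi: "g (chart_map c x) = x" if "x \<in> chart_dom c" for x
      using g that tops unfolding homeomorphic_maps_def by auto
    show "plaque (c, z) \<subseteq> g ` (chart_ball c \<times> {z})"
    proof
      fix x assume "x \<in> plaque (c, z)"
      then have "x \<in> chart_dom c" "chart_map c x \<in> chart_ball c \<times> {z}" unfolding plaque_def by auto
      then show "x \<in> g ` (chart_ball c \<times> {z})" using gi[of x] by (metis imageI)
    qed
    show "g ` (chart_ball c \<times> {z}) \<subseteq> plaque (c, z)"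
    proof clarify
      fix b assume b: "b \<in> chart_ball c"
      then obtain x where "x \<in> chart_dom c" "chart_map c x = (b, z)"
      proof -
        have "(b, z) \<in> chart_map c ` chart_dom c"
          using product_chart_maps(2)[OF assms(1)] assms(2) b by simp
        then show thesis using that by (metis imageE)
      qed
      then show "g (b, z) \<in> plaque (c, z)" using gi[of x] b unfolding plaque_def by auto
    qed
  qed
  ultimately show ?thesis by (simp add: connectedin_subtopology)
qed

lemma foliated_change_proj:
  assumes "foliated_change X c d" "p \<in> chart_dom c \<inter> chart_dom d"
  obtains V h where "openin X V" "p \<in> V" "V \<subseteq> chart_dom c \<inter> chart_dom d"
    "\<And>q. q \<in> V \<Longrightarrow> transverse_proj d q = h (transverse_proj c q)"
proof -
  from bspec[OF assms(1)[unfolded foliated_change_def] assms(2)]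
  obtain V g h where V: "openin X V" "p \<in> V" "V \<subseteq> chart_dom c \<inter> chart_dom d"
    and gh: "\<forall>q\<in>V. \<forall>x z. chart_map c q = (x, z) \<longrightarrow> chart_map d q = (g (x, z), h z)"
    by (elim exE conjE)
  show ?thesis
  proof (rule that[OF V])
    fix q assume "q \<in> V"
    then have "chart_map d q = (g (fst (chart_map c q), snd (chart_map c q)), h (snd (chart_map c q)))"
      using gh surjective_pairing by blast
    then show "transverse_proj d q = h (transverse_proj c q)" unfolding transverse_proj_def by simp
  qed
qed

text \<open>Foliated charts are compatible with the atlas by definition, but not with each other;
  the transverse change is composed through an atlas chart at p.\<close>

lemma foliated_charts_overlap:
  assumes A: "foliated_atlas X n \<A>" and c: "foliated_chart X n \<A> c" and d: "foliated_chart X n \<A> d"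
    and p: "p \<in> chart_dom c \<inter> chart_dom d"
  shows "\<exists>V h. openin X V \<and> p \<in> V \<and> V \<subseteq> chart_dom c \<inter> chart_dom d \<and>
    (\<forall>q\<in>V. transverse_proj d q = h (transverse_proj c q))"
proof -
  have "p \<in> topspace X" using p product_chart_maps(1) c unfolding foliated_chart_def by blast
  then obtain a where a: "a \<in> \<A>" "p \<in> chart_dom a" using A unfolding foliated_atlas_def by blast
  have ca: "foliated_change X c a" "foliated_change X a d"
    using a c d unfolding foliated_chart_def by auto
  obtain V1 h1 where 1: "openin X V1" "p \<in> V1" "V1 \<subseteq> chart_dom c \<inter> chart_dom a"
    "\<And>q. q \<in> V1 \<Longrightarrow> transverse_proj a q = h1 (transverse_proj c q)"
    using p a by (auto intro: foliated_change_proj[OF ca(1)])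
  obtain V2 h2 where 2: "openin X V2" "p \<in> V2" "V2 \<subseteq> chart_dom a \<inter> chart_dom d"
    "\<And>q. q \<in> V2 \<Longrightarrow> transverse_proj d q = h2 (transverse_proj a q)"
    using p a by (auto intro: foliated_change_proj[OF ca(2)])
  show ?thesis
    by (intro exI[of _ "V1 \<inter> V2"] exI[of _ "h2 \<circ> h1"]) (use 1 2 in auto)
qed

section \<open>The plaque graph of a regular atlas\<close>

locale compact_foliation =
  fixes X :: "'a topology" and n :: nat and \<A> \<U> :: "('a, 'z) fol_chart set"
  assumes foliated: "compact_polish_foliated_space X n \<A>" and regular: "regular_atlas X n \<A> \<U>"
begin

abbreviation LT :: "'a topology" where "LT \<equiv> leaf_topology X n \<A>"

definition vertices :: "(('a, 'z) fol_chart \<times> 'z) set" where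
  "vertices = (SIGMA c:\<U>. topspace (chart_trans c))"

lemma compactX: "compact_space X" and atlas: "foliated_atlas X n \<A>"
  using foliated unfolding compact_polish_foliated_space_def by auto

lemma regular_charts: "\<forall>c\<in>\<U>. foliated_chart X n \<A> c"
  and coverU: "(\<Union>c\<in>\<U>. chart_dom c) = topspace X"
  and regular_extension: "\<forall>c\<in>\<U>. \<exists>c'. foliated_chart X n \<A> c' \<and>
    X closure_of (chart_dom c) \<subseteq> chart_dom c' \<and> (\<forall>x \<in> chart_dom c. chart_map c x = chart_map c' x)"
  and regular_locally_finite: "\<forall>x \<in> topspace X. \<exists>V. openin X V \<and> x \<in> V \<and> finite {c\<in>\<U>. V \<inter> chart_dom c \<noteq> {}}"
  and regular_plaques: "\<forall>c\<in>\<U>. \<forall>d\<in>\<U>. \<forall>P \<in> plaques c. \<forall>Q \<in> plaques d. \<forall>Q' \<in> plaques d.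
    X closure_of P \<inter> X closure_of Q \<noteq> {} \<and> X closure_of P \<inter> X closure_of Q' \<noteq> {} \<longrightarrow> Q = Q'"
  by (rule regular[unfolded regular_atlas_def, THEN conjunct1]
      regular[unfolded regular_atlas_def, THEN conjunct2, THEN conjunct1]
      regular[unfolded regular_atlas_def, THEN conjunct2, THEN conjunct2, THEN conjunct1]
      regular[unfolded regular_atlas_def, THEN conjunct2, THEN conjunct2, THEN conjunct2, THEN conjunct1]
      regular[unfolded regular_atlas_def, THEN conjunct2, THEN conjunct2, THEN conjunct2, THEN conjunct2])+

lemma chartU: "c \<in> \<U> \<Longrightarrow> foliated_chart X n \<A> c"
  using regular_charts by simp

lemma productU: "c \<in> \<U> \<Longrightarrow> product_chart X n c"
  using chartU unfolding foliated_chart_def by blast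

lemma plaqueU: "c \<in> \<U> \<Longrightarrow> plaque (c, z) = {x \<in> chart_dom c. transverse_proj c x = z}"
  by (rule plaque_eq[OF productU])

lemma in_vertices: "(c, z) \<in> vertices \<longleftrightarrow> c \<in> \<U> \<and> z \<in> topspace (chart_trans c)"
  unfolding vertices_def by auto

lemma vertex_of_point: "c \<in> \<U> \<Longrightarrow> x \<in> chart_dom c \<Longrightarrow>
    (c, transverse_proj c x) \<in> vertices \<and> x \<in> plaque (c, transverse_proj c x)"
  using transverse_proj_in[OF productU] by (simp add: plaqueU in_vertices)

text \<open>Near a common point the transverse coordinate of another chart is a function of that of
  c, hence constant along a plaque of c. So the generating plaques of all other charts cut it in
  ambient-open sets.\<close>

lemma open_in_plaque:
  assumes c: "foliated_chart X n \<A> c" and W: "openin LT W"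
  shows "openin (subtopology X (plaque (c, z))) (W \<inter> plaque (c, z))"
proof -
  have pc: "product_chart X n c" using c unfolding foliated_chart_def by blast
  let ?P = "plaque (c, z)"
  have "generate_topology_on (\<Union>c \<in> {c. foliated_chart X n \<A> c}. plaques c) W"
    using W unfolding leaf_topology_def openin_topology_generated_by_iff .
  then show ?thesis
  proof (induction rule: generate_topology_on.induct)
    case (Int a b)
    have "a \<inter> b \<inter> ?P = (a \<inter> ?P) \<inter> (b \<inter> ?P)" by blast
    then show ?case using Int openin_Int by simp
  next
    case (UN K)
    have "\<Union>K \<inter> ?P = (\<Union>k\<in>K. k \<inter> ?P)" by blast
    moreover have "openin (subtopology X ?P) (\<Union>k\<in>K. k \<inter> ?P)" using UN by (intro openin_Union) auto
    ultimately show ?case by simp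
  next
    case (Basis s)
    then obtain d w where d: "foliated_chart X n \<A> d" "s = plaque (d, w)"
      unfolding plaques_eq by blast
    have pd: "product_chart X n d" using d unfolding foliated_chart_def by blast
    have "\<exists>V. openin X V \<and> p \<in> V \<and> V \<inter> ?P \<subseteq> s" if p: "p \<in> s \<inter> ?P" for p
    proof -
      have pp: "p \<in> chart_dom c \<inter> chart_dom d" "transverse_proj c p = z" "transverse_proj d p = w"
        using p unfolding d(2) plaque_eq[OF pc] plaque_eq[OF pd] by auto
      from foliated_charts_overlap[OF atlas c d(1) pp(1)]
      obtain V h where V: "openin X V" "p \<in> V" "V \<subseteq> chart_dom c \<inter> chart_dom d"
        "\<forall>q\<in>V. transverse_proj d q = h (transverse_proj c q)" by (elim exE conjE)
      have "V \<inter> ?P \<subseteq> s"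
        using V pp unfolding d(2) plaque_eq[OF pc] plaque_eq[OF pd] by auto
      then show ?thesis using V by blast
    qed
    then obtain N where N: "\<And>p. p \<in> s \<inter> ?P \<Longrightarrow> openin X (N p) \<and> p \<in> N p \<and> N p \<inter> ?P \<subseteq> s" by metis
    have "s \<inter> ?P = (\<Union>p\<in>s \<inter> ?P. N p) \<inter> ?P" using N by blast
    moreover have "openin X (\<Union>p\<in>s \<inter> ?P. N p)" using N by blast
    ultimately show ?case unfolding openin_subtopology by blast
  qed simp
qed

lemma topspace_LT: "topspace LT = topspace X"
proof -
  have "topspace LT = \<Union>(\<Union>c \<in> {c. foliated_chart X n \<A> c}. plaques c)"
    unfolding leaf_topology_def by (simp add: topology_generated_by_topspace)
  also have "\<dots> = topspace X"
  proof
    show "\<Union>(\<Union>c \<in> {c. foliated_chart X n \<A> c}. plaques c) \<subseteq> topspace X"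
      unfolding plaques_eq plaque_def foliated_chart_def using product_chart_maps(1) by fastforce
    show "topspace X \<subseteq> \<Union>(\<Union>c \<in> {c. foliated_chart X n \<A> c}. plaques c)"
    proof
      fix x assume "x \<in> topspace X"
      then obtain c where "c \<in> \<U>" "x \<in> chart_dom c" using coverU by blast
      then show "x \<in> \<Union>(\<Union>c \<in> {c. foliated_chart X n \<A> c}. plaques c)"
        using vertex_of_point[of c x] chartU[of c] unfolding plaques_eq by (auto simp: in_vertices)
    qed
  qed
  finally show ?thesis .
qed

text \<open>Through this map, connectedness and compactness established in X within a plaque pass to
  the leaf topology.\<close>

lemma continuous_plaque_LT:
  assumes c: "foliated_chart X n \<A> c" shows "continuous_map (subtopology X (plaque (c, z))) LT id"
proof -
  have sub: "plaque (c, z) \<subseteq> topspace X"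
    using c product_chart_maps(1) unfolding foliated_chart_def plaque_def by fastforce
  show ?thesis unfolding continuous_map_def
  proof (intro conjI allI impI)
    fix W assume "openin LT W"
    moreover have "{x \<in> topspace (subtopology X (plaque (c, z))). id x \<in> W} = W \<inter> plaque (c, z)"
      using sub by auto
    ultimately show "openin (subtopology X (plaque (c, z))) {x \<in> topspace (subtopology X (plaque (c, z))). id x \<in> W}"
      using open_in_plaque[OF c] by simp
  qed (use sub topspace_LT in auto)
qed

lemma connectedin_plaque: assumes "(c, z) \<in> vertices" shows "connectedin LT (plaque (c, z))"
proof -
  have c: "c \<in> \<U>" "z \<in> topspace (chart_trans c)" using assms in_vertices by auto
  have "connectedin (subtopology X (plaque (c, z))) (plaque (c, z))"
    using connectedin_plaque_ambient[OF productU[OF c(1)] c(2)] by (simp add: connectedin_subtopology)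
  from connectedin_continuous_map_image[OF continuous_plaque_LT[OF chartU[OF c(1)]] this]
  show ?thesis by simp
qed

lemma openin_plaque: assumes "(c, z) \<in> vertices" shows "openin LT (plaque (c, z))"
  unfolding leaf_topology_def
  by (rule topology_generated_by_Basis) (use assms chartU in \<open>auto simp: in_vertices plaques_eq\<close>)

text \<open>In the larger chart given by regularity, points of the transversal are closed, so the
  closure stays in one plaque. Within it \<open>continuous_plaque_LT\<close> carries the compactness
  inherited from X to the leaf topology.\<close>

lemma compact_closure_plaque_ambient:
  assumes "(c, z) \<in> vertices" shows "compactin LT (X closure_of plaque (c, z))"
proof -
  have c: "c \<in> \<U>" "z \<in> topspace (chart_trans c)" using assms in_vertices by auto
  let ?P = "plaque (c, z)"
  from bspec[OF regular_extension c(1)]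
  obtain c' where c': "foliated_chart X n \<A> c'" "X closure_of (chart_dom c) \<subseteq> chart_dom c'"
    "\<forall>x \<in> chart_dom c. chart_map c x = chart_map c' x" by (elim exE conjE)
  have p': "product_chart X n c'" using c'(1) unfolding foliated_chart_def by simp
  have domX: "chart_dom c \<subseteq> topspace X" by (rule product_chart_maps(1)[OF productU[OF c(1)]])
  have domc: "chart_dom c \<subseteq> chart_dom c'" using closure_of_subset[OF domX] c'(2) by blast
  have cl: "X closure_of ?P \<subseteq> chart_dom c'"
    using closure_of_mono[of ?P "chart_dom c" X] c'(2) unfolding plaque_def by auto
  have PP: "?P \<subseteq> plaque (c', z)"
    unfolding plaqueU[OF c(1)] plaque_eq[OF p'] using domc c'(3) by (auto simp: transverse_proj_def)
  have "X closure_of ?P \<subseteq> plaque (c', z)"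
  proof
    fix x assume x: "x \<in> X closure_of ?P"
    then have xd: "x \<in> chart_dom c'" using cl by blast
    have "transverse_proj c' x = z"
    proof (rule ccontr)
      assume ne: "transverse_proj c' x \<noteq> z"
      have "Hausdorff_space (chart_trans c')"
        using p' unfolding product_chart_def polish_topology_def
        by (meson completely_metrizable_imp_metrizable_space metrizable_imp_Hausdorff_space)
      then have "openin (chart_trans c') (topspace (chart_trans c') - {z})"
        by (metis Diff_empty Diff_insert0 Hausdorff_imp_t1_space openin_topspace openin_diff closedin_t1_singleton)
      from open_transverse_preimage[OF p' this]
      have "openin X {x \<in> chart_dom c'. transverse_proj c' x \<in> topspace (chart_trans c') - {z}}"
        (is "openin X ?O") .
      moreover have "x \<in> ?O" using xd ne transverse_proj_in[OF p' xd] by simp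
      ultimately have "?P \<inter> ?O \<noteq> {}" using closure_of_meets_open[OF x] by simp
      then show False using PP unfolding plaque_eq[OF p'] by auto
    qed
    then show "x \<in> plaque (c', z)" unfolding plaque_eq[OF p'] using xd by blast
  qed
  moreover have "compactin X (X closure_of ?P)" by (rule closedin_compact_space[OF compactX closedin_closure_of])
  ultimately have "compactin (subtopology X (plaque (c', z))) (X closure_of ?P)"
    by (simp add: compactin_subtopology)
  from image_compactin[OF this continuous_plaque_LT[OF c'(1)]] show ?thesis by simp
qed

lemma plaque_inject:
  assumes "(c, z) \<in> vertices" "(c, z') \<in> vertices" "plaque (c, z) = plaque (c, z')" shows "z = z'"
proof -
  have c: "c \<in> \<U>" using assms(1) in_vertices by blast
  obtain x where "x \<in> plaque (c, z)" using product_plaque_nonempty[OF productU[OF c]] assms(1) in_vertices by blast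
  then show ?thesis using assms(3) unfolding plaqueU[OF c] by auto
qed

lemma closure_superset_plaque: "(c, z) \<in> vertices \<Longrightarrow> plaque (c, z) \<subseteq> X closure_of plaque (c, z)"
  using openin_subset[OF openin_plaque] topspace_LT by (intro closure_of_subset) simp

text \<open>Here the closure condition of regular atlases enters. It makes the plaque graph locally
  finite and, later, words of charts single-valued.\<close>

lemma unique_neighbour:
  assumes "u \<in> vertices" "(d, z) \<in> vertices" "(d, z') \<in> vertices"
    "plaque u \<inter> plaque (d, z) \<noteq> {}" "plaque u \<inter> plaque (d, z') \<noteq> {}"
  shows "z = z'"
proof -
  obtain c w where u: "u = (c, w)" by (cases u)
  have cd: "c \<in> \<U>" "d \<in> \<U>" using assms u in_vertices by auto
  have pl: "plaque (c, w) \<in> plaques c" "plaque (d, z) \<in> plaques d" "plaque (d, z') \<in> plaques d"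
    using assms(1-3) unfolding u plaques_eq by (auto simp: in_vertices)
  have "X closure_of plaque (c, w) \<inter> X closure_of plaque (d, z) \<noteq> {}"
    "X closure_of plaque (c, w) \<inter> X closure_of plaque (d, z') \<noteq> {}"
    using assms closure_superset_plaque[of c w] closure_superset_plaque[of d] u by blast+
  then have "plaque (d, z) = plaque (d, z')"
    using regular_plaques[rule_format, OF cd pl] by simp
  then show ?thesis using plaque_inject assms(2,3) by blast
qed

text \<open>Charts with empty domain escape local finiteness, so \<U> itself may be infinite; such
  charts have no plaques.\<close>

definition alphabet :: "('a, 'z) fol_chart set" where
  "alphabet = {c \<in> \<U>. chart_dom c \<noteq> {}}"

lemma finite_alphabet: "finite alphabet"
proof -
  obtain N where N: "\<And>x. x \<in> topspace X \<Longrightarrow> openin X (N x) \<and> x \<in> N x \<and> finite {c\<in>\<U>. N x \<inter> chart_dom c \<noteq> {}}"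
    using bchoice[OF regular_locally_finite] by auto
  have "\<exists>\<F>. finite \<F> \<and> \<F> \<subseteq> N ` topspace X \<and> topspace X \<subseteq> \<Union>\<F>"
    using compactX[unfolded compact_space_def] by (rule compactinD) (use N in auto)
  then obtain \<F> where \<F>: "finite \<F>" "\<F> \<subseteq> N ` topspace X" "topspace X \<subseteq> \<Union>\<F>" by (elim exE conjE)
  have "alphabet \<subseteq> (\<Union>W\<in>\<F>. {c\<in>\<U>. W \<inter> chart_dom c \<noteq> {}})"
  proof
    fix c assume "c \<in> alphabet"
    then obtain x where x: "c \<in> \<U>" "x \<in> chart_dom c" unfolding alphabet_def by blast
    then have "x \<in> topspace X" using product_chart_maps(1)[OF productU] by blast
    then obtain W where "W \<in> \<F>" "x \<in> W" using \<F>(3) by blast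
    then show "c \<in> (\<Union>W\<in>\<F>. {c\<in>\<U>. W \<inter> chart_dom c \<noteq> {}})" using x by blast
  qed
  moreover have "finite (\<Union>W\<in>\<F>. {c\<in>\<U>. W \<inter> chart_dom c \<noteq> {}})" using \<F> N by auto
  ultimately show ?thesis using finite_subset by blast
qed

lemma vertex_alphabet: "u \<in> vertices \<Longrightarrow> fst u \<in> alphabet"
  using product_plaque_nonempty[OF productU] unfolding alphabet_def
  by (cases u) (auto simp: in_vertices plaque_def)

lemma finite_plaque_neighbours:
  assumes "u \<in> vertices" shows "finite {v \<in> vertices. plaque u \<inter> plaque v \<noteq> {}}"
proof (rule inj_on_finite)
  show "inj_on fst {v \<in> vertices. plaque u \<inter> plaque v \<noteq> {}}"
  proof (rule inj_onI)
    fix v w assume "v \<in> {v \<in> vertices. plaque u \<inter> plaque v \<noteq> {}}"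
      "w \<in> {v \<in> vertices. plaque u \<inter> plaque v \<noteq> {}}" "fst v = fst w"
    then show "v = w" using unique_neighbour[OF assms, of "fst v" "snd v" "snd w"] by (cases v; cases w) simp
  qed
  show "fst ` {v \<in> vertices. plaque u \<inter> plaque v \<noteq> {}} \<subseteq> alphabet" using vertex_alphabet by blast
qed (rule finite_alphabet)

lemma plaques_cover_LT: "(\<Union>u\<in>vertices. plaque u) = topspace LT"
proof
  show "(\<Union>u\<in>vertices. plaque u) \<subseteq> topspace LT" using openin_plaque openin_subset by fastforce
  show "topspace LT \<subseteq> (\<Union>u\<in>vertices. plaque u)"
    unfolding topspace_LT using coverU vertex_of_point by blast
qed

text \<open>The leaf-closure of a plaque lies in the union of the neighbouring plaques, which are finitely
  many and have compact ambient closures.\<close>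

lemma compact_closure_LT:
  assumes u: "u \<in> vertices" shows "compactin LT (LT closure_of plaque u)"
proof (rule closed_compactin)
  let ?N = "{v \<in> vertices. plaque u \<inter> plaque v \<noteq> {}}"
  show "compactin LT (\<Union>v\<in>?N. X closure_of plaque v)"
    using finite_plaque_neighbours[OF u] compact_closure_plaque_ambient
    by (intro compactin_Union) auto
  show "LT closure_of plaque u \<subseteq> (\<Union>v\<in>?N. X closure_of plaque v)"
  proof
    fix x assume x: "x \<in> LT closure_of plaque u"
    then have "x \<in> topspace LT" using in_closure_of by metis
    then obtain v where v: "v \<in> vertices" "x \<in> plaque v" using plaques_cover_LT by blast
    then have "openin LT (plaque v)" using openin_plaque by (cases v) auto
    then have "plaque u \<inter> plaque v \<noteq> {}" using closure_of_meets_open[OF x] v(2) by simp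
    moreover have "x \<in> X closure_of plaque v" using v closure_superset_plaque by (cases v) auto
    ultimately show "x \<in> (\<Union>v\<in>?N. X closure_of plaque v)" using v(1) by blast
  qed
qed simp

sublocale plaque_cover LT vertices plaque
proof
  show "\<And>u. u \<in> vertices \<Longrightarrow> openin LT (plaque u)" using openin_plaque by auto
  show "\<And>u. u \<in> vertices \<Longrightarrow> connectedin LT (plaque u)" using connectedin_plaque by auto
  show "\<And>u. u \<in> vertices \<Longrightarrow> plaque u \<noteq> {}"
    using product_plaque_nonempty productU in_vertices by (metis surj_pair)
qed (fact compact_closure_LT plaques_cover_LT finite_plaque_neighbours)+

lemma leaves_eq: "leaves X n \<A> = region ` vertices"
  unfolding leaves_def by (rule connected_components_regions)

subsection \<open>Quasi-isometric leaves\<close>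

abbreviation dst :: "'a \<Rightarrow> 'a \<Rightarrow> real" where "dst \<equiv> leaf_dist X n \<A> \<U>"

definition chain :: "'a set set \<Rightarrow> 'a \<Rightarrow> 'a \<Rightarrow> bool" where
  "chain \<P> x y \<longleftrightarrow> \<P> \<subseteq> (\<Union>c\<in>\<U>. plaques c) \<and> finite \<P> \<and> connectedin LT (\<Union>\<P>) \<and> x \<in> \<Union>\<P> \<and> y \<in> \<Union>\<P>"

lemma leaf_dist_chain: "x \<noteq> y \<Longrightarrow> dst x y = real (LEAST k. \<exists>\<P>. card \<P> = k \<and> chain \<P> x y)"
  unfolding leaf_dist_def chain_def by (simp add: conj_ac)

lemma plaques_vertices: "(\<Union>c\<in>\<U>. plaques c) = plaque ` vertices"
  unfolding plaques_eq vertices_def by auto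

text \<open>A walk of m edges visits m + 1 vertices; fewer plaques occur when it repeats vertices or
  when different vertices have the same plaque.\<close>

lemma chain_of_disc:
  assumes u: "u \<in> vertices" and "v \<in> disc u m"
  shows "\<exists>\<P>. \<P> \<subseteq> plaque ` vertices \<and> finite \<P> \<and> card \<P> \<le> Suc m \<and> connectedin LT (\<Union>\<P>) \<and>
    plaque u \<in> \<P> \<and> plaque v \<in> \<P>"
  using assms(2)
proof (induction m arbitrary: v)
  case 0
  then show ?case using u connected_plaque[OF u] by (intro exI[of _ "{plaque u}"]) auto
next
  case (Suc m)
  then obtain w where w: "w \<in> disc u m" "(w, v) \<in> meets" unfolding disc_Suc by auto
  from Suc.IH[OF w(1)] obtain \<P> where \<P>: "\<P> \<subseteq> plaque ` vertices" "finite \<P>" "card \<P> \<le> Suc m"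
    "connectedin LT (\<Union>\<P>)" "plaque u \<in> \<P>" "plaque w \<in> \<P>" by (elim exE conjE)
  have v: "v \<in> vertices" "plaque w \<inter> plaque v \<noteq> {}" using w(2) unfolding meets_def by auto
  have "connectedin LT (\<Union>\<P> \<union> plaque v)"
    by (rule connectedin_Un[OF \<P>(4) connected_plaque[OF v(1)]]) (use v(2) \<P>(6) in blast)
  moreover have "card (insert (plaque v) \<P>) \<le> Suc (Suc m)"
    using \<P>(2,3) by (simp add: card_insert_if)
  ultimately show ?case using \<P> v(1)
    by (intro exI[of _ "insert (plaque v) \<P>"]) (auto simp: Un_commute)
qed

lemma leaf_dist_le_of_disc:
  assumes u: "u \<in> vertices" and "v \<in> disc u m" "x \<in> plaque u" "y \<in> plaque v"
  shows "dst x y \<le> real (Suc m)" "\<exists>\<P>. chain \<P> x y"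
proof -
  from chain_of_disc[OF assms(1,2)] obtain \<P> where \<P>: "\<P> \<subseteq> plaque ` vertices" "finite \<P>" "card \<P> \<le> Suc m"
    "connectedin LT (\<Union>\<P>)" "plaque u \<in> \<P>" "plaque v \<in> \<P>" by (elim exE conjE)
  have ch: "chain \<P> x y" unfolding chain_def plaques_vertices using \<P> assms(3,4) by blast
  then show "\<exists>\<P>. chain \<P> x y" by blast
  show "dst x y \<le> real (Suc m)"
  proof (cases "x = y")
    case True
    then show ?thesis unfolding leaf_dist_def by simp
  next
    case False
    have "(LEAST k. \<exists>\<P>. card \<P> = k \<and> chain \<P> x y) \<le> card \<P>" by (rule Least_le) (use ch in blast)
    then show ?thesis unfolding leaf_dist_chain[OF False] using \<P>(3) by linarith
  qed
qed

lemma meets_disc: "(u, v) \<in> meets \<Longrightarrow> v \<in> disc u 1"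
  by (simp add: disc_def)

text \<open>The quadratic bound comes from counting the edges between the plaques of a chain.\<close>

lemma disc_of_leaf_dist_le:
  assumes u: "u \<in> vertices" and v: "v \<in> leaf u" and x: "x \<in> plaque u" and y: "y \<in> plaque v"
    and d: "dst x y \<le> real k"
  shows "v \<in> disc u (k * k + 2)"
proof -
  have vV: "v \<in> vertices" using v leaf_subset_vertices[OF u] by blast
  show ?thesis
  proof (cases "x = y")
    case True
    then have "v \<in> disc u 1" using meetsI[OF u vV x] y meets_disc by blast
    then show ?thesis using disc_mono[OF u, of 1 "k * k + 2"] by auto
  next
    case False
    \<comment> \<open>A walk in the graph shows that some chain exists; only then is
      \<open>LEAST\<close> attained.\<close>
    obtain m where m: "v \<in> disc u m" using leaf_disc[OF v] by metis
    then have "\<exists>k \<P>. card \<P> = k \<and> chain \<P> x y" using leaf_dist_le_of_disc(2)[OF u m x y] by blast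
    from LeastI_ex[OF this] obtain \<P> where \<P>: "card \<P> = (LEAST k. \<exists>\<P>. card \<P> = k \<and> chain \<P> x y)" "chain \<P> x y"
      by (elim exE conjE)
    then have ck: "card \<P> \<le> k" using d unfolding leaf_dist_chain[OF False] by simp
    have ch: "\<P> \<subseteq> plaque ` vertices" "finite \<P>" "connectedin LT (\<Union>\<P>)" "x \<in> \<Union>\<P>" "y \<in> \<Union>\<P>"
      using \<P>(2) unfolding chain_def plaques_vertices by auto
    \<comment> \<open>One vertex for each plaque of the chain, so that vertices and plaques are
      equally many.\<close>
    obtain \<Omega> where \<Omega>: "\<Omega> \<subseteq> vertices" "inj_on plaque \<Omega>" "\<P> = plaque ` \<Omega>"
      using ch(1) unfolding subset_image_inj by (elim exE conjE)
    have fin: "finite \<Omega>" using ch(2) \<Omega>(2,3) by (simp add: finite_image_iff)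
    have card\<Omega>: "card \<Omega> \<le> k" using ck \<Omega>(2,3) by (simp add: card_image)
    obtain u' v' where u': "u' \<in> \<Omega>" "x \<in> plaque u'" and v': "v' \<in> \<Omega>" "y \<in> plaque v'"
      using ch(4,5) \<Omega>(3) by auto
    define R where "R = meets \<inter> \<Omega> \<times> \<Omega>"
    have "finite R" unfolding R_def using fin by blast
    have "card R \<le> card (\<Omega> \<times> \<Omega>)" unfolding R_def using fin by (intro card_mono) auto
    then have cR: "card R \<le> k * k"
      using mult_le_mono[OF card\<Omega> card\<Omega>] by (simp add: card_cartesian_product)
    define Q where "Q = \<Omega> \<inter> R\<^sup>* `` {u'}"
    \<comment> \<open>Otherwise the plaques reachable from u' and the others would disconnect the
      union of the chain.\<close>
    have "v' \<in> Q"
    proof (rule ccontr)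
      assume nv: "v' \<notin> Q"
      let ?O1 = "\<Union>w\<in>Q. plaque w" and ?O2 = "\<Union>w\<in>\<Omega> - Q. plaque w"
      have op: "openin LT ?O1" "openin LT ?O2"
        using \<Omega>(1) open_plaque unfolding Q_def by (auto intro!: openin_Union)
      have cov: "\<Union>\<P> \<subseteq> ?O1 \<union> ?O2" unfolding \<Omega>(3) by blast
      have dis: "?O1 \<inter> ?O2 \<inter> \<Union>\<P> = {}"
      proof (rule ccontr)
        assume "\<not> ?thesis"
        then obtain w w' z where w: "w \<in> Q" "w' \<in> \<Omega> - Q" "z \<in> plaque w" "z \<in> plaque w'" by blast
        then have "w \<in> \<Omega>" "w' \<in> \<Omega>" unfolding Q_def by auto
        then have "(w, w') \<in> R" using meetsI[of w w' z] w \<Omega>(1) unfolding R_def by blast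
        then have "w' \<in> Q" using w(1) \<open>w' \<in> \<Omega>\<close> unfolding Q_def by (auto intro: rtrancl_into_rtrancl)
        then show False using w(2) by blast
      qed
      have "u' \<in> Q" unfolding Q_def using u'(1) by simp
      then have "?O1 \<inter> \<Union>\<P> \<noteq> {}" using u'(2) ch(4) by blast
      moreover have "?O2 \<inter> \<Union>\<P> \<noteq> {}" using nv v' ch(5) by blast
      ultimately show False using connectedinD[OF ch(3) op cov dis] by blast
    qed
    then have "(u', v') \<in> R\<^sup>*" unfolding Q_def by simp
    \<comment> \<open>In a finite relation whatever is reachable is reachable in at most as many
      steps as there are pairs, here at most k * k.\<close>
    then obtain j where j: "j \<le> card R" "(u', v') \<in> R ^^ j"
      unfolding rtrancl_finite_eq_relpow[OF \<open>finite R\<close>] by auto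
    have "R ^^ j \<subseteq> meets ^^ j" unfolding R_def by (induction j) auto
    then have 1: "v' \<in> disc u' j" using j(2) unfolding disc_def by blast
    have V': "u' \<in> vertices" "v' \<in> vertices" using u' v' \<Omega>(1) by auto
    \<comment> \<open>The chain may cover x and y by plaques other than those of u and v; the 2 in
      the bound pays for these two changes.\<close>
    have 2: "u' \<in> disc u 1" "v \<in> disc v' 1"
      using meets_disc meetsI[OF u V'(1) x u'(2)] meetsI[OF V'(2) vV v'(2) y] by auto
    have "v \<in> disc u (1 + j + 1)" using disc_trans[OF disc_trans[OF 2(1) 1] 2(2)] .
    then show ?thesis using disc_mono[OF u, of "1 + j + 1" "k * k + 2"] j(1) cR by auto
  qed
qed

text \<open>The quasi-isometry is inverted and carried over from nets to vertices: from y to a point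
  p of its plaque, to a net point \<open>f a\<close> within K of p, back to a, and to a plaque
  containing a. This is the direction in which \<open>branch_coarse_transfer\<close> pulls back
  pieces.\<close>

lemma coarse_map:
  assumes u: "u \<in> vertices" and v: "v \<in> vertices" and KC: "K \<ge> 0" "C \<ge> 1"
    and f: "coarse_quasi_isometry K C (region u) dst (region v) dst A A' f"
  obtains g s \<beta> where "g ` leaf v \<subseteq> leaf u"
    "\<And>y y'. y \<in> leaf v \<Longrightarrow> (y, y') \<in> meets \<Longrightarrow> g y' \<in> disc (g y) s"
    "\<And>x. x \<in> leaf u \<Longrightarrow> \<exists>y\<in>leaf v. x \<in> disc (g y) s"
    "\<And>y y' m. y \<in> leaf v \<Longrightarrow> y' \<in> leaf v \<Longrightarrow> g y' \<in> disc (g y) m \<Longrightarrow> y' \<in> disc y (\<beta> m)"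
proof -
  have A: "A \<subseteq> region u" "\<And>x. x \<in> region u \<Longrightarrow> \<exists>a\<in>A. dst x a \<le> K"
    and A': "A' \<subseteq> region v" "\<And>x. x \<in> region v \<Longrightarrow> \<exists>a\<in>A'. dst x a \<le> K"
    and bij: "bij_betw f A A'"
    and fd: "\<And>x y. x \<in> A \<Longrightarrow> y \<in> A \<Longrightarrow> 1 / C * dst x y \<le> dst (f x) (f y) \<and> dst (f x) (f y) \<le> C * dst x y"
    using f unfolding coarse_quasi_isometry_def net_def by auto
  have fA: "f ` A = A'" using bij unfolding bij_betw_def by blast
  have lu: "leaf u \<subseteq> vertices" and lv: "leaf v \<subseteq> vertices" using u v leaf_subset_vertices by auto
  have inv: "dst x y \<le> C * dst (f x) (f y)" if "x \<in> A" "y \<in> A" for x y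
  proof -
    have "C * (1 / C * dst x y) \<le> C * dst (f x) (f y)"
      using fd[OF that] KC(2) by (intro mult_left_mono) auto
    then show ?thesis using KC(2) by simp
  qed
  \<comment> \<open>Radius in the plaque graph that accounts for leaf distance r, rounded up to an
    integer for \<open>disc_of_leaf_dist_le\<close>.\<close>
  define q where "q r = (nat \<lceil>r\<rceil>) * (nat \<lceil>r\<rceil>) + 2" for r :: real
  have disc: "y \<in> disc x (q r)" if "x \<in> vertices" "y \<in> leaf x" "s \<in> plaque x" "t \<in> plaque y" "dst s t \<le> r" for x y s t r
    unfolding q_def using that by (intro disc_of_leaf_dist_le[OF that(1-4)]) linarith
  have same: "y \<in> leaf x" if "x \<in> leaf w" "y \<in> leaf w" for w x y
    using that leaf_sym leaf_trans by blast
  let ?D = "q K"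
  have "\<exists>p a b c. p \<in> plaque y \<and> a \<in> A \<and> dst p (f a) \<le> K \<and> b \<in> leaf u \<and> a \<in> plaque b \<and> c \<in> leaf v \<and>
      f a \<in> plaque c \<and> c \<in> disc y ?D" if y: "y \<in> leaf v" for y
  proof -
    have yV: "y \<in> vertices" using y lv by blast
    obtain p where p: "p \<in> plaque y" using plaque_nonempty[OF yV] by blast
    then have "p \<in> region v" using plaque_subset_region[OF y] by blast
    then obtain a where a: "a \<in> A" "dst p (f a) \<le> K" using A'(2) fA by blast
    obtain b where b: "b \<in> leaf u" "a \<in> plaque b" using a(1) A(1) unfolding region_def by blast
    have "f a \<in> region v" using a(1) fA A'(1) by blast
    then obtain c where c: "c \<in> leaf v" "f a \<in> plaque c" unfolding region_def by blast
    have "c \<in> disc y ?D" by (rule disc[OF yV same[OF y c(1)] p c(2) a(2)])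
    then show ?thesis using p a b c by blast
  qed
  then obtain p a g c where G: "\<And>y. y \<in> leaf v \<Longrightarrow> p y \<in> plaque y \<and> a y \<in> A \<and> dst (p y) (f (a y)) \<le> K \<and>
      g y \<in> leaf u \<and> a y \<in> plaque (g y) \<and> c y \<in> leaf v \<and> f (a y) \<in> plaque (c y) \<and> c y \<in> disc y ?D"
    by metis
  \<comment> \<open>For adjacent y and y' the plaques \<open>c y\<close> and \<open>c y'\<close> are
    at most \<open>?D + 1 + ?D\<close> apart; \<open>Suc\<close> converts edges into
    plaques.\<close>
  define N1 where "N1 = q (C * real (Suc (?D + 1 + ?D)))"
  define N2 where "N2 = q (C * real (Suc ?D))"
  define s where "s = N1 + N2 + ?D"
  have up: "g y' \<in> disc (g y) (q (C * real (Suc m)))"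
    if y: "y \<in> leaf v" "y' \<in> leaf v" "c y' \<in> disc (c y) m" for y y' m
  proof -
    have "c y \<in> vertices" using G[OF y(1)] lv by blast
    then have "dst (f (a y)) (f (a y')) \<le> real (Suc m)"
      using leaf_dist_le_of_disc(1)[of "c y" "c y'" m] y G by blast
    then have "C * dst (f (a y)) (f (a y')) \<le> C * real (Suc m)" using KC(2) by (intro mult_left_mono) auto
    then have le: "dst (a y) (a y') \<le> C * real (Suc m)" using inv[of "a y" "a y'"] y G by fastforce
    show ?thesis
      by (rule disc[OF _ same _ _ le]) (use G[OF y(1)] G[OF y(2)] lu in auto)
  qed
  show ?thesis
  proof (rule that)
    show "g ` leaf v \<subseteq> leaf u" using G by blast
  next
    fix y y' assume y: "y \<in> leaf v" "(y, y') \<in> meets"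
    then have y': "y' \<in> leaf v" using leaf_step by blast
    have "c y' \<in> disc (c y) (?D + 1 + ?D)"
      using disc_trans[OF disc_trans[OF disc_sym meets_disc[OF y(2)]]] G[OF y(1)] G[OF y'] by blast
    then have "g y' \<in> disc (g y) N1" unfolding N1_def by (rule up[OF y(1) y'])
    moreover have "g y \<in> vertices" using G[OF y(1)] lu by blast
    ultimately show "g y' \<in> disc (g y) s" using disc_mono[of "g y" N1 s] unfolding s_def by auto
  next
    fix x assume x: "x \<in> leaf u"
    then have xV: "x \<in> vertices" using lu by blast
    obtain t where t: "t \<in> plaque x" using plaque_nonempty[OF xV] by blast
    then have "t \<in> region u" using plaque_subset_region[OF x] by blast
    then obtain e where e: "e \<in> A" "dst t e \<le> K" using A(2) by blast
    obtain r where r: "r \<in> leaf u" "e \<in> plaque r" using e(1) A(1) unfolding region_def by blast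
    have rx: "r \<in> disc x ?D" by (rule disc[OF xV same[OF x r(1)] t r(2) e(2)])
    have "f e \<in> region v" using e(1) fA A'(1) by blast
    then obtain y where y: "y \<in> leaf v" "f e \<in> plaque y" unfolding region_def by blast
    have yV: "y \<in> vertices" using y lv by blast
    have "dst (f e) (f (a y)) \<le> real (Suc ?D)"
      using leaf_dist_le_of_disc(1)[OF yV, of "c y" ?D] y G[OF y(1)] by blast
    then have "C * dst (f e) (f (a y)) \<le> C * real (Suc ?D)" using KC(2) by (intro mult_left_mono) auto
    then have le: "dst e (a y) \<le> C * real (Suc ?D)" using inv[of e "a y"] e G[OF y(1)] by fastforce
    have rV: "r \<in> vertices" using r lu by blast
    have gy: "g y \<in> leaf u" "a y \<in> plaque (g y)" using G[OF y(1)] by auto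
    have "g y \<in> disc r N2" unfolding N2_def by (rule disc[OF rV same[OF r(1) gy(1)] r(2) gy(2) le])
    then have "x \<in> disc (g y) (N2 + ?D)" using disc_trans[OF disc_sym disc_sym[OF rx]] by blast
    moreover have "g y \<in> vertices" using G[OF y(1)] lu by blast
    ultimately have "x \<in> disc (g y) s" using disc_mono[of "g y" "N2 + ?D" s] unfolding s_def by auto
    then show "\<exists>y\<in>leaf v. x \<in> disc (g y) s" using y(1) by blast
  next
    fix y y' m assume y: "y \<in> leaf v" "y' \<in> leaf v" "g y' \<in> disc (g y) m"
    have gV: "g y \<in> vertices" using G[OF y(1)] lu by blast
    have "dst (a y) (a y') \<le> real (Suc m)"
      using leaf_dist_le_of_disc(1)[OF gV y(3)] G[OF y(1)] G[OF y(2)] by blast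
    then have "C * dst (a y) (a y') \<le> C * real (Suc m)" using KC(2) by (intro mult_left_mono) auto
    then have le: "dst (f (a y)) (f (a y')) \<le> C * real (Suc m)" using fd[of "a y" "a y'"] G[OF y(1)] G[OF y(2)] by fastforce
    have cV: "c y \<in> vertices" using G[OF y(1)] lv by blast
    have "c y' \<in> disc (c y) (q (C * real (Suc m)))"
      by (rule disc[OF cV same _ _ le]) (use G[OF y(1)] G[OF y(2)] in auto)
    then show "y' \<in> disc y (?D + q (C * real (Suc m)) + ?D)"
      using disc_trans[OF disc_trans, of "c y" y ?D "c y'" _ y' ?D] disc_sym G[OF y(1)] G[OF y(2)] by blast
  qed
qed

text \<open>The radius produced by \<open>transfer\<close> depends on R but not on the vertex w,
  which makes the second claim uniform over the leaf.\<close>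

lemma branch_quasi_isometry_invariant:
  assumes u: "u \<in> vertices" and v: "v \<in> vertices" and KC: "K \<ge> 0" "C \<ge> 1"
    and f: "coarse_quasi_isometry K C (region u) dst (region v) dst A A' f"
  shows "finite F \<Longrightarrow> branch k F u \<Longrightarrow> \<exists>F. finite F \<and> branch k F v"
    "(\<And>w. w \<in> leaf u \<Longrightarrow> branch k (disc w R) w) \<Longrightarrow> \<exists>R. \<forall>w\<in>leaf v. branch k (disc w R) w"
proof -
  obtain g s \<beta> where g: "g ` leaf v \<subseteq> leaf u"
    "\<And>y y'. y \<in> leaf v \<Longrightarrow> (y, y') \<in> meets \<Longrightarrow> g y' \<in> disc (g y) s"
    "\<And>x. x \<in> leaf u \<Longrightarrow> \<exists>y\<in>leaf v. x \<in> disc (g y) s"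
    "\<And>y y' m. y \<in> leaf v \<Longrightarrow> y' \<in> leaf v \<Longrightarrow> g y' \<in> disc (g y) m \<Longrightarrow> y' \<in> disc y (\<beta> m)"
    using coarse_map[OF assms] by blast
  have transfer: "branch k (disc w (\<beta> (R + s))) w" if w: "w \<in> leaf v" and br: "branch k (disc (g w) R) u" for w R
  proof (rule branch_coarse_transfer[where u = u and g = g and s = s and R = R])
    have lw: "leaf w = leaf v" by (rule leaf_eq[OF w])
    show "u \<in> vertices" "branch k (disc (g w) R) u" by (fact u br)+
    show "w \<in> vertices" using w leaf_subset_vertices[OF v] by blast
    show "g ` leaf w \<subseteq> leaf u" unfolding lw by (rule g(1))
    show "\<And>y y'. y \<in> leaf w \<Longrightarrow> (y, y') \<in> meets \<Longrightarrow> g y' \<in> disc (g y) s" unfolding lw by (rule g(2))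
    show "\<And>x. x \<in> leaf u \<Longrightarrow> \<exists>y\<in>leaf w. x \<in> disc (g y) s" unfolding lw by (rule g(3))
    show "\<And>y. y \<in> leaf w \<Longrightarrow> g y \<in> disc (g w) (R + s) \<Longrightarrow> y \<in> disc w (\<beta> (R + s))"
      unfolding lw by (rule g(4)[OF w])
  qed
  {
    assume "finite F" "branch k F u"
    then obtain R where R: "branch k (disc u R) u" using branch_imp_disc[OF _ _ u] by blast
    have gl: "g v \<in> leaf u" using g(1) leaf_self by blast
    then obtain t where t: "u \<in> disc (g v) t" using leaf_disc[OF leaf_sym[OF gl]] by metis
    then have "branch k (disc (g v) (t + R)) u" using branch_mono_set[OF R disc_shift[OF t]] by simp
    from transfer[OF leaf_self this] show "\<exists>F. finite F \<and> branch k F v" by (meson finite_disc)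
  next
    assume unif: "\<And>w. w \<in> leaf u \<Longrightarrow> branch k (disc w R) w"
    have "branch k (disc w (\<beta> (R + s))) w" if w: "w \<in> leaf v" for w
    proof (rule transfer[OF w])
      have gl: "g w \<in> leaf u" using g(1) w by blast
      show "branch k (disc (g w) R) u" using unif[OF gl] branch_leaf[OF gl] by simp
    qed
    then show "\<exists>R. \<forall>w\<in>leaf v. branch k (disc w R) w" by blast
  }
qed

end

section \<open>Generic points of the transversals\<close>

text \<open>An open set N in the frontier contains a point y of A. As A is closed in W and dense in
  N, the part of N in W belongs to A; so y is interior to A, contrary to its lying in the
  frontier.\<close>

lemma interior_frontier_of_locally_closed:
  assumes "openin Z W" "A \<subseteq> W" "openin Z (W - A)"
  shows "Z interior_of (Z frontier_of A) = {}"
proof (rule ccontr)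
  let ?N = "Z interior_of (Z frontier_of A)"
  assume "?N \<noteq> {}"
  have N: "openin Z ?N" "?N \<subseteq> Z closure_of A" "?N \<inter> Z interior_of A = {}"
    using interior_of_subset[of Z "Z frontier_of A"] unfolding frontier_of_def by auto
  have meet: "A \<inter> G \<noteq> {}" if "openin Z G" "x \<in> G" "x \<in> Z closure_of A" for G x
    using closure_of_meets_open[OF that(3,1,2)] .
  obtain x where x: "x \<in> ?N" using \<open>?N \<noteq> {}\<close> by blast
  then obtain y where y: "y \<in> A" "y \<in> ?N" using meet[OF N(1) x] N(2) by blast
  have "?N \<inter> W \<subseteq> A"
  proof
    fix z assume z: "z \<in> ?N \<inter> W"
    show "z \<in> A"
    proof (rule ccontr)
      assume "z \<notin> A"
      then have "A \<inter> (W - A) \<noteq> {}" using z N(2) by (intro meet[OF assms(3)]) auto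
      then show False by blast
    qed
  qed
  then have "?N \<inter> W \<subseteq> Z interior_of A"
    using N(1) assms(1) by (intro interior_of_maximal) auto
  then show False using y assms(2) N(3) by blast
qed

context compact_foliation
begin

abbreviation TT :: "(('a, 'z) fol_chart \<times> 'z) topology" where "TT \<equiv> transversal \<U>"

lemma topspace_TT: "topspace TT = vertices"
  unfolding transversal_def vertices_def by (simp add: o_def)

lemma openin_TT: "openin TT W \<longleftrightarrow> W \<subseteq> vertices \<and> (\<forall>c\<in>\<U>. openin (chart_trans c) {z. (c, z) \<in> W})"
  unfolding transversal_def openin_sum_topology vertices_def by (simp add: o_def)

lemma openin_fibre:
  assumes "c \<in> \<U>" "openin (chart_trans c) W" shows "openin TT ({c} \<times> W)"
  unfolding openin_TT
proof (intro conjI ballI)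
  show "{c} \<times> W \<subseteq> vertices" using assms openin_subset in_vertices by fastforce
  fix d assume "d \<in> \<U>"
  show "openin (chart_trans d) {z. (d, z) \<in> {c} \<times> W}" using assms(2) by (cases "d = c") auto
qed

lemma Hausdorff_chart_trans: "c \<in> \<U> \<Longrightarrow> Hausdorff_space (chart_trans c)"
  using productU unfolding product_chart_def polish_topology_def
  by (meson completely_metrizable_imp_metrizable_space metrizable_imp_Hausdorff_space)

lemma separate_vertices:
  assumes "u \<in> vertices" "v \<in> vertices" "u \<noteq> v"
  obtains N N' where "openin TT N" "openin TT N'" "u \<in> N" "v \<in> N'" "N \<inter> N' = {}"
proof -
  obtain c z d w where uv: "u = (c, z)" "v = (d, w)" by (cases u; cases v)
  have cd: "c \<in> \<U>" "d \<in> \<U>" "z \<in> topspace (chart_trans c)" "w \<in> topspace (chart_trans d)"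
    using assms uv in_vertices by auto
  show ?thesis
  proof (cases "c = d")
    case True
    then have "z \<noteq> w" using assms(3) uv by simp
    then obtain N N' where "openin (chart_trans c) N" "openin (chart_trans c) N'" "z \<in> N" "w \<in> N'" "disjnt N N'"
      using Hausdorff_chart_trans[OF cd(1)] cd True unfolding Hausdorff_space_def by metis
    then show ?thesis using that[of "{c} \<times> N" "{c} \<times> N'"] openin_fibre[OF cd(1)] uv True
      unfolding disjnt_def by blast
  next
    case False
    then show ?thesis
      using that[of "{c} \<times> topspace (chart_trans c)" "{d} \<times> topspace (chart_trans d)"]
        openin_fibre cd uv by auto
  qed
qed

text \<open>Transverse projections are continuous and open, so meeting is an open relation between
  transversals.\<close>

lemma open_meets_image: assumes W: "openin TT W" shows "openin TT (meets `` W)"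
  unfolding openin_TT
proof (intro conjI ballI)
  show "meets `` W \<subseteq> vertices" unfolding meets_def by auto
  fix c assume c: "c \<in> \<U>"
  let ?M = "\<lambda>e. chart_dom c \<inter> {x \<in> chart_dom e. transverse_proj e x \<in> {z. (e, z) \<in> W}}"
  have "{z. (c, z) \<in> meets `` W} = (\<Union>e\<in>\<U>. transverse_proj c ` ?M e)"
  proof (intro set_eqI iffI)
    fix z assume "z \<in> {z. (c, z) \<in> meets `` W}"
    then obtain u where u: "u \<in> W" "(u, (c, z)) \<in> meets" by blast
    obtain e y where e: "u = (e, y)" by (cases u)
    have eU: "e \<in> \<U>" using u e W in_vertices unfolding openin_TT by auto
    obtain x where "x \<in> plaque (e, y)" "x \<in> plaque (c, z)" using u(2) e unfolding meets_def by auto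
    then have "x \<in> ?M e" "transverse_proj c x = z" using u(1) e plaqueU[OF eU] plaqueU[OF c] by auto
    then show "z \<in> (\<Union>e\<in>\<U>. transverse_proj c ` ?M e)" using eU by blast
  next
    fix z assume "z \<in> (\<Union>e\<in>\<U>. transverse_proj c ` ?M e)"
    then obtain e x where e: "e \<in> \<U>" "x \<in> ?M e" "z = transverse_proj c x" by blast
    have "((e, transverse_proj e x), (c, z)) \<in> meets"
      using meetsI vertex_of_point[OF e(1), of x] vertex_of_point[OF c, of x] e by blast
    then show "z \<in> {z. (c, z) \<in> meets `` W}" using e(2) by blast
  qed
  moreover have "openin (chart_trans c) (transverse_proj c ` ?M e)" if e: "e \<in> \<U>" for e
  proof (rule open_transverse_image[OF productU[OF c]])
    have "openin X (chart_dom c)" using productU[OF c] unfolding product_chart_def by simp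
    moreover have "openin (chart_trans e) {z. (e, z) \<in> W}" using W e unfolding openin_TT by simp
    ultimately show "openin X (?M e)" using open_transverse_preimage[OF productU[OF e]] by (intro openin_Int)
  qed auto
  ultimately show "openin (chart_trans c) {z. (c, z) \<in> meets `` W}" by auto
qed

lemma open_fibre_part: assumes W: "openin TT W" shows "openin TT {v \<in> W. fst v = d}"
proof (cases "d \<in> \<U>")
  case True
  have "{v \<in> W. fst v = d} = W \<inter> {d} \<times> topspace (chart_trans d)"
    using openin_subset[OF W] topspace_TT in_vertices by auto
  then show ?thesis using openin_Int[OF W openin_fibre[OF True openin_topspace]] by simp
next
  case False
  then have "{v \<in> W. fst v = d} = {}" using openin_subset[OF W] topspace_TT in_vertices by auto
  then show ?thesis by (simp only: openin_empty)
qed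

section \<open>Words of charts and stable points\<close>

definition step :: "('a, 'z) fol_chart \<Rightarrow> (('a, 'z) fol_chart \<times> 'z) rel" where
  "step d = {(u, v) \<in> meets. fst v = d}"

text \<open>A letter names only the chart of the next plaque. By \<open>unique_neighbour\<close>
  this determines the plaque, so a word acts as a partial map on vertices, whatever the starting
  chart.\<close>

primrec word :: "('a, 'z) fol_chart list \<Rightarrow> (('a, 'z) fol_chart \<times> 'z) rel" where
  "word [] = Id_on vertices"
| "word (d # ds) = step d O word ds"

lemma meets_vertices: "(u, v) \<in> meets \<Longrightarrow> u \<in> vertices \<and> v \<in> vertices"
  unfolding meets_def by auto

lemma step_unique: assumes "(u, v) \<in> step d" "(u, v') \<in> step d" shows "v = v'"
proof -
  obtain z z' where v: "v = (d, z)" "v' = (d, z')" using assms unfolding step_def by (cases v; cases v') auto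
  have "(u, v) \<in> meets" "(u, v') \<in> meets" using assms unfolding step_def by auto
  then show ?thesis using unique_neighbour[of u d z z'] unfolding v meets_def by auto
qed

lemma word_unique: "(u, v) \<in> word w \<Longrightarrow> (u, v') \<in> word w \<Longrightarrow> v = v'"
proof (induction w arbitrary: u)
  case (Cons d ds)
  then obtain a a' where "(u, a) \<in> step d" "(a, v) \<in> word ds" "(u, a') \<in> step d" "(a', v') \<in> word ds" by auto
  then show ?case using step_unique Cons.IH by blast
qed auto

lemma word_vertices: "(u, v) \<in> word w \<Longrightarrow> u \<in> vertices \<and> v \<in> vertices"
  by (induction w arbitrary: u) (auto simp: step_def dest: meets_vertices)

lemma open_step_image: assumes "openin TT W" shows "openin TT (step d `` W)"
proof -
  have "step d `` W = {v \<in> meets `` W. fst v = d}" unfolding step_def by blast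
  then show ?thesis using open_fibre_part[OF open_meets_image[OF assms]] by simp
qed

lemma open_step_preimage: assumes "openin TT W" shows "openin TT ((step d)\<inverse> `` W)"
proof -
  have "(step d)\<inverse> `` W = meets `` {v \<in> W. fst v = d}" unfolding step_def using edge_sym by blast
  then show ?thesis using open_meets_image[OF open_fibre_part[OF assms]] by simp
qed

lemma open_word_preimage: "openin TT W \<Longrightarrow> openin TT ((word w)\<inverse> `` W)"
proof (induction w)
  case Nil
  then have "(word [])\<inverse> `` W = W" using openin_subset topspace_TT by fastforce
  then show ?case using Nil by simp
next
  case (Cons d ds)
  have "(word (d # ds))\<inverse> `` W = (step d)\<inverse> `` ((word ds)\<inverse> `` W)" by auto
  then show ?case using Cons open_step_preimage by simp
qed

lemma word_append: "word (w @ w') = word w O word w'"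
proof (induction w)
  case Nil
  have "Id_on vertices O word w' = word w'" using word_vertices by fastforce
  then show ?case by simp
qed (simp add: O_assoc)

lemma step_alphabet: "(u, v) \<in> step d \<Longrightarrow> d \<in> alphabet"
  using vertex_alphabet meets_vertices unfolding step_def by blast

text \<open>As the alphabet is finite, finitely many words enumerate all discs of a given radius,
  independently of the centre; this allows discs about different points to be compared.\<close>

lemma disc_word:
  assumes "u \<in> vertices"
  shows "v \<in> disc u m \<longleftrightarrow> (\<exists>w\<in>lists alphabet. length w = m \<and> (u, v) \<in> word w)"
  using assms
proof (induction m arbitrary: u)
  case 0
  then show ?case by auto
next
  case (Suc m)
  have "v \<in> disc u (Suc m) \<longleftrightarrow> (\<exists>a. (u, a) \<in> meets \<and> v \<in> disc a m)"
  proof -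
    have "meets ^^ Suc m = meets O meets ^^ m" by (simp add: relpow_commute)
    then show ?thesis unfolding disc_def by (simp only:) blast
  qed
  also have "\<dots> \<longleftrightarrow> (\<exists>a. (u, a) \<in> meets \<and> (\<exists>w\<in>lists alphabet. length w = m \<and> (a, v) \<in> word w))"
    using Suc.IH meets_vertices by blast
  also have "\<dots> \<longleftrightarrow> (\<exists>w\<in>lists alphabet. length w = Suc m \<and> (u, v) \<in> word w)"
  proof
    assume "\<exists>a. (u, a) \<in> meets \<and> (\<exists>w\<in>lists alphabet. length w = m \<and> (a, v) \<in> word w)"
    then obtain a w where a: "(u, a) \<in> meets" "w \<in> lists alphabet" "length w = m" "(a, v) \<in> word w" by blast
    have st: "(u, a) \<in> step (fst a)" using a(1) unfolding step_def by simp
    then have "(u, v) \<in> word (fst a # w)" using a(4) by auto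
    then show "\<exists>w\<in>lists alphabet. length w = Suc m \<and> (u, v) \<in> word w"
      using a step_alphabet[OF st] by (intro bexI[of _ "fst a # w"]) auto
  next
    assume "\<exists>w\<in>lists alphabet. length w = Suc m \<and> (u, v) \<in> word w"
    then obtain w where w: "w \<in> lists alphabet" "length w = Suc m" "(u, v) \<in> word w" by blast
    then obtain d ds where ds: "w = d # ds" by (cases w) auto
    then obtain a where a: "(u, a) \<in> step d" "(a, v) \<in> word ds" using w(3) by auto
    have "(u, a) \<in> meets" using a(1) unfolding step_def by simp
    moreover have "ds \<in> lists alphabet" "length ds = m" using w ds by auto
    ultimately show "\<exists>a. (u, a) \<in> meets \<and> (\<exists>w\<in>lists alphabet. length w = m \<and> (a, v) \<in> word w)"
      using a(2) by blast
  qed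
  finally show ?case .
qed

text \<open>Two special cases matter: \<open>agree w w\<close> says that w is defined at the point,
  and \<open>agree w []\<close> that w fixes it.\<close>

definition agree :: "('a, 'z) fol_chart list \<Rightarrow> ('a, 'z) fol_chart list \<Rightarrow> ('a, 'z) fol_chart \<times> 'z \<Rightarrow> bool" where
  "agree w w' u \<longleftrightarrow> (\<exists>v. (u, v) \<in> word w \<and> (u, v) \<in> word w')"

text \<open>Stability excludes holonomy at \<open>u\<close>, and moreover that two plaques of the leaf of \<open>u\<close>
  which do not meet are limits of meeting ones. The latter makes the plaque graphs of nearby leaves
  locally isomorphic.\<close>

definition stable :: "('a, 'z) fol_chart \<times> 'z \<Rightarrow> bool" where
  "stable u \<longleftrightarrow> u \<in> vertices \<and> (\<forall>w\<in>lists alphabet. \<forall>w'\<in>lists alphabet.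
     \<exists>W. openin TT W \<and> u \<in> W \<and> (\<forall>a\<in>W. agree w w' a = agree w w' u))"

lemma stableD:
  assumes "stable u" "w \<in> lists alphabet" "w' \<in> lists alphabet"
  shows "\<exists>W. openin TT W \<and> u \<in> W \<and> (\<forall>a\<in>W. agree w w' a = agree w w' u)"
  using assms unfolding stable_def by blast

text \<open>Words read from v are words read from u with the chart of v put in front, and the step
  from u to v takes open sets to open sets.\<close>

lemma stable_step:
  assumes u: "stable u" and uv: "(u, v) \<in> meets" shows "stable v"
  unfolding stable_def
proof (intro conjI ballI)
  show "v \<in> vertices" using uv meets_vertices by blast
  fix w w' assume w: "w \<in> lists alphabet" "w' \<in> lists alphabet"
  let ?d = "fst v"
  have st: "(u, v) \<in> step ?d" using uv unfolding step_def by simp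
  then have d: "?d \<in> alphabet" by (rule step_alphabet)
  have "?d # w \<in> lists alphabet" "?d # w' \<in> lists alphabet" using w d by auto
  from stableD[OF u this] obtain W where
    W: "openin TT W" "u \<in> W" "\<forall>a\<in>W. agree (?d # w) (?d # w') a = agree (?d # w) (?d # w') u"
    by (elim exE conjE)
  have ag: "agree (?d # w) (?d # w') a = agree w w' b" if "(a, b) \<in> step ?d" for a b
  proof -
    have "(a, v) \<in> word (?d # x) \<longleftrightarrow> (b, v) \<in> word x" for x v
    proof
      assume "(a, v) \<in> word (?d # x)"
      then obtain b' where b': "(a, b') \<in> step ?d" "(b', v) \<in> word x" unfolding word.simps by (elim relcompE) simp
      then show "(b, v) \<in> word x" using step_unique[OF that b'(1)] by simp
    next
      assume "(b, v) \<in> word x"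
      then show "(a, v) \<in> word (?d # x)" unfolding word.simps using that by (rule relcompI[rotated])
    qed
    then show ?thesis unfolding agree_def by simp
  qed
  show "\<exists>W. openin TT W \<and> v \<in> W \<and> (\<forall>a\<in>W. agree w w' a = agree w w' v)"
  proof (intro exI conjI ballI)
    show "openin TT (step ?d `` W)" by (rule open_step_image[OF W(1)])
    show "v \<in> step ?d `` W" using st W(2) by blast
    fix b assume "b \<in> step ?d `` W"
    then obtain a where "a \<in> W" "(a, b) \<in> step ?d" by blast
    then show "agree w w' b = agree w w' v" using W(3) ag[of a b] ag[OF st] by blast
  qed
qed

lemma stable_leaf: assumes "stable u" "v \<in> leaf u" shows "stable v"
proof -
  have "(u, v) \<in> meets\<^sup>*" using assms(2) unfolding leaf_def by simp
  then show ?thesis by (induction rule: rtrancl_induct) (use assms(1) stable_step in blast)+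
qed

lemma stable_neighbourhood:
  assumes u: "stable u" and fin: "finite \<W>" "\<W> \<subseteq> lists alphabet"
  obtains W where "openin TT W" "u \<in> W" "\<And>a w w'. a \<in> W \<Longrightarrow> w \<in> \<W> \<Longrightarrow> w' \<in> \<W> \<Longrightarrow> agree w w' a = agree w w' u"
proof -
  have "\<forall>p\<in>\<W> \<times> \<W>. \<exists>W. openin TT W \<and> u \<in> W \<and> (\<forall>a\<in>W. agree (fst p) (snd p) a = agree (fst p) (snd p) u)"
  proof
    fix p assume "p \<in> \<W> \<times> \<W>"
    then have "fst p \<in> lists alphabet" "snd p \<in> lists alphabet" using fin(2) by (auto simp: mem_Times_iff)
    then show "\<exists>W. openin TT W \<and> u \<in> W \<and> (\<forall>a\<in>W. agree (fst p) (snd p) a = agree (fst p) (snd p) u)"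
      by (rule stableD[OF u])
  qed
  from bchoice[OF this] obtain N where
    N: "\<forall>p\<in>\<W> \<times> \<W>. openin TT (N p) \<and> u \<in> N p \<and> (\<forall>a\<in>N p. agree (fst p) (snd p) a = agree (fst p) (snd p) u)" ..
  let ?W = "topspace TT \<inter> \<Inter>(N ` (\<W> \<times> \<W>))"
  show ?thesis
  proof (rule that)
    show "openin TT ?W"
    proof (cases "\<W> = {}")
      case False
      then have "openin TT (\<Inter>(N ` (\<W> \<times> \<W>)))" using N fin(1) by (intro openin_Inter) auto
      then show ?thesis by auto
    qed simp
    show "u \<in> ?W" using N u topspace_TT unfolding stable_def by auto
    fix a w w' assume "a \<in> ?W" "w \<in> \<W>" "w' \<in> \<W>"
    then have p: "(w, w') \<in> \<W> \<times> \<W>" and a: "a \<in> N (w, w')" by auto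
    have "\<forall>a\<in>N (w, w'). agree w w' a = agree w w' u"
      using bspec[OF N p] unfolding fst_conv snd_conv by (elim conjE)
    then show "agree w w' a = agree w w' u" using a by (rule bspec)
  qed
qed

text \<open>Near a stable u, words of bounded length are defined, and coincide, exactly as at u.
  Sending the endpoint of a word from u to its endpoint from u' is thus well defined and meets the
  requirements of \<open>branch_of_local_iso\<close>.\<close>

lemma branch_upper_semicontinuous:
  assumes u: "stable u"
  obtains W where "openin TT W" "u \<in> W" "\<And>u'. u' \<in> W \<Longrightarrow> branch k (disc u' R) u' \<Longrightarrow> branch k (disc u R) u"
proof -
  have uV: "u \<in> vertices" using u unfolding stable_def by blast
  obtain M where M: "\<And>u' \<theta>. u' \<in> vertices \<Longrightarrow> inj_on \<theta> (disc u M) \<Longrightarrow> (\<And>r. r \<le> M \<Longrightarrow> \<theta> ` disc u r = disc u' r) \<Longrightarrow>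
    (\<And>a b. a \<in> disc u M \<Longrightarrow> b \<in> disc u M \<Longrightarrow> (a, b) \<in> meets \<Longrightarrow> (\<theta> a, \<theta> b) \<in> meets) \<Longrightarrow>
    branch k (disc u' R) u' \<Longrightarrow> branch k (disc u R) u"
    using branch_of_local_iso[OF uV] by blast
  \<comment> \<open>The letter beyond length M tests adjacency of vertices of
    \<open>disc u M\<close>.\<close>
  let ?\<W> = "{w \<in> lists alphabet. length w \<le> Suc M}"
  have "finite ?\<W>"
    using finite_lists_length_le[OF finite_alphabet, of "Suc M"] by (simp add: lists_eq_set)
  then obtain W where W: "openin TT W" "u \<in> W"
    "\<And>a w w'. a \<in> W \<Longrightarrow> w \<in> ?\<W> \<Longrightarrow> w' \<in> ?\<W> \<Longrightarrow> agree w w' a = agree w w' u"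
    using stable_neighbourhood[OF u, of ?\<W>] by blast
  show ?thesis
  proof (rule that[OF W(1,2)])
    fix u' assume u': "u' \<in> W" and br: "branch k (disc u' R) u'"
    have u'V: "u' \<in> vertices" using u' openin_subset[OF W(1)] topspace_TT by blast
    have "\<forall>v\<in>disc u M. \<exists>w. w \<in> lists alphabet \<and> length w = M \<and> (u, v) \<in> word w"
      using disc_word[OF uV] by blast
    from bchoice[OF this] obtain \<omega> where
      \<omega>: "\<And>v. v \<in> disc u M \<Longrightarrow> \<omega> v \<in> lists alphabet \<and> length (\<omega> v) = M \<and> (u, v) \<in> word (\<omega> v)" by blast
    have \<omega>W: "\<omega> v \<in> ?\<W>" if "v \<in> disc u M" for v using \<omega>[OF that] by simp
    have "\<forall>v\<in>disc u M. \<exists>v'. (u', v') \<in> word (\<omega> v)"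
    proof
      fix v assume v: "v \<in> disc u M"
      have "agree (\<omega> v) (\<omega> v) u" unfolding agree_def using \<omega>[OF v] by blast
      then have "agree (\<omega> v) (\<omega> v) u'" using W(3)[OF u' \<omega>W[OF v] \<omega>W[OF v]] by simp
      then show "\<exists>v'. (u', v') \<in> word (\<omega> v)" unfolding agree_def by blast
    qed
    from bchoice[OF this] obtain \<theta> where \<theta>: "\<And>v. v \<in> disc u M \<Longrightarrow> (u', \<theta> v) \<in> word (\<omega> v)" by blast
    have key: "(u, v) \<in> word w \<longleftrightarrow> (u', \<theta> v) \<in> word w" if v: "v \<in> disc u M" and w: "w \<in> ?\<W>" for v w
    proof -
      have "(u, v) \<in> word w \<longleftrightarrow> agree w (\<omega> v) u"
        unfolding agree_def using \<omega>[OF v] word_unique by blast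
      also have "\<dots> \<longleftrightarrow> agree w (\<omega> v) u'" using W(3)[OF u' w \<omega>W[OF v]] by simp
      also have "\<dots> \<longleftrightarrow> (u', \<theta> v) \<in> word w"
        unfolding agree_def using \<theta>[OF v] word_unique by blast
      finally show ?thesis .
    qed
    show "branch k (disc u R) u"
    proof (rule M[where u' = u' and \<theta> = \<theta>])
      show "u' \<in> vertices" "branch k (disc u' R) u'" by (fact u'V br)+
      show "inj_on \<theta> (disc u M)"
      proof (rule inj_onI)
        fix v v' assume v: "v \<in> disc u M" "v' \<in> disc u M" "\<theta> v = \<theta> v'"
        then have "(u, v) \<in> word (\<omega> v')" using key[OF v(1) \<omega>W[OF v(2)]] \<theta>[OF v(2)] by simp
        then show "v = v'" using \<omega>[OF v(2)] word_unique by blast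
      qed
    next
      fix r assume r: "r \<le> M"
      show "\<theta> ` disc u r = disc u' r"
      proof
        show "\<theta> ` disc u r \<subseteq> disc u' r"
        proof (rule image_subsetI)
          fix v assume v: "v \<in> disc u r"
          then obtain w where w: "w \<in> lists alphabet" "length w = r" "(u, v) \<in> word w"
            using disc_word[OF uV] by blast
          have vM: "v \<in> disc u M" using v disc_mono[OF uV r] by blast
          have "(u', \<theta> v) \<in> word w" using key[OF vM, of w] w r by simp
          then show "\<theta> v \<in> disc u' r" using disc_word[OF u'V] w by blast
        qed
        show "disc u' r \<subseteq> \<theta> ` disc u r"
        proof
          fix v' assume "v' \<in> disc u' r"
          then obtain w where w: "w \<in> lists alphabet" "length w = r" "(u', v') \<in> word w"
            using disc_word[OF u'V] by blast
          have wW: "w \<in> ?\<W>" using w r by simp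
          have "agree w w u'" unfolding agree_def using w by blast
          then obtain v where v: "(u, v) \<in> word w" using W(3)[OF u' wW wW] unfolding agree_def by blast
          then have vr: "v \<in> disc u r" using disc_word[OF uV] w by blast
          then have "(u', \<theta> v) \<in> word w" using key[OF _ wW, of v] v disc_mono[OF uV r] by blast
          then have "v' = \<theta> v" using w(3) word_unique by blast
          then show "v' \<in> \<theta> ` disc u r" using vr by blast
        qed
      qed
    next
      fix a b assume a: "a \<in> disc u M" and b: "b \<in> disc u M" and ab: "(a, b) \<in> meets"
      let ?w = "\<omega> a @ [fst b]"
      have st: "(a, b) \<in> step (fst b)" using ab unfolding step_def by simp
      have bV: "b \<in> vertices" using ab meets_vertices by blast
      have wW: "?w \<in> ?\<W>" using \<omega>[OF a] step_alphabet[OF st] by simp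
      have "(u, b) \<in> word ?w" unfolding word_append using \<omega>[OF a] st bV by auto
      then have "(u', \<theta> b) \<in> word ?w" using key[OF b wW] by simp
      then obtain x where x: "(u', x) \<in> word (\<omega> a)" "(x, \<theta> b) \<in> step (fst b)"
        unfolding word_append by auto
      have "(x, \<theta> b) \<in> meets" using x(2) unfolding step_def by simp
      then show "(\<theta> a, \<theta> b) \<in> meets" using word_unique[OF x(1) \<theta>[OF a]] by simp
    qed
  qed
qed

text \<open>Pairs of words are countable. Two words are both defined on an open set and differ on an
  open subset of it, since transversals are Hausdorff; so the frontier of their agreement set is
  nowhere dense. Off the frontier agreement is locally constant.\<close>

lemma stable_residual:
  assumes c: "c \<in> \<U>"
  obtains \<G> where "countable \<G>" "\<And>G. G \<in> \<G> \<Longrightarrow> closedin (chart_trans c) G \<and> chart_trans c interior_of G = {}"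
    "\<And>z. z \<in> topspace (chart_trans c) \<Longrightarrow> z \<notin> \<Union>\<G> \<Longrightarrow> stable (c, z)"
proof -
  let ?Z = "chart_trans c"
  define A where "A w w' = {z \<in> topspace ?Z. agree w w' (c, z)}" for w w'
  define \<G> where "\<G> = (\<lambda>(w, w'). ?Z frontier_of A w w') ` (lists alphabet \<times> lists alphabet)"
  have op: "openin ?Z {z. (c, z) \<in> W}" if "openin TT W" for W
    using that c unfolding openin_TT by simp
  have dom: "openin TT ((word w)\<inverse> `` vertices)" for w
    using open_word_preimage[OF openin_topspace] unfolding topspace_TT .
  have nowhere: "?Z interior_of (?Z frontier_of A w w') = {}" for w w'
  proof (rule interior_frontier_of_locally_closed)
    let ?W = "{z. (c, z) \<in> (word w)\<inverse> `` vertices \<inter> (word w')\<inverse> `` vertices}"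
    show "openin ?Z ?W" by (intro op openin_Int dom)
    show "A w w' \<subseteq> ?W" unfolding A_def agree_def using word_vertices by blast
    show "openin ?Z (?W - A w w')"
    proof (subst openin_subopen, intro ballI)
      fix z assume z: "z \<in> ?W - A w w'"
      then obtain v v' where v: "((c, z), v) \<in> word w" "((c, z), v') \<in> word w'" by blast
      have "v \<noteq> v'"
      proof
        assume "v = v'"
        then have "agree w w' (c, z)" using v unfolding agree_def by blast
        moreover have "z \<in> topspace ?Z" using word_vertices[OF v(1)] in_vertices by blast
        ultimately show False using z unfolding A_def by blast
      qed
      then obtain N N' where N: "openin TT N" "openin TT N'" "v \<in> N" "v' \<in> N'" "N \<inter> N' = {}"
        using separate_vertices word_vertices[OF v(1)] word_vertices[OF v(2)] by metis
      let ?Q = "{z. (c, z) \<in> (word w)\<inverse> `` N \<inter> (word w')\<inverse> `` N'}"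
      have "openin ?Z ?Q" by (intro op openin_Int open_word_preimage N)
      moreover have "z \<in> ?Q" using v N by blast
      moreover have "?Q \<subseteq> ?W - A w w'"
      proof
        fix y assume "y \<in> ?Q"
        then obtain b b' where b: "((c, y), b) \<in> word w" "((c, y), b') \<in> word w'" "b \<in> N" "b' \<in> N'" by blast
        then have "\<not> agree w w' (c, y)" unfolding agree_def using word_unique N(5) by blast
        then show "y \<in> ?W - A w w'" using b word_vertices unfolding A_def by blast
      qed
      ultimately show "\<exists>T. openin ?Z T \<and> z \<in> T \<and> T \<subseteq> ?W - A w w'" by blast
    qed
  qed
  show ?thesis
  proof (rule that)
    have "countable (lists alphabet)" using finite_alphabet by (simp add: countable_finite countable_lists)
    then show "countable \<G>" unfolding \<G>_def by simp
    fix G assume "G \<in> \<G>"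
    then obtain w w' where "G = ?Z frontier_of A w w'" unfolding \<G>_def by auto
    then show "closedin ?Z G \<and> ?Z interior_of G = {}" using nowhere[of w w'] by (simp add: closedin_frontier_of)
  next
    fix z assume z: "z \<in> topspace ?Z" "z \<notin> \<Union>\<G>"
    show "stable (c, z)" unfolding stable_def
    proof (intro conjI ballI)
      show "(c, z) \<in> vertices" using c z in_vertices by blast
      fix w w' assume "w \<in> lists alphabet" "w' \<in> lists alphabet"
      then have nf: "z \<notin> ?Z frontier_of A w w'" using z(2) unfolding \<G>_def by auto
      have "\<exists>Q. openin ?Z Q \<and> z \<in> Q \<and> (\<forall>y\<in>Q. agree w w' (c, y) = agree w w' (c, z))"
      proof (cases "agree w w' (c, z)")
        case True
        have "A w w' \<subseteq> topspace ?Z" unfolding A_def by blast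
        then have "z \<in> ?Z closure_of A w w'"
          using closure_of_subset True z(1) unfolding A_def by blast
        then have "z \<in> ?Z interior_of A w w'" using nf unfolding frontier_of_def by blast
        moreover have "?Z interior_of A w w' \<subseteq> A w w'" by (rule interior_of_subset)
        ultimately show ?thesis using True unfolding A_def
          by (intro exI[of _ "?Z interior_of {z \<in> topspace ?Z. agree w w' (c, z)}"]) auto
      next
        case False
        then have "z \<notin> ?Z interior_of A w w'" using interior_of_subset[of ?Z "A w w'"] unfolding A_def by blast
        then have nc: "z \<notin> ?Z closure_of A w w'" using nf unfolding frontier_of_def by blast
        have sub: "A w w' \<subseteq> ?Z closure_of A w w'" by (rule closure_of_subset) (auto simp: A_def)
        have "openin ?Z (topspace ?Z - ?Z closure_of A w w')" by (intro openin_diff) auto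
        moreover have "\<not> agree w w' (c, y)" if "y \<in> topspace ?Z - ?Z closure_of A w w'" for y
          using that sub unfolding A_def by blast
        ultimately show ?thesis using False nc z(1) by blast
      qed
      then obtain Q where Q: "openin ?Z Q" "z \<in> Q" "\<forall>y\<in>Q. agree w w' (c, y) = agree w w' (c, z)" by blast
      show "\<exists>W. openin TT W \<and> (c, z) \<in> W \<and> (\<forall>a\<in>W. agree w w' a = agree w w' (c, z))"
      proof (intro exI conjI ballI)
        show "openin TT ({c} \<times> Q)" "(c, z) \<in> {c} \<times> Q" using openin_fibre[OF c Q(1)] Q(2) by auto
        fix a assume "a \<in> {c} \<times> Q"
        then obtain y where "y \<in> Q" "a = (c, y)" by blast
        then show "agree w w' a = agree w w' (c, z)" using Q(3) by blast
      qed
    qed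
  qed
qed

subsection \<open>Trivial holonomy at generic points\<close>

text \<open>A homeomorphism between open sets, in a form for which composition and inversion of
  graphs are immediate.\<close>

definition bi_open :: "(('a, 'z) fol_chart \<times> 'z) rel \<Rightarrow> bool" where
  "bi_open f \<longleftrightarrow> f \<subseteq> vertices \<times> vertices \<and> single_valued f \<and> single_valued (f\<inverse>) \<and>
     (\<forall>W. openin TT W \<longrightarrow> openin TT (f `` W) \<and> openin TT (f\<inverse> `` W))"

text \<open>One word cannot serve for a whole graph: gluing in the pseudogroup lets the word change
  from point to point.\<close>

definition locally_in_words :: "(('a, 'z) fol_chart \<times> 'z) rel \<Rightarrow> bool" where
  "locally_in_words f \<longleftrightarrow> (\<forall>u v. (u, v) \<in> f \<longrightarrow> (\<exists>W w. openin TT W \<and> u \<in> W \<and> w \<in> lists alphabet \<and>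
     (\<forall>a b. (a, b) \<in> f \<longrightarrow> a \<in> W \<longrightarrow> (a, b) \<in> word w)))"

lemma locally_in_wordsD:
  assumes "locally_in_words f" "(u, v) \<in> f"
  obtains W w where "openin TT W" "u \<in> W" "w \<in> lists alphabet"
    "\<And>a b. (a, b) \<in> f \<Longrightarrow> a \<in> W \<Longrightarrow> (a, b) \<in> word w"
proof -
  from assms(1)[unfolded locally_in_words_def, rule_format, OF assms(2)]
  obtain W w where "openin TT W" "u \<in> W" "w \<in> lists alphabet"
    "\<forall>a b. (a, b) \<in> f \<longrightarrow> a \<in> W \<longrightarrow> (a, b) \<in> word w" by (elim exE conjE)
  then show ?thesis using that[of W w] by blast
qed

lemma locally_in_wordsI:
  assumes "\<And>u v. (u, v) \<in> f \<Longrightarrow> \<exists>W w. openin TT W \<and> u \<in> W \<and> w \<in> lists alphabet \<and>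
    (\<forall>a b. (a, b) \<in> f \<longrightarrow> a \<in> W \<longrightarrow> (a, b) \<in> word w)"
  shows "locally_in_words f"
  unfolding locally_in_words_def by (intro allI impI) (rule assms)

lemma bi_openD: "bi_open f \<Longrightarrow> openin TT W \<Longrightarrow> openin TT (f `` W)"
  "bi_open f \<Longrightarrow> openin TT W \<Longrightarrow> openin TT (f\<inverse> `` W)"
  unfolding bi_open_def by blast+

lemma bi_open_unique: "bi_open f \<Longrightarrow> (a, b) \<in> f \<Longrightarrow> (a, b') \<in> f \<Longrightarrow> b = b'"
  "bi_open f \<Longrightarrow> (a, b) \<in> f \<Longrightarrow> (a', b) \<in> f \<Longrightarrow> a = a'"
  unfolding bi_open_def single_valued_def by blast+

lemma bi_open_converse: "bi_open f \<Longrightarrow> bi_open (f\<inverse>)"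
  unfolding bi_open_def by auto

lemma bi_open_comp: assumes f: "bi_open f" and g: "bi_open g" shows "bi_open (f O g)"
  unfolding bi_open_def
proof (intro conjI allI impI)
  show "f O g \<subseteq> vertices \<times> vertices" using f g unfolding bi_open_def by blast
  show "single_valued (f O g)" using f g unfolding bi_open_def by (blast intro: single_valued_relcomp)
  show "single_valued ((f O g)\<inverse>)"
    using f g unfolding bi_open_def converse_relcomp by (blast intro: single_valued_relcomp)
  fix W assume W: "openin TT W"
  show "openin TT ((f O g) `` W)" unfolding relcomp_Image
    by (rule bi_openD(1)[OF g bi_openD(1)[OF f W]])
  show "openin TT ((f O g)\<inverse> `` W)" unfolding converse_relcomp relcomp_Image
    by (rule bi_openD(2)[OF f bi_openD(2)[OF g W]])
qed

lemma elementary_holonomy_eq: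
  assumes "c \<in> \<U>" "d \<in> \<U>"
  shows "elementary_holonomy c d = {(u, v) \<in> meets. fst u = c \<and> fst v = d}"
proof
  show "elementary_holonomy c d \<subseteq> {(u, v) \<in> meets. fst u = c \<and> fst v = d}"
  proof
    fix p assume "p \<in> elementary_holonomy c d"
    then obtain x where x: "x \<in> chart_dom c \<inter> chart_dom d"
      and p: "p = ((c, transverse_proj c x), (d, transverse_proj d x))"
      unfolding elementary_holonomy_def by blast
    have "((c, transverse_proj c x), (d, transverse_proj d x)) \<in> meets"
      using x vertex_of_point[OF assms(1), of x] vertex_of_point[OF assms(2), of x]
      by (intro meetsI[of _ _ x]) auto
    then show "p \<in> {(u, v) \<in> meets. fst u = c \<and> fst v = d}" unfolding p by simp
  qed
  show "{(u, v) \<in> meets. fst u = c \<and> fst v = d} \<subseteq> elementary_holonomy c d"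
  proof
    fix p assume "p \<in> {(u, v) \<in> meets. fst u = c \<and> fst v = d}"
    then obtain z w where p: "p = ((c, z), (d, w))" and m: "((c, z), (d, w)) \<in> meets" by auto
    obtain x where "x \<in> plaque (c, z)" "x \<in> plaque (d, w)" using m unfolding meets_def by auto
    then have "x \<in> chart_dom c \<inter> chart_dom d" "z = transverse_proj c x" "w = transverse_proj d x"
      using plaqueU[OF assms(1)] plaqueU[OF assms(2)] by auto
    then show "p \<in> elementary_holonomy c d" unfolding p elementary_holonomy_def by blast
  qed
qed

lemma elementary_holonomy_step:
  assumes "c \<in> \<U>" "d \<in> \<U>" shows "elementary_holonomy c d \<subseteq> step d"
  unfolding elementary_holonomy_eq[OF assms] step_def by auto

lemma elementary_holonomy_converse:
  assumes "c \<in> \<U>" "d \<in> \<U>" shows "(elementary_holonomy c d)\<inverse> = elementary_holonomy d c"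
  unfolding elementary_holonomy_def by blast

lemma open_elementary_holonomy:
  assumes "c \<in> \<U>" "d \<in> \<U>" "openin TT W" shows "openin TT (elementary_holonomy c d `` W)"
proof -
  have "elementary_holonomy c d `` W = {v \<in> meets `` {u \<in> W. fst u = c}. fst v = d}"
    unfolding elementary_holonomy_eq[OF assms(1,2)] by blast
  then show ?thesis using open_fibre_part[OF open_meets_image[OF open_fibre_part[OF assms(3)]]] by simp
qed

lemma bi_open_elementary: assumes "c \<in> \<U>" "d \<in> \<U>" shows "bi_open (elementary_holonomy c d)"
  unfolding bi_open_def
proof (intro conjI allI impI)
  show "elementary_holonomy c d \<subseteq> vertices \<times> vertices"
    unfolding elementary_holonomy_eq[OF assms] using meets_vertices by blast
  have sv: "single_valued (elementary_holonomy c d)" if "c \<in> \<U>" "d \<in> \<U>" for c d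
    using elementary_holonomy_step[OF that] step_unique unfolding single_valued_def by blast
  then show "single_valued (elementary_holonomy c d)" "single_valued ((elementary_holonomy c d)\<inverse>)"
    using assms elementary_holonomy_converse by auto
  fix W assume "openin TT W"
  then show "openin TT (elementary_holonomy c d `` W)" "openin TT ((elementary_holonomy c d)\<inverse> `` W)"
    using open_elementary_holonomy assms elementary_holonomy_converse by auto
qed

lemma locally_in_words_elementary:
  assumes "c \<in> \<U>" "d \<in> \<U>" shows "locally_in_words (elementary_holonomy c d)"
proof (rule locally_in_wordsI)
  fix u v assume uv: "(u, v) \<in> elementary_holonomy c d"
  have sub: "(a, b) \<in> word [d]" if "(a, b) \<in> elementary_holonomy c d" for a b
  proof -
    have "(a, b) \<in> step d" using that elementary_holonomy_step[OF assms] by blast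
    moreover have "b \<in> vertices" using calculation meets_vertices unfolding step_def by blast
    ultimately show ?thesis by auto
  qed
  have "(u, v) \<in> step d" using uv elementary_holonomy_step[OF assms] by blast
  then have "d \<in> alphabet" "u \<in> vertices" using step_alphabet meets_vertices unfolding step_def by blast+
  then show "\<exists>W w. openin TT W \<and> u \<in> W \<and> w \<in> lists alphabet \<and>
      (\<forall>a b. (a, b) \<in> elementary_holonomy c d \<longrightarrow> a \<in> W \<longrightarrow> (a, b) \<in> word w)"
    using sub topspace_TT openin_topspace[of TT]
    by (intro exI[of _ "topspace TT"] exI[of _ "[d]"]) (simp del: word.simps openin_topspace)
qed

lemma locally_in_words_comp:
  assumes f: "bi_open f" "locally_in_words f" and g: "locally_in_words g"
  shows "locally_in_words (f O g)"
proof (rule locally_in_wordsI)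
  fix u v assume "(u, v) \<in> f O g"
  then obtain t where t: "(u, t) \<in> f" "(t, v) \<in> g" by blast
  obtain W1 w1 where 1: "openin TT W1" "u \<in> W1" "w1 \<in> lists alphabet"
    "\<And>a b. (a, b) \<in> f \<Longrightarrow> a \<in> W1 \<Longrightarrow> (a, b) \<in> word w1" using locally_in_wordsD[OF f(2) t(1)] by blast
  obtain W2 w2 where 2: "openin TT W2" "t \<in> W2" "w2 \<in> lists alphabet"
    "\<And>a b. (a, b) \<in> g \<Longrightarrow> a \<in> W2 \<Longrightarrow> (a, b) \<in> word w2" using locally_in_wordsD[OF g t(2)] by blast
  let ?W = "W1 \<inter> f\<inverse> `` W2"
  have op: "openin TT ?W" using 1(1) bi_openD(2)[OF f(1) 2(1)] by (rule openin_Int)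
  have "(a, b) \<in> word (w1 @ w2)" if ab: "(a, b) \<in> f O g" "a \<in> ?W" for a b
  proof -
    obtain s where s: "(a, s) \<in> f" "(s, b) \<in> g" using ab(1) by blast
    obtain s' where "(a, s') \<in> f" "s' \<in> W2" using ab(2) by blast
    then have "s \<in> W2" using bi_open_unique(1)[OF f(1) s(1)] by blast
    then have "(a, s) \<in> word w1" "(s, b) \<in> word w2" using 1(4) 2(4) s ab(2) by auto
    then show ?thesis unfolding word_append by (rule relcompI)
  qed
  moreover have "u \<in> ?W" using 1(2) 2(2) t(1) by blast
  moreover have "w1 @ w2 \<in> lists alphabet" using 1(3) 2(3) by simp
  ultimately show "\<exists>W w. openin TT W \<and> u \<in> W \<and> w \<in> lists alphabet \<and>
      (\<forall>a b. (a, b) \<in> f O g \<longrightarrow> a \<in> W \<longrightarrow> (a, b) \<in> word w)"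
    using op by (intro exI[of _ ?W] exI[of _ "w1 @ w2"]) blast
qed

lemma bi_open_local_homeo:
  assumes "local_homeo_graph TT f" shows "bi_open f"
proof -
  obtain g where D: "openin TT (Domain f)" "openin TT (Range f)" and f: "f = {(u, g u) | u. u \<in> Domain f}"
    and h: "homeomorphic_map (subtopology TT (Domain f)) (subtopology TT (Range f)) g"
    using assms unfolding local_homeo_graph_def by (elim conjE exE)
  have sub: "Domain f \<subseteq> topspace TT" "Range f \<subseteq> topspace TT" using D openin_subset by auto
  have tD: "topspace (subtopology TT (Domain f)) = Domain f" using sub by (simp add: Int_absorb1)
  have fI: "(a, b) \<in> f \<longleftrightarrow> a \<in> Domain f \<and> b = g a" for a b
  proof -
    have "(a, b) \<in> f \<longleftrightarrow> (a, b) \<in> {(u, g u) | u. u \<in> Domain f}" using f by (rule arg_cong)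
    then show ?thesis by blast
  qed
  have inj: "inj_on g (Domain f)" using homeomorphic_imp_injective_map[OF h] tD by simp
  show ?thesis unfolding bi_open_def
  proof (intro conjI allI impI)
    show "f \<subseteq> vertices \<times> vertices" using sub topspace_TT by auto
    show "single_valued f" by (rule single_valuedI) (simp add: fI)
    show "single_valued (f\<inverse>)" unfolding single_valued_def using fI inj_onD[OF inj] by (metis converse_iff)
    fix W assume W: "openin TT W"
    have "openin (subtopology TT (Domain f)) (W \<inter> Domain f)" using W by (rule openin_subtopology_Int)
    then have "openin (subtopology TT (Range f)) (g ` (W \<inter> Domain f))"
      using homeomorphic_imp_open_map[OF h] unfolding open_map_def by blast
    then have "openin TT (g ` (W \<inter> Domain f))" using D(2) openin_open_subtopology by blast
    moreover have "f `` W = g ` (W \<inter> Domain f)" by (simp only: Image_def image_def fI) blast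
    ultimately show "openin TT (f `` W)" by simp
    have "openin (subtopology TT (Range f)) (W \<inter> Range f)" using W by (rule openin_subtopology_Int)
    then have "openin (subtopology TT (Domain f)) {a \<in> topspace (subtopology TT (Domain f)). g a \<in> W \<inter> Range f}"
      by (rule openin_continuous_map_preimage[OF homeomorphic_imp_continuous_map[OF h]])
    then have "openin TT {a \<in> Domain f. g a \<in> W \<inter> Range f}" unfolding tD using D(1) openin_open_subtopology by blast
    moreover have "g a \<in> Range f" if "a \<in> Domain f" for a using fI[of a "g a"] that by (intro RangeI) simp
    then have "f\<inverse> `` W = {a \<in> Domain f. g a \<in> W \<inter> Range f}"
      by (simp only: Image_def converse_iff fI) blast
    ultimately show "openin TT (f\<inverse> `` W)" by simp
  qed
qed

text \<open>The induction carries all three properties at once: composition needs open preimages,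
  and inversion needs words for the inverse.\<close>

lemma pseudogroup_locally_in_words:
  assumes "f \<in> holonomy_pseudogroup \<U>"
  shows "bi_open f \<and> locally_in_words f \<and> locally_in_words (f\<inverse>)"
  using assms unfolding holonomy_pseudogroup_def
proof (induction rule: generated_pseudogroup.induct)
  case (gen f)
  then obtain c d where "f = elementary_holonomy c d" "c \<in> \<U>" "d \<in> \<U>" by blast
  then show ?case using bi_open_elementary locally_in_words_elementary elementary_holonomy_converse by simp
next
  case (ident W)
  then have W: "W \<subseteq> vertices" using openin_subset topspace_TT by blast
  have "Id_on W `` N = W \<inter> N" for N by auto
  then have "bi_open (Id_on W)" unfolding bi_open_def using W ident by (auto simp: openin_Int)
  moreover have "locally_in_words (Id_on W)"
  proof (rule locally_in_wordsI)
    fix u v assume "(u, v) \<in> Id_on W"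
    then show "\<exists>N w. openin TT N \<and> u \<in> N \<and> w \<in> lists alphabet \<and> (\<forall>a b. (a, b) \<in> Id_on W \<longrightarrow> a \<in> N \<longrightarrow> (a, b) \<in> word w)"
      using W ident by (intro exI[of _ W] exI[of _ "[]"]) auto
  qed
  ultimately show ?case by simp
next
  case (comp f g)
  then show ?case
    using bi_open_comp[of f g] locally_in_words_comp[of f g]
      locally_in_words_comp[of "g\<inverse>" "f\<inverse>"] bi_open_converse[of g] by (simp add: converse_relcomp)
next
  case (inv f)
  then show ?case using bi_open_converse by simp
next
  case (glue f)
  have bo: "bi_open f" by (rule bi_open_local_homeo[OF glue(1)])
  have loc: "\<exists>N. openin TT N \<and> u \<in> N \<and> locally_in_words (Id_on N O f) \<and> locally_in_words ((Id_on N O f)\<inverse>)"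
    if "(u, v) \<in> f" for u v using glue(2)[of u] that by blast
  have "locally_in_words f"
  proof (rule locally_in_wordsI)
    fix u v assume uv: "(u, v) \<in> f"
    from loc[OF this] obtain N where N: "openin TT N" "u \<in> N" "locally_in_words (Id_on N O f)" by (elim exE conjE)
    have "(u, v) \<in> Id_on N O f" using uv N(2) by auto
    then obtain W w where W: "openin TT W" "u \<in> W" "w \<in> lists alphabet"
      "\<And>a b. (a, b) \<in> Id_on N O f \<Longrightarrow> a \<in> W \<Longrightarrow> (a, b) \<in> word w" using locally_in_wordsD[OF N(3)] by blast
    have "(a, b) \<in> word w" if "(a, b) \<in> f" "a \<in> W \<inter> N" for a b
      by (rule W(4)) (use that in auto)
    then show "\<exists>W w. openin TT W \<and> u \<in> W \<and> w \<in> lists alphabet \<and> (\<forall>a b. (a, b) \<in> f \<longrightarrow> a \<in> W \<longrightarrow> (a, b) \<in> word w)"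
      using openin_Int[OF W(1) N(1)] W(2,3) N(2) by (intro exI[of _ "W \<inter> N"] exI[of _ w]) auto
  qed
  moreover have "locally_in_words (f\<inverse>)"
  proof (rule locally_in_wordsI)
    fix v u assume "(v, u) \<in> f\<inverse>"
    then have uv: "(u, v) \<in> f" by simp
    from loc[OF this] obtain N where N: "openin TT N" "u \<in> N" "locally_in_words ((Id_on N O f)\<inverse>)" by (elim exE conjE)
    have "(v, u) \<in> (Id_on N O f)\<inverse>" using uv N(2) by auto
    then obtain W w where W: "openin TT W" "v \<in> W" "w \<in> lists alphabet"
      "\<And>a b. (a, b) \<in> (Id_on N O f)\<inverse> \<Longrightarrow> a \<in> W \<Longrightarrow> (a, b) \<in> word w" using locally_in_wordsD[OF N(3)] by blast
    \<comment> \<open>Injectivity of f identifies a with the preimage of b in N, which puts (b, a)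
      into the inverse of the restricted graph.\<close>
    have "(b, a) \<in> word w" if ba: "(b, a) \<in> f\<inverse>" "b \<in> W \<inter> f `` N" for b a
    proof (rule W(4))
      obtain a' where "a' \<in> N" "(a', b) \<in> f" using ba(2) by blast
      then have "a \<in> N" using bi_open_unique(2)[OF bo, of a b a'] ba(1) by simp
      then show "(b, a) \<in> (Id_on N O f)\<inverse>" using ba(1) by auto
    qed (use ba in simp)
    moreover have "openin TT (W \<inter> f `` N)" "v \<in> W \<inter> f `` N"
      using W(1,2) bi_openD(1)[OF bo N(1)] uv N(2) by auto
    ultimately show "\<exists>W w. openin TT W \<and> v \<in> W \<and> w \<in> lists alphabet \<and> (\<forall>a b. (a, b) \<in> f\<inverse> \<longrightarrow> a \<in> W \<longrightarrow> (a, b) \<in> word w)"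
      using W(3) by (intro exI[of _ "W \<inter> f `` N"] exI[of _ w]) blast
  qed
  ultimately show ?case using bo by simp
qed

text \<open>Near u the map f follows a word w that fixes u, and stability of
  \<open>agree w []\<close> makes w fix all nearby points.\<close>

lemma stable_germ:
  assumes u: "stable u" and f: "f \<in> holonomy_stabilizer \<U> u"
  shows "\<exists>W. openin TT W \<and> u \<in> W \<and> Id_on W O f = Id_on W"
proof -
  have uu: "(u, u) \<in> f" and pg: "f \<in> holonomy_pseudogroup \<U>" using f unfolding holonomy_stabilizer_def by auto
  have bo: "bi_open f" and lf: "locally_in_words f" using pseudogroup_locally_in_words[OF pg] by auto
  obtain W w where W: "openin TT W" "u \<in> W" "w \<in> lists alphabet"
    "\<And>a b. (a, b) \<in> f \<Longrightarrow> a \<in> W \<Longrightarrow> (a, b) \<in> word w" using locally_in_wordsD[OF lf uu] by blast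
  have uV: "u \<in> vertices" using u unfolding stable_def by blast
  have "[] \<in> lists alphabet" by simp
  from stableD[OF u W(3) this] obtain N where
    N: "openin TT N" "u \<in> N" "\<forall>a\<in>N. agree w [] a = agree w [] u" by (elim exE conjE)
  have ag: "agree w [] u" unfolding agree_def using W(4)[OF uu W(2)] uV by (intro exI[of _ u]) (simp add: Id_onI)
  \<comment> \<open>The last factor is the domain of f, so f is defined on all of
    \<open>?Q\<close>.\<close>
  let ?Q = "W \<inter> N \<inter> f\<inverse> `` topspace TT"
  have "openin TT ?Q" by (intro openin_Int W N bi_openD(2)[OF bo openin_topspace])
  moreover have "u \<in> ?Q" using W(2) N(2) uu uV topspace_TT by blast
  moreover have fix_a: "b = a" if ab: "(a, b) \<in> f" "a \<in> ?Q" for a b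
  proof -
    have "agree w [] a = agree w [] u" using bspec[OF N(3), of a] ab(2) by blast
    then have "agree w [] a" using ag by simp
    then have "(a, a) \<in> word w" unfolding agree_def by auto
    moreover have "(a, b) \<in> word w" using W(4) ab by blast
    ultimately show ?thesis using word_unique by blast
  qed
  have "Id_on ?Q O f = Id_on ?Q"
  proof
    show "Id_on ?Q O f \<subseteq> Id_on ?Q"
    proof
      fix p assume "p \<in> Id_on ?Q O f"
      then obtain a b where "p = (a, b)" "a \<in> ?Q" "(a, b) \<in> f" by blast
      then show "p \<in> Id_on ?Q" using fix_a by blast
    qed
    show "Id_on ?Q \<subseteq> Id_on ?Q O f"
    proof
      fix p assume "p \<in> Id_on ?Q"
      then obtain a where a: "p = (a, a)" "a \<in> ?Q" by blast
      then obtain b where "(a, b) \<in> f" by blast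
      then have "(a, a) \<in> f" using fix_a a(2) by blast
      then show "p \<in> Id_on ?Q O f" using a by blast
    qed
  qed
  ultimately show ?thesis by blast
qed

lemma stable_trivial_germs:
  assumes u: "stable u"
  shows "holonomy_germs \<U> u = {same_germ \<U> u `` {Id_on (topspace TT)}}"
proof -
  let ?I = "Id_on (topspace TT)" and ?S = "holonomy_stabilizer \<U> u"
  have uV: "u \<in> vertices" using u unfolding stable_def by blast
  have I: "?I \<in> ?S"
    unfolding holonomy_stabilizer_def holonomy_pseudogroup_def
    using generated_pseudogroup.ident[OF openin_topspace, of TT] uV topspace_TT by auto
  have "(f, g) \<in> same_germ \<U> u" if fg: "f \<in> ?S" "g \<in> ?S" for f g
  proof -
    obtain W where W: "openin TT W" "u \<in> W" "Id_on W O f = Id_on W" using stable_germ[OF u fg(1)] by blast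
    obtain N where N: "openin TT N" "u \<in> N" "Id_on N O g = Id_on N" using stable_germ[OF u fg(2)] by blast
    have "Id_on (W \<inter> N) O f = Id_on N O (Id_on W O f)" by auto
    also have "\<dots> = Id_on W O (Id_on N O g)" unfolding W(3) N(3) by auto
    also have "\<dots> = Id_on (W \<inter> N) O g" by auto
    finally have "Id_on (W \<inter> N) O f = Id_on (W \<inter> N) O g" .
    then show ?thesis unfolding same_germ_def using fg openin_Int[OF W(1) N(1)] W(2) N(2) by blast
  qed
  then have "same_germ \<U> u `` {f} = ?S" if "f \<in> ?S" for f
    using that unfolding same_germ_def by blast
  then show ?thesis unfolding holonomy_germs_def quotient_def using I by blast
qed

lemma stable_without_holonomy:
  assumes u: "stable u" shows "without_holonomy \<U> (region u)"
  unfolding without_holonomy_def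
proof (intro ballI)
  have uV: "u \<in> vertices" using u unfolding stable_def by blast
  fix c x assume c: "c \<in> \<U>" and x: "x \<in> region u \<inter> chart_dom c"
  let ?v = "(c, transverse_proj c x)"
  have v: "?v \<in> vertices" "x \<in> plaque ?v" using vertex_of_point[OF c, of x] x by auto
  then have "?v \<in> leaf u" using leafI[OF uV v] x by blast
  then show "holonomy_germs \<U> ?v = {same_germ \<U> ?v `` {Id_on (topspace TT)}}"
    by (rule stable_trivial_germs[OF stable_leaf[OF u]])
qed

end

section \<open>Baire category and minimality\<close>

lemma infinite_cantor_set: "infinite cantor_set"
proof
  assume "finite cantor_set"
  then have "finite (range (\<lambda>n::nat. ternary_value (\<lambda>i. i = n)))"
    using range_ternary_value by (elim finite_subset[rotated]) blast
  moreover have "inj (\<lambda>n::nat. ternary_value (\<lambda>i. i = n))"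
    by (rule injI) (metis ternary_value_inject)
  ultimately show False using finite_imageD by blast
qed

lemma infinite_cantor_space:
  assumes "cantor_space E" shows "infinite (topspace E)"
proof
  assume fin: "finite (topspace E)"
  obtain f where "homeomorphic_map E (subtopology euclideanreal cantor_set) f"
    using assms unfolding cantor_space_def homeomorphic_space by blast
  then have "f ` topspace E = cantor_set" using homeomorphic_imp_surjective_map by fastforce
  then show False using fin infinite_cantor_set by (metis finite_imageI)
qed

lemma has_end_type_unique: "has_end_type E t \<Longrightarrow> has_end_type E t' \<Longrightarrow> t = t'"
  using infinite_cantor_space[of E] by (cases t; cases t') auto

context compact_foliation
begin

text \<open>By density some word leads from the plaque of a given point into W, and the same word
  does so from nearby plaques. Compactness of X leaves finitely many words, hence a common bound on
  their length.\<close>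

lemma leaf_recurrence_bound:
  assumes min: "minimal_foliation X n \<A>" and c: "c \<in> \<U>" and W: "openin (chart_trans c) W" "W \<noteq> {}"
  obtains S where "\<And>v. v \<in> vertices \<Longrightarrow> \<exists>z\<in>W. (c, z) \<in> disc v S"
proof -
  let ?O = "{x \<in> chart_dom c. transverse_proj c x \<in> W}"
  have O: "openin X ?O" by (rule open_transverse_preimage[OF productU[OF c] W(1)])
  obtain z0 where z0: "z0 \<in> W" using W(2) by blast
  then have "(c, z0) \<in> vertices" using c openin_subset[OF W(1)] in_vertices by blast
  then obtain x0 where "x0 \<in> plaque (c, z0)" using plaque_nonempty by blast
  then have x0: "x0 \<in> ?O" using z0 plaqueU[OF c] by auto
  define near where "near m x \<longleftrightarrow> (\<exists>d\<in>\<U>. x \<in> chart_dom d \<and> (\<exists>z\<in>W. (c, z) \<in> disc (d, transverse_proj d x) m))" for m x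
  have "\<exists>N m. openin X N \<and> x \<in> N \<and> (\<forall>y\<in>N. near m y)" if x: "x \<in> topspace X" for x
  proof -
    obtain d where d: "d \<in> \<U>" "x \<in> chart_dom d" using x coverU by blast
    let ?v = "(d, transverse_proj d x)"
    have v: "?v \<in> vertices" using vertex_of_point[OF d] by blast
    have "region ?v \<in> leaves X n \<A>" unfolding leaves_eq using v by blast
    then have "X closure_of region ?v = topspace X" using min unfolding minimal_foliation_def dense_leaf_def by blast
    moreover have "x0 \<in> topspace X" using x0 openin_subset[OF O] by blast
    ultimately have "region ?v \<inter> ?O \<noteq> {}" using closure_of_meets_open[OF _ O x0] by blast
    then obtain y where y: "y \<in> region ?v" "y \<in> chart_dom c" "transverse_proj c y \<in> W" by blast
    have cy: "(c, transverse_proj c y) \<in> vertices" "y \<in> plaque (c, transverse_proj c y)"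
      using vertex_of_point[OF c y(2)] by auto
    obtain m where m: "(c, transverse_proj c y) \<in> disc ?v m" using leaf_disc[OF leafI[OF v cy y(1)]] by metis
    then obtain w where w: "w \<in> lists alphabet" "length w = m" "(?v, (c, transverse_proj c y)) \<in> word w"
      using disc_word[OF v] by blast
    let ?Q = "(word w)\<inverse> `` ({c} \<times> W)"
    let ?N = "{x' \<in> chart_dom d. transverse_proj d x' \<in> {z. (d, z) \<in> ?Q}}"
    have "openin (chart_trans d) {z. (d, z) \<in> ?Q}"
      using open_word_preimage[OF openin_fibre[OF c W(1)]] d(1) unfolding openin_TT by blast
    then have "openin X ?N" by (rule open_transverse_preimage[OF productU[OF d(1)]])
    moreover have "x \<in> ?N" using d(2) w(3) y(3) by blast
    moreover have "near m y'" if y': "y' \<in> ?N" for y'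
    proof -
      obtain z where z: "z \<in> W" "((d, transverse_proj d y'), (c, z)) \<in> word w" using y' by blast
      have "(d, transverse_proj d y') \<in> vertices" using word_vertices[OF z(2)] by blast
      then have "(c, z) \<in> disc (d, transverse_proj d y') m" using disc_word z(2) w(1,2) by blast
      then show ?thesis unfolding near_def using d(1) y' z(1) by blast
    qed
    ultimately show ?thesis by blast
  qed
  then obtain N m where Nm: "\<And>x. x \<in> topspace X \<Longrightarrow> openin X (N x) \<and> x \<in> N x \<and> (\<forall>y\<in>N x. near (m x) y)"
    by metis
  have "\<exists>\<F>. finite \<F> \<and> \<F> \<subseteq> N ` topspace X \<and> topspace X \<subseteq> \<Union>\<F>"
    using compactX[unfolded compact_space_def] by (rule compactinD) (use Nm in auto)
  then obtain \<F> where \<F>: "finite \<F>" "\<F> \<subseteq> N ` topspace X" "topspace X \<subseteq> \<Union>\<F>" by (elim exE conjE)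
  obtain G where G: "finite G" "G \<subseteq> topspace X" "\<F> = N ` G"
    using finite_subset_image[OF \<F>(1,2)] by blast
  \<comment> \<open>The added 1 is the step from v to the plaque of the chart d in which the word
    starts.\<close>
  define S where "S = 1 + Max (insert 0 (m ` G))"
  show ?thesis
  proof (rule that)
    fix v assume v: "v \<in> vertices"
    obtain x where x: "x \<in> plaque v" using plaque_nonempty[OF v] by blast
    then have "x \<in> topspace X" using open_plaque[OF v] openin_subset topspace_LT by blast
    then obtain g where g: "g \<in> G" "x \<in> N g" using \<F>(3) G(3) by blast
    then have "near (m g) x" using Nm G(2) by blast
    then obtain d z where d: "d \<in> \<U>" "x \<in> chart_dom d" and z: "z \<in> W" "(c, z) \<in> disc (d, transverse_proj d x) (m g)"
      unfolding near_def by blast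
    have "(v, (d, transverse_proj d x)) \<in> meets" using meetsI[OF v _ x] vertex_of_point[OF d] by blast
    then have "(c, z) \<in> disc v (1 + m g)" using disc_trans[OF meets_disc z(2)] by blast
    moreover have "1 + m g \<le> S" unfolding S_def using G(1) g(1) by simp
    ultimately show "\<exists>z\<in>W. (c, z) \<in> disc v S" using disc_mono[OF v] z(1) by blast
  qed
qed

lemma Baire_chart_trans:
  assumes "c \<in> \<U>" "countable \<G>" "\<And>G. G \<in> \<G> \<Longrightarrow> closedin (chart_trans c) G \<and> chart_trans c interior_of G = {}"
  shows "chart_trans c interior_of \<Union>\<G> = {}"
  by (rule Baire_category_alt)
    (use assms productU[OF assms(1)] in \<open>simp_all add: product_chart_def polish_topology_def\<close>)

lemma stable_exists:
  assumes c: "c \<in> \<U>" "chart_dom c \<noteq> {}" obtains z where "stable (c, z)"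
proof -
  let ?Z = "chart_trans c"
  obtain \<G> where \<G>: "countable \<G>" "\<And>G. G \<in> \<G> \<Longrightarrow> closedin ?Z G \<and> ?Z interior_of G = {}"
    "\<And>z. z \<in> topspace ?Z \<Longrightarrow> z \<notin> \<Union>\<G> \<Longrightarrow> stable (c, z)" using stable_residual[OF c(1)] by blast
  have "topspace ?Z \<noteq> {}" using c transverse_proj_in[OF productU[OF c(1)]] by blast
  moreover have "?Z interior_of \<Union>\<G> = {}" by (rule Baire_chart_trans[OF c(1) \<G>(1,2)])
  moreover have "?Z interior_of \<Union>\<G> = topspace ?Z" if "topspace ?Z \<subseteq> \<Union>\<G>"
    by (rule subset_antisym[OF interior_of_subset_topspace interior_of_maximal[OF that openin_topspace]])
  ultimately have "\<not> topspace ?Z \<subseteq> \<Union>\<G>" by metis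
  then obtain z where "z \<in> topspace ?Z" "z \<notin> \<Union>\<G>" by (meson subsetI)
  then show ?thesis by (intro that \<G>(3))
qed

text \<open>The closures of the sets \<open>T R\<close> and countably many nowhere dense sets cover
  the transversal, so one closure has interior. By \<open>branch_upper_semicontinuous\<close>, a
  stable point in the closure of \<open>T R\<close> satisfies the condition with the same R.\<close>

lemma uniform_branch_open:
  assumes c: "c \<in> \<U>" "chart_dom c \<noteq> {}"
    and all: "\<And>z. stable (c, z) \<Longrightarrow> \<exists>R. branch k (disc (c, z) R) (c, z)"
  obtains W R where "openin (chart_trans c) W" "W \<noteq> {}"
    "\<And>z. z \<in> W \<Longrightarrow> stable (c, z) \<Longrightarrow> branch k (disc (c, z) R) (c, z)"
proof -
  let ?Z = "chart_trans c"
  define T where "T R = {z \<in> topspace ?Z. stable (c, z) \<and> branch k (disc (c, z) R) (c, z)}" for R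
  obtain \<G> where \<G>: "countable \<G>" "\<And>G. G \<in> \<G> \<Longrightarrow> closedin ?Z G \<and> ?Z interior_of G = {}"
    "\<And>z. z \<in> topspace ?Z \<Longrightarrow> z \<notin> \<Union>\<G> \<Longrightarrow> stable (c, z)" using stable_residual[OF c(1)] by blast
  have "\<exists>R. ?Z interior_of (?Z closure_of T R) \<noteq> {}"
  proof (rule ccontr)
    assume no: "\<nexists>R. ?Z interior_of (?Z closure_of T R) \<noteq> {}"
    let ?H = "\<G> \<union> range (\<lambda>R. ?Z closure_of T R)"
    have "?Z interior_of \<Union>?H = {}"
    proof (rule Baire_chart_trans[OF c(1)])
      show "countable ?H" using \<G>(1) by simp
      show "closedin ?Z G \<and> ?Z interior_of G = {}" if "G \<in> ?H" for G using that \<G>(2) no by auto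
    qed
    moreover have "topspace ?Z \<subseteq> \<Union>?H"
    proof
      fix z assume z: "z \<in> topspace ?Z"
      show "z \<in> \<Union>?H"
      proof (cases "z \<in> \<Union>\<G>")
        case False
        then have "stable (c, z)" using \<G>(3) z by blast
        then obtain R where "z \<in> T R" using all z unfolding T_def by blast
        moreover have "T R \<subseteq> ?Z closure_of T R" by (rule closure_of_subset) (auto simp: T_def)
        ultimately show ?thesis by blast
      qed blast
    qed
    from interior_of_maximal[OF this openin_topspace] have "topspace ?Z \<subseteq> ?Z interior_of \<Union>?H" .
    moreover have "topspace ?Z \<noteq> {}" using c transverse_proj_in[OF productU[OF c(1)]] by blast
    ultimately show False by simp
  qed
  then obtain R where R: "?Z interior_of (?Z closure_of T R) \<noteq> {}" ..
  show ?thesis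
  proof (rule that[of "?Z interior_of (?Z closure_of T R)" R])
    fix z assume z: "z \<in> ?Z interior_of (?Z closure_of T R)" and st: "stable (c, z)"
    obtain Q where Q: "openin TT Q" "(c, z) \<in> Q"
      "\<And>u'. u' \<in> Q \<Longrightarrow> branch k (disc u' R) u' \<Longrightarrow> branch k (disc (c, z) R) (c, z)"
      using branch_upper_semicontinuous[OF st, of k R] by blast
    have "z \<in> ?Z closure_of T R" by (rule subsetD[OF interior_of_subset z])
    moreover have "openin ?Z {y. (c, y) \<in> Q}" using Q(1) c(1) unfolding openin_TT by simp
    ultimately have "T R \<inter> {y. (c, y) \<in> Q} \<noteq> {}"
      by (rule closure_of_meets_open) (simp add: Q(2))
    then obtain y where "y \<in> T R" "(c, y) \<in> Q" by blast
    then show "branch k (disc (c, z) R) (c, z)" using Q(3) unfolding T_def by blast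
  qed (use R in auto)
qed

text \<open>Every vertex reaches W within S steps, and its disc of radius S + R contains the disc of
  radius R about the vertex reached.\<close>

lemma uniform_branch_leaf:
  assumes min: "minimal_foliation X n \<A>" and c: "c \<in> \<U>" "chart_dom c \<noteq> {}"
    and all: "\<And>z. stable (c, z) \<Longrightarrow> \<exists>R. branch k (disc (c, z) R) (c, z)"
    and u: "stable u"
  obtains R where "\<And>v. v \<in> leaf u \<Longrightarrow> branch k (disc v R) v"
proof -
  have uV: "u \<in> vertices" using u unfolding stable_def by blast
  obtain W R where W: "openin (chart_trans c) W" "W \<noteq> {}"
    "\<And>z. z \<in> W \<Longrightarrow> stable (c, z) \<Longrightarrow> branch k (disc (c, z) R) (c, z)"
    using uniform_branch_open[OF c all] by blast
  obtain S where S: "\<And>v. v \<in> vertices \<Longrightarrow> \<exists>z\<in>W. (c, z) \<in> disc v S"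
    using leaf_recurrence_bound[OF min c(1) W(1,2)] by blast
  show ?thesis
  proof (rule that)
    fix v assume v: "v \<in> leaf u"
    then have vV: "v \<in> vertices" using leaf_subset_vertices[OF uV] by blast
    obtain z where z: "z \<in> W" "(c, z) \<in> disc v S" using S[OF vV] by blast
    have zl: "(c, z) \<in> leaf v" using z(2) disc_subset_leaf by blast
    then have "stable (c, z)" using stable_leaf[OF stable_leaf[OF u v]] by blast
    then have "branch k (disc (c, z) R) (c, z)" using W(3) z(1) by blast
    then have "branch k (disc (c, z) R) v" using branch_leaf[OF zl] by simp
    then show "branch k (disc v (S + R)) v" using branch_mono_set disc_shift[OF z(2)] finite_disc by blast
  qed
qed

end

theorem corollary1p4:
  fixes X :: "'a topology" and n :: nat and \<A> \<U> :: "('a, 'z) fol_chart set"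
  assumes "compact_polish_foliated_space X n \<A>"
    and "topspace X \<noteq> {}"
    and "minimal_foliation X n \<A>"
    and "regular_atlas X n \<A> \<U>"
    and "equi_coarsely_quasi_isometric
           {(L, leaf_dist X n \<A> \<U>) | L.
              L \<in> leaves X n \<A> \<and> L \<subseteq> union_dense_without_holonomy X n \<A> \<U>}"
  shows "\<exists>!t. \<forall>L \<in> leaves X n \<A>. L \<subseteq> union_without_holonomy X n \<A> \<U>
           \<longrightarrow> has_end_type (leaf_end_space X n \<A> L) t"
proof -
  interpret compact_foliation X n \<A> \<U> by unfold_locales (fact assms(1) assms(4))+
  let ?E = "\<lambda>v. end_space (leaf_space v)"
  obtain x where "x \<in> topspace X" using assms(2) by blast
  then obtain c where c: "c \<in> \<U>" "x \<in> chart_dom c" using coverU by blast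
  then have c': "chart_dom c \<noteq> {}" by blast
  \<comment> \<open>The reference leaf. Being without holonomy, it also guarantees that at least one
    leaf is under consideration, on which uniqueness of the type rests.\<close>
  obtain z0 where z0: "stable (c, z0)" using stable_exists[OF c(1) c'] by blast
  define good where "good v \<longleftrightarrow> v \<in> vertices \<and> region v \<subseteq> union_without_holonomy X n \<A> \<U>" for v
  have good_stable: "good v" if v: "stable v" for v
  proof -
    have vV: "v \<in> vertices" using v unfolding stable_def by blast
    then have "region v \<in> {L \<in> leaves X n \<A>. without_holonomy \<U> L}"
      using stable_without_holonomy[OF v] unfolding leaves_eq by blast
    then show ?thesis unfolding good_def union_without_holonomy_def using vV by blast
  qed
  \<comment> \<open>By minimality every leaf is dense, so the quasi-isometries are available between
    all leaves under consideration.\<close>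
  have "union_dense_without_holonomy X n \<A> \<U> = union_without_holonomy X n \<A> \<U>"
    using assms(3) unfolding union_dense_without_holonomy_def union_without_holonomy_def minimal_foliation_def
    by (intro arg_cong[where f = Union]) blast
  then have fam: "(region v, dst) \<in> {(L, leaf_dist X n \<A> \<U>) | L.
      L \<in> leaves X n \<A> \<and> L \<subseteq> union_dense_without_holonomy X n \<A> \<U>}" if "good v" for v
    using that unfolding good_def leaves_eq by blast
  from assms(5)[unfolded equi_coarsely_quasi_isometric_def] obtain K C where KC: "K \<ge> 0" "C \<ge> 1"
    and equi: "\<forall>(M, d) \<in> {(L, leaf_dist X n \<A> \<U>) | L. L \<in> leaves X n \<A> \<and> L \<subseteq> union_dense_without_holonomy X n \<A> \<U>}.
      \<forall>(M', d') \<in> {(L, leaf_dist X n \<A> \<U>) | L. L \<in> leaves X n \<A> \<and> L \<subseteq> union_dense_without_holonomy X n \<A> \<U>}.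
        \<exists>A A' f. coarse_quasi_isometry K C M d M' d' A A' f" by (elim exE conjE bexE)
  have cqi: "\<exists>A A' f. coarse_quasi_isometry K C (region v) dst (region w) dst A A' f" if "good v" "good w" for v w
    using bspec[OF bspec[OF equi fam[OF that(1)], unfolded prod.case] fam[OF that(2)]] by simp
  have transfer: "\<exists>F. finite F \<and> branch k F w" if "good v" "good w" "\<exists>F. finite F \<and> branch k F v" for v w k
    using cqi[OF that(1,2)] branch_quasi_isometry_invariant(1)[OF _ _ KC] that unfolding good_def by blast
  let ?u = "(c, z0)"
  have u: "good ?u" by (rule good_stable[OF z0])
  have ex: "\<exists>t. \<forall>v. good v \<longrightarrow> has_end_type (?E v) t"
  proof (cases "\<exists>F. finite F \<and> branch 3 F ?u")
    case False
    \<comment> \<open>The largest possible number of infinite pieces around a finite set; since 3 is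
      excluded it is at most 2.\<close>
    obtain k where k: "k \<le> 2" "\<exists>F. finite F \<and> branch k F ?u" "\<not> (\<exists>F. finite F \<and> branch (Suc k) F ?u)"
    proof -
      let ?B = "\<lambda>k. \<exists>F. finite F \<and> branch k F ?u"
      have "?B 0" using branch_0[of "{}" ?u] by blast
      moreover have "\<not> ?B (Suc 2)" using False by simp
      ultimately consider "\<not> ?B (Suc 0)" | "?B (Suc 0)" "\<not> ?B (Suc (Suc 0))" | "?B (Suc (Suc 0))" by blast
      then show ?thesis
      proof cases
        case 1 then show ?thesis using that[of 0] \<open>?B 0\<close> by blast
      next
        case 2 then show ?thesis using that[of "Suc 0"] by simp
      next
        case 3 then show ?thesis using that[of "Suc (Suc 0)"] \<open>\<not> ?B (Suc 2)\<close> by (simp add: numeral_2_eq_2)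
      qed
    qed
    have card: "card (topspace (?E v)) = k \<and> finite (topspace (?E v))" if v: "good v" for v
    proof -
      have vV: "v \<in> vertices" using v unfolding good_def by blast
      obtain F where F: "finite F" "branch k F v" using transfer[OF u v k(2)] by blast
      have "\<not> branch (Suc k) F v" if "finite F" for F using transfer[OF v u, of "Suc k"] k(3) that by blast
      then show ?thesis using card_ends_of_branch[OF vV F(2,1)] by blast
    qed
    consider "k = 0" | "k = 1" | "k = 2" using k(1) by linarith
    then show ?thesis
    proof cases
      case 1
      \<comment> \<open>\<open>card\<close> is 0 on infinite sets too, so emptiness rests on the
        finiteness in \<open>card\<close>'s companion claim.\<close>
      have "has_end_type (?E v) Zero_Ends" if "good v" for v
        unfolding has_end_type.simps using card[OF that] 1 card_0_eq by metis
      then show ?thesis by blast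
    next
      case 2
      then have "has_end_type (?E v) One_End" if "good v" for v using card[OF that] by simp
      then show ?thesis by blast
    next
      case 3
      then have "has_end_type (?E v) Two_Ends" if "good v" for v using card[OF that] by simp
      then show ?thesis by blast
    qed
  next
    case True
    have "\<exists>R. branch 3 (disc (c, z) R) (c, z)" if z: "stable (c, z)" for z
    proof -
      obtain F where "finite F" "branch 3 F (c, z)" using transfer[OF u good_stable[OF z] True] by blast
      moreover have "(c, z) \<in> vertices" using z unfolding stable_def by blast
      ultimately show ?thesis using branch_imp_disc by blast
    qed
    \<comment> \<open>The uniform scale is obtained on the stable leaf; quasi-isometry moves it to
      leaves whose vertices need not be stable.\<close>
    then obtain R where R: "\<And>v. v \<in> leaf ?u \<Longrightarrow> branch 3 (disc v R) v"
      using uniform_branch_leaf[OF assms(3) c(1) c' _ z0, of 3] by blast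
    have "has_end_type (?E v) Cantor_Ends" if v: "good v" for v
    proof -
      have V: "v \<in> vertices" "?u \<in> vertices" using v u unfolding good_def by auto
      obtain A A' f where f: "coarse_quasi_isometry K C (region ?u) dst (region v) dst A A' f"
        using cqi[OF u v] by blast
      obtain R' where "\<forall>w\<in>leaf v. branch 3 (disc w R') w"
        using branch_quasi_isometry_invariant(2)[OF V(2,1) KC f R] by blast
      then have "cantor_space (?E v)" using cantor_ends_of_uniform_branch[OF V(1), of R'] by blast
      then show ?thesis by simp
    qed
    then show ?thesis by blast
  qed
  have iff: "(\<forall>L \<in> leaves X n \<A>. L \<subseteq> union_without_holonomy X n \<A> \<U> \<longrightarrow> has_end_type (leaf_end_space X n \<A> L) t)
      \<longleftrightarrow> (\<forall>v. good v \<longrightarrow> has_end_type (?E v) t)" for t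
    unfolding leaves_eq good_def leaf_end_space_def by blast
  show ?thesis unfolding iff
  proof (rule ex_ex1I[OF ex])
    fix t t' assume "\<forall>v. good v \<longrightarrow> has_end_type (?E v) t" "\<forall>v. good v \<longrightarrow> has_end_type (?E v) t'"
    then show "t = t'" using has_end_type_unique u by blast
  qed
qed

end
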